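(* Let $F$ be a field of characteristic zero, $\Omega$ a set, $P_\Omega=F[x_\omega]_{\omega\in\Omega}$, $A=P_\Omega/I$, $n\ge1$, and $G=GL(n,F)$. Then $V_n(A)^G$ is generated as an $F$-algebra by the traces $\mathrm{tr}(\pi_n^A(\bar\mu))$ of the images of monomials $\mu$ in the $x_\omega$ (i.e. traces of monomials in the generic matrices $\xi^A_\omega=\pi_n^A(\bar x_\omega)$). Moreover, letting $F[T_\mu]$ be the polynomial ring on indeterminates $T_\mu$ indexed by the nonconstant monomials $\mu$, and $\tau:F[T_\mu]\to V_n(A)^G$, $T_\mu\mapsto\mathrm{tr}(\pi_n^A(\bar\mu))$, with $T(h):=c_0n+\sum_\mu c_\mu T_\mu$ for $h=c_0+\sum_\mu c_\mu\mu\in P_\Omega$, the kernel of $\tau$ is the ideal generated by (a) the elements $\Psi_{n+1}(h_1,\dots,h_{n+1}):=\sum_{\sigma\in S_{n+1}}\epsilon_\sigma\prod_{(j_1\cdots j_l)}T(h_{j_1}\cdots h_{j_l})$, for all $h_1,\dots,h_{n+1}\in P_\Omega$, where the product runs over the cycles $(j_1\cdots j_l)$ of $\sigma$ (including fixed points) and $\epsilon_\sigma$ is the sign; and (b) the elements $T(f)$ with $f\in I$. The analogous statement holds for $TS^n_F(A)$ with $\mathrm{tr}(\pi_n^A(a))$ replaced by $e_1^n(a)$.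
   Context: $V_n(A)$, with universal representation $\pi_n^A:A\to\mathrm{Mat}(n,V_n(A))$, represents $n$-dimensional representations of $A$: $\rho\mapsto\mathrm{Mat}(n,\rho)\circ\pi_n^A$ is a bijection $\mathrm{Hom}(V_n(A),B)\to\mathrm{Hom}(A,\mathrm{Mat}(n,B))$ for all commutative $F$-algebras $B$. $G$ acts on $V_n(A)$ by the action induced from conjugation of representations; $V_n(A)^G$ denotes the invariants. $\bar h$ denotes the image in $A$ of $h\in P_\Omega$. $TS^n_F(A)=(A^{\otimes n})^{S_n}$ and $e_1^n(a)=\sum_{k=1}^n1^{\otimes(k-1)}\otimes a\otimes1^{\otimes(n-k)}$. *)

theory Defs
  imports "HOL-Analysis.Analysis" "HOL-Library.Poly_Mapping"
    "HOL-Combinatorics.Permutations" "HOL-Combinatorics.Orbits"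
begin

type_synonym ('v,'k) mpoly = "('v \<Rightarrow>\<^sub>0 nat) \<Rightarrow>\<^sub>0 'k"

definition pconst :: "'k::comm_ring_1 \<Rightarrow> ('v,'k) mpoly" where
  "pconst c = Poly_Mapping.single 0 c"

definition pvar :: "'v \<Rightarrow> ('v,'k::comm_ring_1) mpoly" where
  "pvar v = Poly_Mapping.single (Poly_Mapping.single v 1) 1"

definition pmon :: "('v \<Rightarrow>\<^sub>0 nat) \<Rightarrow> ('v,'k::comm_ring_1) mpoly" where
  "pmon m = Poly_Mapping.single m 1"

definition poly_eval :: "('v \<Rightarrow> ('u,'k::comm_ring_1) mpoly) \<Rightarrow> ('v,'k) mpoly \<Rightarrow> ('u,'k) mpoly" where
  "poly_eval s p = (\<Sum>mm\<in>Poly_Mapping.keys p. pconst (Poly_Mapping.lookup p mm) * (\<Prod>x\<in>Poly_Mapping.keys mm. s x ^ Poly_Mapping.lookup mm x))"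

definition ideal_span :: "'a::comm_ring_1 set \<Rightarrow> 'a set \<Rightarrow> 'a set" where
  "ideal_span R S = {x. \<exists>l. set l \<subseteq> R \<times> S \<and> x = sum_list (map (\<lambda>(r,s). r * s) l)}"

definition is_ideal :: "'a::comm_ring_1 set \<Rightarrow> bool" where
  "is_ideal I \<longleftrightarrow> 0 \<in> I \<and> (\<forall>x\<in>I. \<forall>y\<in>I. x + y \<in> I) \<and> (\<forall>r. \<forall>x\<in>I. r * x \<in> I)"

text \<open>Evaluation of polynomials of P_Omega at n x n matrices (the images of the
  variables are assumed to commute modulo the relevant ideal, so any fixed order
  of the factors in a monomial may be used; we fix one by choice).\<close>
definition mono_list :: "('w \<Rightarrow>\<^sub>0 nat) \<Rightarrow> 'w list" where
  "mono_list m = (SOME xs. \<forall>w. count_list xs w = Poly_Mapping.lookup m w)"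

definition mat_scal :: "'a::semiring_1 \<Rightarrow> 'a^'n^'n \<Rightarrow> 'a^'n^'n" where
  "mat_scal c M = (\<chi> i j. c * M $ i $ j)"

definition eval_mon :: "('w \<Rightarrow> 'a::semiring_1^'n^'n) \<Rightarrow> ('w \<Rightarrow>\<^sub>0 nat) \<Rightarrow> 'a^'n^'n" where
  "eval_mon X m = foldr (\<lambda>w M. X w ** M) (mono_list m) (mat 1)"

definition eval_mat :: "('w \<Rightarrow> ('u,'k::comm_ring_1) mpoly^'n^'n) \<Rightarrow> ('w,'k) mpoly
    \<Rightarrow> ('u,'k) mpoly^'n^'n" where
  "eval_mat X p = (\<Sum>m\<in>Poly_Mapping.keys p. mat_scal (pconst (Poly_Mapping.lookup p m)) (eval_mon X m))"

text \<open>The representation space V_n(A), A = P_Omega / I, presented as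
  F[x_(w,i,j)] / J_n(I); generic matrices xi_w = (x_(w,i,j)).\<close>
definition generic :: "'w \<Rightarrow> (('w \<times> 'n \<times> 'n),'k::comm_ring_1) mpoly^'n^'n" where
  "generic w = (\<chi> i j. pvar (w, i, j))"

definition rep_ideal :: "('w,'k::comm_ring_1) mpoly set \<Rightarrow> (('w \<times> 'n::finite \<times> 'n),'k) mpoly set" where
  "rep_ideal I = ideal_span UNIV
     ({(generic w ** generic w' - generic w' ** generic w) $ i $ j | w w' i j. True}
      \<union> {eval_mat generic f $ i $ j | f i j. f \<in> I})"

definition const_mat :: "'k::comm_ring_1^'n^'n \<Rightarrow> ('u,'k) mpoly^'n^'n" where
  "const_mat g = (\<chi> i j. pconst (g $ i $ j))"

definition gl_act :: "'k::field^'n::finite^'n \<Rightarrow> (('w \<times> 'n \<times> 'n),'k) mpoly \<Rightarrow> (('w \<times> 'n \<times> 'n),'k) mpoly" where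
  "gl_act g p = poly_eval (\<lambda>(w,i,j). (const_mat g ** generic w ** const_mat (matrix_inv g)) $ i $ j) p"

definition rep_invariant :: "('w,'k::field) mpoly set \<Rightarrow> (('w \<times> 'n::finite \<times> 'n),'k) mpoly \<Rightarrow> bool" where
  "rep_invariant I p \<longleftrightarrow> (\<forall>g::'k^'n^'n. invertible g \<longrightarrow> gl_act g p - p \<in> rep_ideal I)"

definition tr_mon :: "('w \<Rightarrow>\<^sub>0 nat) \<Rightarrow> (('w \<times> 'n::finite \<times> 'n),'k::comm_ring_1) mpoly" where
  "tr_mon m = trace (eval_mon generic m)"

text \<open>A^{tensor n} presented as F[x_(w,k)] / J'_n(I), k ranging over n copies.\<close>
definition copy_var :: "'n \<Rightarrow> 'w \<Rightarrow> (('w \<times> 'n),'k::comm_ring_1) mpoly" where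
  "copy_var k w = pvar (w, k)"

definition tens_ideal :: "('w,'k::comm_ring_1) mpoly set \<Rightarrow> (('w \<times> 'n::finite),'k) mpoly set" where
  "tens_ideal I = ideal_span UNIV {poly_eval (copy_var k) f | f k. f \<in> I}"

definition sym_act :: "('n \<Rightarrow> 'n) \<Rightarrow> (('w \<times> 'n),'k::comm_ring_1) mpoly \<Rightarrow> (('w \<times> 'n),'k) mpoly" where
  "sym_act s p = poly_eval (\<lambda>(w,k). pvar (w, s k)) p"

definition tens_invariant :: "('w,'k::comm_ring_1) mpoly set \<Rightarrow> (('w \<times> 'n::finite),'k) mpoly \<Rightarrow> bool" where
  "tens_invariant I p \<longleftrightarrow> (\<forall>s. s permutes (UNIV::'n set) \<longrightarrow> sym_act s p - p \<in> tens_ideal I)"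

definition e1_mon :: "('w \<Rightarrow>\<^sub>0 nat) \<Rightarrow> (('w \<times> 'n::finite),'k::comm_ring_1) mpoly" where
  "e1_mon m = (\<Sum>k\<in>UNIV. poly_eval (copy_var k) (pmon m))"

definition TPoly :: "(('w \<Rightarrow>\<^sub>0 nat),'k::comm_ring_1) mpoly set" where
  "TPoly = {Phi. \<forall>m\<in>Poly_Mapping.keys Phi. \<forall>mu\<in>Poly_Mapping.keys m. mu \<noteq> 0}"

definition Tlin :: "nat \<Rightarrow> ('w,'k::comm_ring_1) mpoly \<Rightarrow> (('w \<Rightarrow>\<^sub>0 nat),'k) mpoly" where
  "Tlin n h = pconst (of_nat n * Poly_Mapping.lookup h 0)
     + (\<Sum>mu\<in>Poly_Mapping.keys h - {0}. pconst (Poly_Mapping.lookup h mu) * pvar mu)"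

text \<open>Psi_{n+1}(h_0,...,h_n): sum over sigma in S_{n+1} of sign times the product over
  the cycles (orbits, including fixed points) of T of the product of the h_j in the cycle.\<close>
definition Psi :: "nat \<Rightarrow> (nat \<Rightarrow> ('w,'k::comm_ring_1) mpoly) \<Rightarrow> (('w \<Rightarrow>\<^sub>0 nat),'k) mpoly" where
  "Psi n h = (\<Sum>\<sigma>\<in>{\<sigma>. \<sigma> permutes {..n}}.
      of_int (sign \<sigma>) * (\<Prod>c\<in>orbit \<sigma> ` {..n}. Tlin n (\<Prod>j\<in>c. h j)))"

definition trace_relations :: "nat \<Rightarrow> ('w,'k::comm_ring_1) mpoly set \<Rightarrow> (('w \<Rightarrow>\<^sub>0 nat),'k) mpoly set" where
  "trace_relations n I = ideal_span TPoly
     ({Psi n h | h. True} \<union> {Tlin n f | f. f \<in> I})"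

end

(* A trace polynomial in commuting matrices only depends on commutative monomials, so everything is
   a computation with the symmetric expressions Psi_k(h_1, ..., h_k), which satisfy
     Psi_(k+1)(h_1, ..., h_k, g) = T(g) Psi_k(h_1, ..., h_k) - sum_b Psi_k(h_1, ..., h_b g, ..., h_k).

   Multisymmetric functions.  The recursion shows that the linear map Theta with
   mu_1 (x) ... (x) mu_n |-> Psi_n(mu_1, ..., mu_n) is F[T]-linear modulo the relations; as
   Psi_n(1, ..., 1) = n!, it is n! times a left inverse of T_mu |-> e_1(mu), and it sends the ideal
   of TS^n to the trace relations.  In the other order the composite is the sum over S_n.

   Matrices.  The trace of the antisymmetrizer on n+1 factors vanishes and satisfies the same
   recursion, so the relations hold for commuting matrices; restriction to diagonal matrices reduces
   the converse to the case of TS^n.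

   Generation of the invariants.  An invariant modulo the ideal J is killed modulo J by the Lie
   algebra, hence by the Casimir operator C.  On products of d matrix entries, C = D - (contractions),
   where contractions have fewer factors and D is positive definite over the rationals, so D is a
   root of a polynomial with constant term 1.  By induction on d every element is sent into the trace
   ring (modulo J) by some h(C) with h(0) = 1; for an invariant p one has h(C) p = p modulo J. *)
theory Submission
  imports Defs "HOL-Computational_Algebra.Polynomial"
begin

section \<open>Polynomials, evaluation homomorphisms and ideals\<close>

text \<open>An invariant of the quotient V_n(A) is not given as the image of an invariant
  polynomial, and there is no direct averaging over GL(n,F). The Casimir operator takes the place of
  both a lifting and an averaging argument: it preserves J, so every polynomial in it acts modulo J.
  Positivity makes sense only over an ordered field, but D acts on index tuples with integral
  coefficients; the polynomial that kills a vector is therefore found over the rationals and then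
  mapped into F. The constant term 1 is what remains of h(C) p when C p vanishes modulo J. The
  kernels form a circle: restriction to diagonal matrices sends relations among traces to relations
  among the e_1(mu), Theta places these in the ideal of (a) and (b), and the antisymmetrizer leads
  from that ideal back to relations among traces. Quotient rings are never formed; all arguments use
  representatives and congruences.\<close>

definition ring_map :: "('a::comm_ring_1 \<Rightarrow> 'b::comm_ring_1) \<Rightarrow> bool" where
  "ring_map f \<longleftrightarrow> f 1 = 1 \<and> (\<forall>x y. f (x + y) = f x + f y) \<and> (\<forall>x y. f (x * y) = f x * f y)"

lemma ring_mapI:
  assumes "f 1 = 1" "\<And>x y. f (x + y) = f x + f y" "\<And>x y. f (x * y) = f x * f y"
  shows "ring_map f"
  using assms by (simp add: ring_map_def)

lemma ring_map_1: "ring_map f \<Longrightarrow> f 1 = 1"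
  and ring_map_add: "ring_map f \<Longrightarrow> f (x + y) = f x + f y"
  and ring_map_mult: "ring_map f \<Longrightarrow> f (x * y) = f x * f y"
  by (auto simp: ring_map_def)

lemma ring_map_0: assumes "ring_map f" shows "f 0 = 0"
  using ring_map_add[OF assms, of 0 0] by simp

lemma ring_map_uminus: assumes "ring_map f" shows "f (- x) = - f x"
proof -
  have "f (- x) + f x = 0"
    unfolding ring_map_add[OF assms, symmetric] by (simp add: ring_map_0[OF assms])
  then show ?thesis by (simp add: eq_neg_iff_add_eq_0)
qed

lemma ring_map_diff: "ring_map f \<Longrightarrow> f (x - y) = f x - f y"
  using ring_map_add[of f x "- y"] ring_map_uminus[of f y] by simp

lemma ring_map_sum: "ring_map f \<Longrightarrow> f (sum g S) = (\<Sum>x\<in>S. f (g x))"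
  by (induction S rule: infinite_finite_induct) (auto simp: ring_map_0 ring_map_add)

lemma ring_map_prod: "ring_map f \<Longrightarrow> f (prod g S) = (\<Prod>x\<in>S. f (g x))"
  by (induction S rule: infinite_finite_induct) (auto simp: ring_map_1 ring_map_mult)

lemma ring_map_power: "ring_map f \<Longrightarrow> f (x ^ n) = f x ^ n"
  by (induction n) (auto simp: ring_map_1 ring_map_mult)

lemma ring_map_of_int: assumes "ring_map f" shows "f (of_int z) = of_int z"
proof -
  have n: "f (of_nat n) = of_nat n" for n
    by (induction n) (auto simp: ring_map_0 ring_map_1 ring_map_add assms)
  show ?thesis by (cases z rule: int_cases2) (auto simp: n ring_map_uminus[OF assms])
qed

lemma ring_map_comp: "ring_map f \<Longrightarrow> ring_map g \<Longrightarrow> ring_map (\<lambda>x. f (g x))"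
  by (simp add: ring_map_def)

lemma ring_map_pconst: "ring_map (pconst :: 'k::comm_ring_1 \<Rightarrow> ('v,'k) mpoly)"
  by (simp add: ring_map_def pconst_def single_add mult_single)

lemmas pconst_add = ring_map_add[OF ring_map_pconst]
  and pconst_mult = ring_map_mult[OF ring_map_pconst]
  and pconst_0 [simp] = ring_map_0[OF ring_map_pconst]
  and pconst_1 [simp] = ring_map_1[OF ring_map_pconst]
  and pconst_uminus = ring_map_uminus[OF ring_map_pconst]
  and pconst_diff = ring_map_diff[OF ring_map_pconst]
  and pconst_sum = ring_map_sum[OF ring_map_pconst]
  and pconst_of_int = ring_map_of_int[OF ring_map_pconst]

lemma single_eq_pconst: "Poly_Mapping.single m c = pconst c * pmon m"
  by (simp add: pconst_def pmon_def mult_single)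

lemma pmon_add: "pmon (m + m') = (pmon m * pmon m' :: ('v,'k::comm_ring_1) mpoly)"
  by (simp add: pmon_def mult_single)

lemma pmon_0 [simp]: "pmon 0 = 1"
  by (simp add: pmon_def)

lemma pconst_cancel:
  assumes "(c::'k::field) \<noteq> 0" shows "pconst (inverse c) * (pconst c * p) = p"
  using assms by (simp add: mult.assoc[symmetric] pconst_mult[symmetric])

lemma mpoly_monomial_induct [case_names single add]:
  assumes "\<And>m c. P (Poly_Mapping.single m c)" and "\<And>p q. P p \<Longrightarrow> P q \<Longrightarrow> P (p + q)"
  shows "P (p :: ('v,'k::comm_ring_1) mpoly)"
proof (induction p rule: Poly_Mapping.update_induct)
  case const
  show ?case using assms(1)[of 0 0] by simp
next
  case (update f a b)
  have "Poly_Mapping.update a b f = f + Poly_Mapping.single a b"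
    using update(1)
    by (intro poly_mapping_eqI) (auto simp: lookup_update lookup_add lookup_single in_keys_iff when_def)
  then show ?case using assms update by simp
qed

lemma additive_eq_sum:
  fixes f :: "('v,'k::comm_ring_1) mpoly \<Rightarrow> 'b::ab_group_add"
  assumes "\<And>p q. f (p + q) = f p + f q"
  shows "f p = (\<Sum>m\<in>Poly_Mapping.keys p. f (Poly_Mapping.single m (Poly_Mapping.lookup p m)))"
proof -
  have f0: "f 0 = 0" using assms[of 0 0] by simp
  have sup: "(\<Sum>m\<in>Poly_Mapping.keys p. f (Poly_Mapping.single m (Poly_Mapping.lookup p m)))
     = (\<Sum>m\<in>S. f (Poly_Mapping.single m (Poly_Mapping.lookup p m)))"
    if "finite S" "Poly_Mapping.keys p \<subseteq> S" for S p
    using that by (intro sum.mono_neutral_left) (auto simp: in_keys_iff f0)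
  show ?thesis
  proof (induction p rule: mpoly_monomial_induct)
    case (single m c)
    then show ?case by (cases "c = 0") (auto simp: f0)
  next
    case (add p q)
    let ?S = "Poly_Mapping.keys p \<union> Poly_Mapping.keys q"
    have "Poly_Mapping.keys (p + q) \<subseteq> ?S" by (rule Poly_Mapping.keys_add)
    then have "(\<Sum>m\<in>Poly_Mapping.keys (p + q). f (Poly_Mapping.single m (Poly_Mapping.lookup (p + q) m)))
       = (\<Sum>m\<in>?S. f (Poly_Mapping.single m (Poly_Mapping.lookup (p + q) m)))"
      by (intro sup) auto
    also have "\<dots> = (\<Sum>m\<in>?S. f (Poly_Mapping.single m (Poly_Mapping.lookup p m)))
        + (\<Sum>m\<in>?S. f (Poly_Mapping.single m (Poly_Mapping.lookup q m)))"
      by (simp add: lookup_add single_add assms sum.distrib)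
    also have "\<dots> = f p + f q"
      by (subst (1 2) sup[symmetric]) (auto simp: add[symmetric])
    finally show ?case by (simp add: assms)
  qed
qed

section \<open>Evaluation homomorphisms of polynomial rings\<close>

definition mon_eval :: "('v \<Rightarrow> 'b::comm_ring_1) \<Rightarrow> ('v \<Rightarrow>\<^sub>0 nat) \<Rightarrow> 'b" where
  "mon_eval s m = (\<Prod>x\<in>Poly_Mapping.keys m. s x ^ Poly_Mapping.lookup m x)"

lemma mon_eval_superset:
  assumes "finite S" "Poly_Mapping.keys m \<subseteq> S"
  shows "mon_eval s m = (\<Prod>x\<in>S. s x ^ Poly_Mapping.lookup m x)"
  unfolding mon_eval_def using assms
  by (intro prod.mono_neutral_left) (auto simp: in_keys_iff)

lemma mon_eval_0 [simp]: "mon_eval s 0 = 1"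
  by (simp add: mon_eval_def)

lemma mon_eval_single [simp]: "mon_eval s (Poly_Mapping.single x k) = s x ^ k"
  by (cases "k = 0") (auto simp: mon_eval_def)

lemma mon_eval_add: "mon_eval s (m + m') = mon_eval s m * mon_eval s m'"
proof -
  let ?S = "Poly_Mapping.keys m \<union> Poly_Mapping.keys m'"
  have "Poly_Mapping.keys (m + m') \<subseteq> ?S" by (rule Poly_Mapping.keys_add)
  then show ?thesis
    by (subst (1 2 3) mon_eval_superset[where S = ?S])
      (auto simp: lookup_add power_add prod.distrib)
qed

lemma mon_eval_ring_map: "ring_map f \<Longrightarrow> f (mon_eval s m) = mon_eval (\<lambda>x. f (s x)) m"
  by (simp add: mon_eval_def ring_map_prod ring_map_power)

text \<open>The coefficient map \<open>c\<close> is a parameter because two kinds of target occur: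
  polynomial rings over the same field, and polynomials in t over such a ring, used later to
  differentiate one-parameter groups.\<close>

definition hom_eval :: "('k \<Rightarrow> 'b::comm_ring_1) \<Rightarrow> ('v \<Rightarrow> 'b) \<Rightarrow> ('v,'k::comm_ring_1) mpoly \<Rightarrow> 'b" where
  "hom_eval c s p = (\<Sum>m\<in>Poly_Mapping.keys p. c (Poly_Mapping.lookup p m) * mon_eval s m)"

lemma poly_eval_eq: "poly_eval s = hom_eval pconst s"
  by (rule ext) (simp add: poly_eval_def hom_eval_def mon_eval_def)

lemma hom_eval_single:
  "ring_map c \<Longrightarrow> hom_eval c s (Poly_Mapping.single m a) = c a * mon_eval s m"
  by (cases "a = 0") (auto simp: hom_eval_def ring_map_0)

lemma hom_eval_superset:
  assumes "ring_map c" "finite S" "Poly_Mapping.keys p \<subseteq> S"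
  shows "hom_eval c s p = (\<Sum>m\<in>S. c (Poly_Mapping.lookup p m) * mon_eval s m)"
  unfolding hom_eval_def using assms
  by (intro sum.mono_neutral_left) (auto simp: in_keys_iff ring_map_0)

lemma hom_eval_add:
  assumes "ring_map c"
  shows "hom_eval c s (p + q) = hom_eval c s p + hom_eval c s q"
proof -
  let ?S = "Poly_Mapping.keys p \<union> Poly_Mapping.keys q"
  have "Poly_Mapping.keys (p + q) \<subseteq> ?S" by (rule Poly_Mapping.keys_add)
  then show ?thesis
    by (subst (1 2 3) hom_eval_superset[where S = ?S, OF assms])
      (auto simp: lookup_add ring_map_add[OF assms] algebra_simps sum.distrib)
qed

lemma ring_map_hom_eval:
  assumes c: "ring_map c"
  shows "ring_map (hom_eval c s)"
proof (rule ring_mapI)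
  show "hom_eval c s 1 = 1"
    unfolding single_one[symmetric] by (subst hom_eval_single) (auto simp: c ring_map_1)
next
  fix p q show "hom_eval c s (p + q) = hom_eval c s p + hom_eval c s q"
    by (rule hom_eval_add[OF c])
next
  fix p q
  show "hom_eval c s (p * q) = hom_eval c s p * hom_eval c s q"
  proof (induction p rule: mpoly_monomial_induct)
    case (single m a)
    show ?case
    proof (induction q rule: mpoly_monomial_induct)
      case (single m' b)
      show ?case
        by (simp add: mult_single hom_eval_single c ring_map_mult mon_eval_add ac_simps)
    qed (simp add: distrib_left hom_eval_add c)
  qed (simp add: distrib_right hom_eval_add c)
qed

lemma hom_eval_pconst: "ring_map c \<Longrightarrow> hom_eval c s (pconst a) = c a"
  by (simp add: pconst_def hom_eval_single)

lemma hom_eval_pvar: "ring_map c \<Longrightarrow> hom_eval c s (pvar v) = s v"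
  by (simp add: pvar_def hom_eval_single ring_map_1)

lemma hom_eval_pmon: "ring_map c \<Longrightarrow> hom_eval c s (pmon m) = mon_eval s m"
  by (simp add: pmon_def hom_eval_single ring_map_1)

lemma ring_map_poly_eval: "ring_map (poly_eval s)"
  unfolding poly_eval_eq by (rule ring_map_hom_eval[OF ring_map_pconst])

lemma poly_eval_pconst [simp]: "poly_eval s (pconst a) = pconst a"
  unfolding poly_eval_eq by (rule hom_eval_pconst[OF ring_map_pconst])

lemma poly_eval_pvar [simp]: "poly_eval s (pvar v) = s v"
  unfolding poly_eval_eq by (rule hom_eval_pvar[OF ring_map_pconst])

lemma poly_eval_pmon [simp]: "poly_eval s (pmon m) = mon_eval s m"
  unfolding poly_eval_eq by (rule hom_eval_pmon[OF ring_map_pconst])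

lemma pmon_eq_mon_eval: "(pmon m :: ('v,'k::comm_ring_1) mpoly) = mon_eval pvar m"
proof (induction m rule: Poly_Mapping.update_induct)
  case const
  then show ?case by simp
next
  case (update f a b)
  have "Poly_Mapping.update a b f = f + Poly_Mapping.single a b"
    using update(1)
    by (intro poly_mapping_eqI) (auto simp: lookup_update lookup_add lookup_single in_keys_iff when_def)
  moreover have "(pmon (Poly_Mapping.single a b) :: ('v,'k) mpoly) = pvar a ^ b" for b
  proof (induction b)
    case (Suc b)
    have "Poly_Mapping.single a (Suc b) = Poly_Mapping.single a 1 + Poly_Mapping.single a b"
      by (simp add: single_add[symmetric])
    then show ?case using Suc by (simp add: pmon_add) (simp add: pvar_def pmon_def)
  qed simp
  ultimately show ?case using update by (simp add: pmon_add mon_eval_add)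
qed

lemma mpoly_induct [case_names const var add mult]:
  assumes const: "\<And>c. P (pconst c)" and var: "\<And>v. P (pvar v)"
    and add: "\<And>p q. P p \<Longrightarrow> P q \<Longrightarrow> P (p + q)"
    and mult: "\<And>p q. P p \<Longrightarrow> P q \<Longrightarrow> P (p * q)"
  shows "P (p :: ('v,'k::comm_ring_1) mpoly)"
proof (induction p rule: mpoly_monomial_induct)
  case (single m c)
  have one: "P 1" using const[of 1] by simp
  have pow: "P (pvar v ^ n)" for v n by (induction n) (auto intro: one mult var)
  have "P (\<Prod>x\<in>S. pvar x ^ n x)" for S :: "'v set" and n
    by (induction S rule: infinite_finite_induct) (auto intro: one mult pow)
  then have "P (pmon m)" unfolding pmon_eq_mon_eval mon_eval_def by blast
  then show ?case unfolding single_eq_pconst by (intro mult const)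
qed (rule add)

lemma ring_map_eqI:
  fixes f g :: "('v,'k::comm_ring_1) mpoly \<Rightarrow> 'b::comm_ring_1"
  assumes "ring_map f" "ring_map g" "\<And>c. f (pconst c) = g (pconst c)" "\<And>v. f (pvar v) = g (pvar v)"
  shows "f p = g p"
  by (induction p rule: mpoly_induct) (simp_all add: assms ring_map_add ring_map_mult)

section \<open>Ideals and congruences\<close>

lemma is_ideal_0: "is_ideal J \<Longrightarrow> 0 \<in> J"
  and is_ideal_add: "is_ideal J \<Longrightarrow> x \<in> J \<Longrightarrow> y \<in> J \<Longrightarrow> x + y \<in> J"
  and is_ideal_mult: "is_ideal J \<Longrightarrow> x \<in> J \<Longrightarrow> r * x \<in> J"
  by (auto simp: is_ideal_def)

lemma is_ideal_mult_right: "is_ideal J \<Longrightarrow> x \<in> J \<Longrightarrow> x * r \<in> J"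
  by (metis is_ideal_mult mult.commute)

lemma is_ideal_uminus: "is_ideal J \<Longrightarrow> x \<in> J \<Longrightarrow> - x \<in> J"
  using is_ideal_mult[of J x "-1"] by simp

lemma is_ideal_diff: "is_ideal J \<Longrightarrow> x \<in> J \<Longrightarrow> y \<in> J \<Longrightarrow> x - y \<in> J"
  using is_ideal_add[of J x "- y"] is_ideal_uminus[of J y] by simp

lemma is_ideal_sum: "is_ideal J \<Longrightarrow> (\<And>x. x \<in> S \<Longrightarrow> f x \<in> J) \<Longrightarrow> sum f S \<in> J"
  by (induction S rule: infinite_finite_induct) (auto simp: is_ideal_0 is_ideal_add)

lemma ideal_span_0: "0 \<in> ideal_span R S"
  unfolding ideal_span_def by (auto intro!: exI[of _ "[]"])

lemma ideal_span_add: "x \<in> ideal_span R S \<Longrightarrow> y \<in> ideal_span R S \<Longrightarrow> x + y \<in> ideal_span R S"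
proof -
  assume "x \<in> ideal_span R S" "y \<in> ideal_span R S"
  then obtain l l' where "set l \<subseteq> R \<times> S" "x = sum_list (map (\<lambda>(r,s). r * s) l)"
    "set l' \<subseteq> R \<times> S" "y = sum_list (map (\<lambda>(r,s). r * s) l')"
    unfolding ideal_span_def by blast
  then show ?thesis unfolding ideal_span_def by (auto intro!: exI[of _ "l @ l'"])
qed

lemma ideal_span_base: "1 \<in> R \<Longrightarrow> s \<in> S \<Longrightarrow> s \<in> ideal_span R S"
  unfolding ideal_span_def by (auto intro!: exI[of _ "[(1,s)]"])

lemma ideal_span_induct [consumes 1, case_names zero add]:
  assumes "x \<in> ideal_span R S" "P 0"
    "\<And>r s x. r \<in> R \<Longrightarrow> s \<in> S \<Longrightarrow> P x \<Longrightarrow> P (r * s + x)"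
  shows "P x"
proof -
  obtain l where l: "set l \<subseteq> R \<times> S" "x = sum_list (map (\<lambda>(r,s). r * s) l)"
    using assms(1) unfolding ideal_span_def by blast
  show ?thesis unfolding l(2) using l(1) by (induction l) (auto intro: assms)
qed

text \<open>Stated for a multiplicatively closed \<open>R\<close> because the trace relations form
  an ideal of the subring \<open>TPoly\<close>, not of the whole polynomial ring, in which the
  constant monomial also indexes a variable.\<close>

lemma ideal_span_mult:
  assumes "\<And>a b. a \<in> R \<Longrightarrow> b \<in> R \<Longrightarrow> a * b \<in> R" "r \<in> R" "x \<in> ideal_span R S"
  shows "r * x \<in> ideal_span R S"
  using assms(3)
proof (induction rule: ideal_span_induct)
  case zero
  show ?case by (simp add: ideal_span_0)
next
  case (add r' s x)
  have "(r * r') * s \<in> ideal_span R S"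
    unfolding ideal_span_def using assms(1)[OF assms(2) add(1)] add(2)
    by (auto intro!: exI[of _ "[(r * r', s)]"])
  with add(3) show ?case by (simp add: distrib_left mult.assoc ideal_span_add)
qed

lemma is_ideal_ideal_span: "is_ideal (ideal_span UNIV S)"
  unfolding is_ideal_def by (auto intro: ideal_span_0 ideal_span_add ideal_span_mult)

lemma ideal_span_UNIV_minimal:
  assumes "x \<in> ideal_span UNIV S" "is_ideal J" "S \<subseteq> J"
  shows "x \<in> J"
  using assms(1)
  by (induction rule: ideal_span_induct) (use assms(2,3) in \<open>auto simp: is_ideal_def\<close>)

lemma is_ideal_vimage:
  assumes "ring_map f" "is_ideal J" shows "is_ideal (f -` J)"
  using assms by (auto simp: is_ideal_def ring_map_0 ring_map_add ring_map_mult)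

text \<open>Congruence modulo an ideal replaces computations in the quotient ring.\<close>
definition cong_ideal :: "'a::comm_ring_1 set \<Rightarrow> 'a \<Rightarrow> 'a \<Rightarrow> bool" where
  "cong_ideal J x y \<longleftrightarrow> x - y \<in> J"

lemma cong_ideal_refl [simp]: "is_ideal J \<Longrightarrow> cong_ideal J x x"
  by (simp add: cong_ideal_def is_ideal_0)

lemma cong_ideal_trans: "is_ideal J \<Longrightarrow> cong_ideal J x y \<Longrightarrow> cong_ideal J y z \<Longrightarrow> cong_ideal J x z"
  unfolding cong_ideal_def using is_ideal_add[of J "x - y" "y - z"] by simp

lemma cong_ideal_add:
  "is_ideal J \<Longrightarrow> cong_ideal J x y \<Longrightarrow> cong_ideal J x' y' \<Longrightarrow> cong_ideal J (x + x') (y + y')"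
  unfolding cong_ideal_def using is_ideal_add[of J "x - y" "x' - y'"] by (simp add: algebra_simps)

lemma cong_ideal_diff:
  "is_ideal J \<Longrightarrow> cong_ideal J x y \<Longrightarrow> cong_ideal J x' y' \<Longrightarrow> cong_ideal J (x - x') (y - y')"
  unfolding cong_ideal_def using is_ideal_diff[of J "x - y" "x' - y'"] by (simp add: algebra_simps)

lemma cong_ideal_mult:
  assumes "is_ideal J" "cong_ideal J x y" "cong_ideal J x' y'"
  shows "cong_ideal J (x * x') (y * y')"
proof -
  have "x * x' - y * y' = x' * (x - y) + y * (x' - y')" by (simp add: algebra_simps)
  then show ?thesis
    using assms unfolding cong_ideal_def by (simp add: is_ideal_add is_ideal_mult)
qed

lemma cong_ideal_sum:
  "is_ideal J \<Longrightarrow> (\<And>x. x \<in> S \<Longrightarrow> cong_ideal J (f x) (g x)) \<Longrightarrow> cong_ideal J (sum f S) (sum g S)"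
  by (induction S rule: infinite_finite_induct) (auto intro: cong_ideal_add)

lemma cong_ideal_prod:
  "is_ideal J \<Longrightarrow> (\<And>x. x \<in> S \<Longrightarrow> cong_ideal J (f x) (g x)) \<Longrightarrow> cong_ideal J (prod f S) (prod g S)"
  by (induction S rule: infinite_finite_induct) (auto intro: cong_ideal_mult)

section \<open>Signed sums over permutations\<close>

text \<open>The sum defining Psi, with the number \<open>k\<close> of arguments freed from n and
  with an arbitrary \<open>T\<close> on a commutative monoid. The recursion runs through all
  \<open>k\<close>, and \<open>T\<close> will be \<open>Tlin n\<close>, a trace of evaluated
  matrices, or a sum of characters.\<close>

definition cyc_sum :: "('a::comm_monoid_mult \<Rightarrow> 'b::comm_ring_1) \<Rightarrow> nat \<Rightarrow> (nat \<Rightarrow> 'a) \<Rightarrow> 'b" where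
  "cyc_sum T k h = (\<Sum>\<sigma>\<in>{\<sigma>. \<sigma> permutes {..<k}}.
      of_int (sign \<sigma>) * (\<Prod>c\<in>orbit \<sigma> ` {..<k}. T (\<Prod>j\<in>c. h j)))"

lemma Psi_eq_cyc_sum: "Psi n h = cyc_sum (Tlin n) (Suc n) h"
  by (simp add: Psi_def cyc_sum_def lessThan_Suc_atMost)

text \<open>Since q fixes k, the product sends the preimage of b to k and k to b: the new point is
  spliced into the cycle of b just before b, and the other cycles stay as they are.\<close>

lemma orbit_transpose_comp:
  assumes q: "q permutes S" and k: "k \<notin> S" and b: "b \<in> S" and x: "x \<in> S"
  shows "orbit (Transposition.transpose k b \<circ> q) x = (if b \<in> orbit q x then insert k (orbit q x) else orbit q x)"
    (is "_ = ?O")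
proof -
  define s where "s = Transposition.transpose k b \<circ> q"
  have qk: "q k = k" using q k by (simp add: permutes_not_in)
  have sk: "s k = b" by (simp add: s_def qk)
  have sy: "s y = (if q y = b then k else q y)" if "y \<in> S" for y
    using that k q by (auto simp: s_def Transposition.transpose_def permutes_in_image)
  have sub: "orbit q x \<subseteq> S" by (rule permutes_orbit_subset[OF q x])
  have 1: "orbit s x \<subseteq> ?O"
  proof
    fix y assume "y \<in> orbit s x"
    then show "y \<in> ?O"
    proof induction
      case base
      then show ?case using orbit.base[of q x] unfolding sy[OF x] by auto
    next
      case (step y)
      then consider "y = k" "b \<in> orbit q x" | "y \<in> orbit q x" by (auto split: if_splits)
      then show ?case
      proof cases
        case 1
        then show ?thesis by (simp add: sk)
      next
        case 2
        then have "y \<in> S" using sub by auto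
        then show ?thesis using orbit.step[OF 2] unfolding sy[OF \<open>y \<in> S\<close>] by auto
      qed
    qed
  qed
  have *: "y \<in> orbit s x" if "y \<in> orbit q x" for y
    using that
  proof induction
    case base
    show ?case
    proof (cases "q x = b")
      case True
      have "k \<in> orbit s x" using orbit.base[of s x] unfolding sy[OF x] using True by simp
      from orbit.step[OF this] show ?thesis unfolding sk by (simp only: True)
    next
      case False
      then show ?thesis using orbit.base[of s x] unfolding sy[OF x] by simp
    qed
  next
    case (step y)
    then have y: "y \<in> S" using sub by auto
    show ?case
    proof (cases "q y = b")
      case True
      have "k \<in> orbit s x" using orbit.step[OF step.IH] unfolding sy[OF y] using True by simp
      from orbit.step[OF this] show ?thesis unfolding sk by (simp only: True)
    next
      case False
      then show ?thesis using orbit.step[OF step.IH] unfolding sy[OF y] by simp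
    qed
  qed
  have "k \<in> orbit s x" if "b \<in> orbit q x"
    using that
  proof cases
    case base
    then show ?thesis using orbit.base[of s x] unfolding sy[OF x] by simp
  next
    case (step y)
    then have y: "y \<in> S" using sub by auto
    show ?thesis using orbit.step[OF *[OF step(2)]] step(1) unfolding sy[OF y] by simp
  qed
  then have "?O \<subseteq> orbit s x" using * by auto
  with 1 show ?thesis unfolding s_def by (rule equalityI)
qed

text \<open>Splicing k into the cycle of b multiplies the product over that cycle by
  \<open>h k\<close>; by commutativity this factor can be credited to slot b.\<close>

lemma cyc_prod_transpose:
  fixes T :: "'a::comm_monoid_mult \<Rightarrow> 'b::comm_ring_1"
  assumes q: "q permutes S" and fin: "finite S" and k: "k \<notin> S" and b: "b \<in> S"
  shows "(\<Prod>c\<in>orbit (Transposition.transpose k b \<circ> q) ` insert k S. T (\<Prod>j\<in>c. h j))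
       = (\<Prod>c\<in>orbit q ` S. T (\<Prod>j\<in>c. (h(b := h b * h k)) j))"
proof -
  let ?s = "Transposition.transpose k b \<circ> q"
  \<comment> \<open>\<open>g\<close> matches the cycles of q with those of the new permutation, and
    deleting k inverts it. The point k adds no further cycle, because its orbit is that of
    b.\<close>
  define g where "g c = (if b \<in> c then insert k c else c)" for c
  have qk: "q k = k" using q k by (simp add: permutes_not_in)
  have "?s permutes insert k S"
    using b by (intro permutes_compose permutes_swap_id permutes_subset[OF q]) auto
  then have perm: "permutation ?s" using fin by (auto simp: permutation_permutes)
  have sub: "c \<subseteq> S" if "c \<in> orbit q ` S" for c using that permutes_orbit_subset[OF q] by auto
  have "orbit ?s k = orbit ?s b"
    using permutation_orbit_step[OF perm, of k] by (simp add: qk)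
  then have "orbit ?s ` insert k S = orbit ?s ` S" using b by auto
  also have "\<dots> = g ` (orbit q ` S)"
    unfolding image_image
    by (rule image_cong) (auto simp: orbit_transpose_comp[OF q k b] g_def)
  finally have im: "orbit ?s ` insert k S = g ` (orbit q ` S)" .
  have inj: "inj_on g (orbit q ` S)"
  proof (rule inj_on_inverseI[where g = "\<lambda>c. c - {k}"])
    fix c assume "c \<in> orbit q ` S"
    then show "g c - {k} = c" using sub k by (auto simp: g_def)
  qed
  have "(\<Prod>j\<in>g c. h j) = (\<Prod>j\<in>c. (h(b := h b * h k)) j)" if "c \<in> orbit q ` S" for c
  proof -
    have fc: "finite c" "k \<notin> c" using sub[OF that] fin k finite_subset by auto
    show ?thesis
    proof (cases "b \<in> c")
      case True
      have "(\<Prod>j\<in>c. (h(b := h b * h k)) j) = h b * h k * (\<Prod>j\<in>c - {b}. h j)"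
        by (subst prod.remove[OF fc(1) True]) simp
      also have "\<dots> = h k * (\<Prod>j\<in>c. h j)"
        by (simp add: prod.remove[OF fc(1) True, of h] ac_simps)
      finally show ?thesis using True fc by (simp add: g_def)
    next
      case False
      then show ?thesis by (auto simp: g_def intro!: prod.cong)
    qed
  qed
  then show ?thesis unfolding im by (simp add: prod.reindex[OF inj])
qed

text \<open>A permutation of k + 1 points is the transposition of k and b after some q on the first
  k points, with b and q unique. For b = k the last point is a cycle of its own and contributes
  \<open>T (h k)\<close>; for b < k it is spliced in before b and the sign changes.\<close>

lemma cyc_sum_Suc:
  fixes T :: "'a::comm_monoid_mult \<Rightarrow> 'b::comm_ring_1"
  shows "cyc_sum T (Suc k) h = T (h k) * cyc_sum T k h - (\<Sum>b<k. cyc_sum T k (h(b := h b * h k)))"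
proof -
  define P where "P \<sigma> S h = (\<Prod>c\<in>orbit \<sigma> ` S. T (\<Prod>j\<in>c. h j))" for \<sigma> :: "nat \<Rightarrow> nat" and S and h :: "nat \<Rightarrow> 'a"
  let ?S = "{..<k}"
  have fix_k: "P q (insert k ?S) h = T (h k) * P q ?S h" if q: "q permutes ?S" for q
  proof -
    have "q k = k" using q by (simp add: permutes_not_in)
    then have "orbit q k = {k}" by (simp add: orbit_eq_singleton_iff)
    moreover have "{k} \<notin> orbit q ` ?S" using permutes_orbit_subset[OF q] by blast
    ultimately show ?thesis by (simp add: P_def)
  qed
  have move: "of_int (sign (Transposition.transpose k b \<circ> q)) * P (Transposition.transpose k b \<circ> q) (insert k ?S) h
     = - (of_int (sign q) * P q ?S (h(b := h b * h k)))" if q: "q permutes ?S" and b: "b < k" for q b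
  proof -
    have "permutation q" using q by (auto simp: permutation_permutes)
    then have "sign (Transposition.transpose k b \<circ> q) = - sign q"
      using b by (subst sign_compose) (auto simp: permutation_swap_id sign_swap_id)
    then show ?thesis unfolding P_def using cyc_prod_transpose[OF q, of k b T h] b by simp
  qed
  have "cyc_sum T (Suc k) h = (\<Sum>\<sigma>\<in>{\<sigma>. \<sigma> permutes insert k ?S}. of_int (sign \<sigma>) * P \<sigma> (insert k ?S) h)"
    unfolding cyc_sum_def P_def lessThan_Suc ..
  also have "\<dots> = (\<Sum>b\<in>insert k ?S. \<Sum>q\<in>{q. q permutes ?S}.
       of_int (sign (Transposition.transpose k b \<circ> q)) * P (Transposition.transpose k b \<circ> q) (insert k ?S) h)"
    by (rule sum_over_permutations_insert) auto
  also have "\<dots> = (\<Sum>q\<in>{q. q permutes ?S}. of_int (sign q) * P q (insert k ?S) h)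
      + (\<Sum>b<k. \<Sum>q\<in>{q. q permutes ?S}.
       of_int (sign (Transposition.transpose k b \<circ> q)) * P (Transposition.transpose k b \<circ> q) (insert k ?S) h)"
    by (subst sum.insert) auto
  also have "(\<Sum>q\<in>{q. q permutes ?S}. of_int (sign q) * P q (insert k ?S) h) = T (h k) * cyc_sum T k h"
    unfolding cyc_sum_def P_def[symmetric] sum_distrib_left
    by (rule sum.cong) (auto simp: fix_k ac_simps)
  also have "(\<Sum>b<k. \<Sum>q\<in>{q. q permutes ?S}.
       of_int (sign (Transposition.transpose k b \<circ> q)) * P (Transposition.transpose k b \<circ> q) (insert k ?S) h)
     = - (\<Sum>b<k. cyc_sum T k (h(b := h b * h k)))"
    unfolding cyc_sum_def P_def[symmetric] sum_negf[symmetric]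
    by (intro sum.cong refl) (auto simp: move)
  finally show ?thesis by simp
qed

lemma cyc_sum_0: "cyc_sum T 0 h = 1"
  by (simp add: cyc_sum_def)

lemma cyc_sum_cong:
  assumes "\<And>j. j < k \<Longrightarrow> h j = h' j" shows "cyc_sum T k h = cyc_sum T k h'"
proof -
  have "(\<Prod>j\<in>c. h j) = (\<Prod>j\<in>c. h' j)" if "\<sigma> permutes {..<k}" "c \<in> orbit \<sigma> ` {..<k}" for \<sigma> c
    using that permutes_orbit_subset[OF that(1)] assms by (intro prod.cong) auto
  then show ?thesis unfolding cyc_sum_def by (intro sum.cong arg_cong2[where f = "(*)"] prod.cong) auto
qed

lemma cyc_sum_Suc_upd:
  fixes T :: "'a::comm_monoid_mult \<Rightarrow> 'b::comm_ring_1"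
  shows "cyc_sum T (Suc k) (h(k := z)) = T z * cyc_sum T k h - (\<Sum>b<k. cyc_sum T k (h(b := h b * z)))"
proof -
  have "cyc_sum T k ((h(k := z))(b := (h(k := z)) b * (h(k := z)) k)) = cyc_sum T k (h(b := h b * z))"
    if "b < k" for b
    using that by (intro cyc_sum_cong) auto
  moreover have "cyc_sum T k (h(k := z)) = cyc_sum T k h"
    by (intro cyc_sum_cong) auto
  ultimately show ?thesis unfolding cyc_sum_Suc
    by (intro arg_cong2[where f = "(-)"] sum.cong) auto
qed

lemma ring_map_cyc_sum: "ring_map f \<Longrightarrow> f (cyc_sum T k h) = cyc_sum (\<lambda>x. f (T x)) k h"
  by (simp add: cyc_sum_def ring_map_sum ring_map_mult ring_map_of_int ring_map_prod)

text \<open>Slot i occurs in exactly one factor of each summand; the recursion avoids tracking that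
  factor. The slot must be arbitrary in the induction, since splitting off a last argument x + y
  moves it into every other slot.\<close>

lemma cyc_sum_slot_add:
  fixes T :: "'a::comm_ring_1 \<Rightarrow> 'b::comm_ring_1"
  assumes T: "\<And>x y. T (x + y) = T x + T y"
  shows "i < k \<Longrightarrow> cyc_sum T k (h(i := x + y)) = cyc_sum T k (h(i := x)) + cyc_sum T k (h(i := y))"
proof (induction k arbitrary: h x y i)
  case (Suc k)
  show ?case
  proof (cases "i = k")
    case True
    have "(\<Sum>b<k. cyc_sum T k (h(b := h b * (x + y)))) =
        (\<Sum>b<k. cyc_sum T k (h(b := h b * x))) + (\<Sum>b<k. cyc_sum T k (h(b := h b * y)))"
      unfolding sum.distrib[symmetric]
    proof (intro sum.cong refl)
      fix b assume "b \<in> {..<k}"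
      then show "cyc_sum T k (h(b := h b * (x + y))) = cyc_sum T k (h(b := h b * x)) + cyc_sum T k (h(b := h b * y))"
        using Suc.IH[of b h "h b * x" "h b * y"] by (simp only: distrib_left lessThan_iff)
    qed
    then show ?thesis unfolding True cyc_sum_Suc_upd by (simp add: T distrib_right)
  next
    case False
    with Suc.prems have i: "i < k" by simp
    have "cyc_sum T k ((h(i := x + y))(b := (h(i := x + y)) b * h k)) =
       cyc_sum T k ((h(i := x))(b := (h(i := x)) b * h k)) + cyc_sum T k ((h(i := y))(b := (h(i := y)) b * h k))" for b
    proof (cases "b = i")
      case True
      then show ?thesis using Suc.IH[OF i, of h "x * h k" "y * h k"] by (simp only: fun_upd_same fun_upd_upd distrib_right)
    next
      case False
      then have "(h(i := z))(b := (h(i := z)) b * h k) = (h(b := h b * h k))(i := z)" for z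
        by (simp add: fun_upd_twist)
      then show ?thesis using Suc.IH[OF i, of "h(b := h b * h k)"] by (simp only:)
    qed
    moreover have "(h(i := z)) k = h k" for z using i by simp
    ultimately show ?thesis unfolding cyc_sum_Suc
      by (simp only: Suc.IH[OF i, of h x y] distrib_left sum.distrib add_diff_add)
  qed
qed simp

lemma cyc_sum_slot_scale:
  fixes T :: "'a::comm_ring_1 \<Rightarrow> 'b::comm_ring_1"
  assumes T: "\<And>x. T (c * x) = d * T x"
  shows "i < k \<Longrightarrow> cyc_sum T k (h(i := c * x)) = d * cyc_sum T k (h(i := x))"
proof (induction k arbitrary: h x i)
  case (Suc k)
  show ?case
  proof (cases "i = k")
    case True
    have "(\<Sum>b<k. cyc_sum T k (h(b := h b * (c * x)))) = d * (\<Sum>b<k. cyc_sum T k (h(b := h b * x)))"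
      unfolding sum_distrib_left
    proof (intro sum.cong refl)
      fix b assume "b \<in> {..<k}"
      then show "cyc_sum T k (h(b := h b * (c * x))) = d * cyc_sum T k (h(b := h b * x))"
        using Suc.IH[of b h "h b * x"] by (simp only: mult.left_commute[of "h b" c x] lessThan_iff)
    qed
    then show ?thesis unfolding True cyc_sum_Suc_upd by (simp add: T right_diff_distrib mult.assoc)
  next
    case False
    with Suc.prems have i: "i < k" by simp
    have "cyc_sum T k ((h(i := c * x))(b := (h(i := c * x)) b * h k)) =
       d * cyc_sum T k ((h(i := x))(b := (h(i := x)) b * h k))" for b
    proof (cases "b = i")
      case True
      then show ?thesis using Suc.IH[OF i, of h "x * h k"] by (simp only: fun_upd_same fun_upd_upd mult.assoc)
    next
      case False
      then have "(h(i := z))(b := (h(i := z)) b * h k) = (h(b := h b * h k))(i := z)" for z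
        by (simp add: fun_upd_twist)
      then show ?thesis using Suc.IH[OF i, of "h(b := h b * h k)"] by (simp only:)
    qed
    moreover have "(h(i := z)) k = h k" for z using i by simp
    ultimately show ?thesis unfolding cyc_sum_Suc
      by (simp only: Suc.IH[OF i, of h x] right_diff_distrib sum_distrib_left mult.left_commute)
  qed
qed simp

text \<open>The step from k to k + 1 contributes the factor n - k: the value T(1) = n minus the k
  terms in which the last 1 is absorbed. The result is a falling factorial, equal to n! for k =
  n.\<close>

lemma cyc_sum_one:
  assumes "T 1 = of_nat n" "k \<le> n"
  shows "cyc_sum T k (\<lambda>_. 1) = of_nat (\<Prod>{n - k + 1..n})"
  using assms(2)
proof (induction k)
  case (Suc k)
  have "cyc_sum T (Suc k) (\<lambda>_. 1) = (of_nat n - of_nat k) * cyc_sum T k (\<lambda>_. 1)"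
    by (simp add: cyc_sum_Suc assms(1) left_diff_distrib fun_upd_idem)
  also have "\<dots> = of_nat ((n - k) * \<Prod>{n - k + 1..n})"
    using Suc by (simp add: of_nat_diff)
  also have "(n - k) * \<Prod>{n - k + 1..n} = \<Prod>{n - Suc k + 1..n}"
    using Suc.prems by (subst (2) prod.atLeast_Suc_atMost) (auto simp: Suc_diff_Suc)
  finally show ?case .
qed (simp add: cyc_sum_0)

lemma sum_PiE_Suc:
  "(\<Sum>f\<in>{..<Suc k} \<rightarrow>\<^sub>E (UNIV :: 'n::finite set). F f) = (\<Sum>g\<in>{..<k} \<rightarrow>\<^sub>E UNIV. \<Sum>y\<in>UNIV. F (g(k := y)))"
proof -
  have "(\<Sum>f\<in>{..<Suc k} \<rightarrow>\<^sub>E (UNIV :: 'n::finite set). F f)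
      = (\<Sum>f\<in>(\<lambda>(y, g). g(k := y)) ` (UNIV \<times> ({..<k} \<rightarrow>\<^sub>E UNIV)). F f)"
    by (simp add: lessThan_Suc PiE_insert_eq)
  also have "\<dots> = (\<Sum>(y, g)\<in>UNIV \<times> ({..<k} \<rightarrow>\<^sub>E UNIV). F (g(k := y)))"
  proof (subst sum.reindex)
    show "inj_on (\<lambda>(y, g). g(k := y)) (UNIV \<times> ({..<k} \<rightarrow>\<^sub>E (UNIV :: 'n set)))"
      using inj_combinator[of k "{..<k}" "\<lambda>_. UNIV :: 'n set"] by simp
  qed (simp add: case_prod_unfold comp_def)
  also have "\<dots> = (\<Sum>g\<in>{..<k} \<rightarrow>\<^sub>E UNIV. \<Sum>y\<in>UNIV. F (g(k := y)))"
    by (subst sum.cartesian_product[symmetric], subst sum.swap) simp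
  finally show ?thesis .
qed

lemma cyc_sum_inj:
  fixes \<phi> :: "'n::finite \<Rightarrow> 'a::comm_monoid_mult \<Rightarrow> 'b::comm_ring_1"
  assumes mult: "\<And>i x y. \<phi> i (x * y) = \<phi> i x * \<phi> i y"
  shows "cyc_sum (\<lambda>x. \<Sum>i\<in>UNIV. \<phi> i x) k h
     = (\<Sum>f\<in>{..<k} \<rightarrow>\<^sub>E UNIV. of_bool (inj_on f {..<k}) * (\<Prod>j<k. \<phi> (f j) (h j)))"
proof (induction k arbitrary: h)
  case 0
  show ?case by (simp add: cyc_sum_0)
next
  case (Suc k)
  let ?T = "\<lambda>x. \<Sum>i\<in>UNIV. \<phi> i x"
  let ?P = "\<lambda>f. \<Prod>j<k. \<phi> (f j) (h j)"
  have upd: "(\<Prod>j<k. \<phi> (f j) ((h(b := h b * h k)) j)) = \<phi> (f b) (h k) * ?P f" if "b < k" for f b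
  proof -
    have "(\<Prod>j<k. \<phi> (f j) ((h(b := h b * h k)) j)) = (\<phi> (f b) (h b) * \<phi> (f b) (h k)) * (\<Prod>j\<in>{..<k} - {b}. \<phi> (f j) (h j))"
      using that by (subst prod.remove[of _ b]) (auto simp: mult)
    also have "\<dots> = \<phi> (f b) (h k) * ?P f"
      using that by (subst (2) prod.remove[of _ b]) (auto simp: ac_simps)
    finally show ?thesis .
  qed
  have inj_upd: "inj_on (g(k := y)) {..<Suc k} \<longleftrightarrow> inj_on g {..<k} \<and> y \<notin> g ` {..<k}" for g :: "nat \<Rightarrow> 'n" and y
  proof -
    have "inj_on (g(k := y)) {..<k} \<longleftrightarrow> inj_on g {..<k}" by (rule inj_on_cong) auto
    moreover have "(g(k := y)) ` {..<k} = g ` {..<k}" by (rule image_cong) auto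
    ultimately show ?thesis by (simp add: lessThan_Suc inj_on_insert)
  qed
  have main: "(\<Sum>y\<in>UNIV. of_bool (inj_on (g(k := y)) {..<Suc k}) * (\<Prod>j<Suc k. \<phi> ((g(k := y)) j) (h j)))
     = of_bool (inj_on g {..<k}) * (?T (h k) * ?P g) - (\<Sum>b<k. of_bool (inj_on g {..<k}) * (\<phi> (g b) (h k) * ?P g))" for g :: "nat \<Rightarrow> 'n"
  proof (cases "inj_on g {..<k}")
    case True
    have "(\<Sum>y\<in>UNIV. of_bool (inj_on (g(k := y)) {..<Suc k}) * (\<Prod>j<Suc k. \<phi> ((g(k := y)) j) (h j)))
      = (\<Sum>y\<in>UNIV. of_bool (y \<notin> g ` {..<k}) * (\<phi> y (h k) * ?P g))"
      unfolding inj_upd using True by (intro sum.cong refl) (auto simp: lessThan_Suc)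
    also have "\<dots> = (\<Sum>y\<in>UNIV - g ` {..<k}. \<phi> y (h k) * ?P g)"
      by (intro sum.mono_neutral_cong_right) auto
    also have "\<dots> = (\<Sum>y\<in>UNIV. \<phi> y (h k) * ?P g) - (\<Sum>y\<in>g ` {..<k}. \<phi> y (h k) * ?P g)"
      by (subst sum_diff) auto
    also have "(\<Sum>y\<in>g ` {..<k}. \<phi> y (h k) * ?P g) = (\<Sum>b<k. \<phi> (g b) (h k) * ?P g)"
      using True by (subst sum.reindex) auto
    finally show ?thesis using True
      by (simp only: sum_distrib_right of_bool_eq_1_iff mult_1 of_bool_eq(2) simp_thms if_True)
  next
    case False
    then show ?thesis by (simp add: inj_upd)
  qed
  have "(\<Sum>b<k. \<Sum>f\<in>{..<k} \<rightarrow>\<^sub>E UNIV. of_bool (inj_on f {..<k}) * (\<Prod>j<k. \<phi> (f j) ((h(b := h b * h k)) j)))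
     = (\<Sum>f\<in>{..<k} \<rightarrow>\<^sub>E UNIV. \<Sum>b<k. of_bool (inj_on f {..<k}) * (\<phi> (f b) (h k) * ?P f))"
    by (subst sum.swap, intro sum.cong refl) (simp only: upd lessThan_iff)
  then show ?case
    unfolding cyc_sum_Suc Suc.IH sum_PiE_Suc main
    by (simp add: sum_subtractf sum_distrib_left mult.left_commute)
qed

section \<open>Trace relations\<close>

definition lin_ext :: "('m \<Rightarrow> ('u,'k::comm_ring_1) mpoly) \<Rightarrow> ('m \<Rightarrow>\<^sub>0 'k) \<Rightarrow> ('u,'k) mpoly" where
  "lin_ext v p = (\<Sum>m\<in>Poly_Mapping.keys p. pconst (Poly_Mapping.lookup p m) * v m)"

lemma lin_ext_superset:
  assumes "finite S" "Poly_Mapping.keys p \<subseteq> S"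
  shows "lin_ext v p = (\<Sum>m\<in>S. pconst (Poly_Mapping.lookup p m) * v m)"
  unfolding lin_ext_def using assms
  by (intro sum.mono_neutral_left) (auto simp: in_keys_iff)

lemma lin_ext_add: "lin_ext v (p + q) = lin_ext v p + lin_ext v q"
proof -
  let ?S = "Poly_Mapping.keys p \<union> Poly_Mapping.keys q"
  have "Poly_Mapping.keys (p + q) \<subseteq> ?S" by (rule Poly_Mapping.keys_add)
  then show ?thesis
    by (subst (1 2 3) lin_ext_superset[where S = ?S])
      (auto simp: lookup_add pconst_add algebra_simps sum.distrib)
qed

lemma lin_ext_single [simp]: "lin_ext v (Poly_Mapping.single m c) = pconst c * v m"
  by (cases "c = 0") (auto simp: lin_ext_def)

lemma lin_ext_0 [simp]: "lin_ext v 0 = 0"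
  by (simp add: lin_ext_def)

lemma lin_ext_sum: "lin_ext v (sum f S) = (\<Sum>x\<in>S. lin_ext v (f x))"
  by (induction S rule: infinite_finite_induct) (auto simp: lin_ext_add)

lemma lin_ext_pconst_mult:
  fixes p :: "('v,'k::comm_ring_1) mpoly"
  shows "lin_ext v (pconst c * p) = pconst c * lin_ext v p"
proof (induction p rule: mpoly_monomial_induct)
  case (single m a)
  have "pconst c * Poly_Mapping.single m a = (Poly_Mapping.single m (c * a) :: ('v,'k) mpoly)"
    by (simp add: pconst_def mult_single)
  then show ?case by (simp add: pconst_mult mult.assoc)
qed (simp add: distrib_left lin_ext_add)

lemma pconst_of_nat: "pconst (of_nat n) = of_nat n"
  using pconst_of_int[of "int n"] by simp

text \<open>Reading the constant monomial as the number n makes \<open>Tlin n\<close> the linear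
  extension of one function on all monomials, so that constant terms need no separate
  treatment.\<close>

definition Tvar :: "nat \<Rightarrow> ('w \<Rightarrow>\<^sub>0 nat) \<Rightarrow> (('w \<Rightarrow>\<^sub>0 nat),'k::comm_ring_1) mpoly" where
  "Tvar n mu = (if mu = 0 then of_nat n else pvar mu)"

lemma Tlin_eq: "Tlin n h = lin_ext (Tvar n) h"
proof -
  have "Tlin n h = pconst (Poly_Mapping.lookup h 0) * Tvar n 0
     + (\<Sum>mu\<in>Poly_Mapping.keys h - {0}. pconst (Poly_Mapping.lookup h mu) * Tvar n mu)"
    unfolding Tlin_def by (auto simp: Tvar_def pconst_mult pconst_of_nat mult.commute intro!: arg_cong2[where f = "(+)"] sum.cong)
  also have "\<dots> = (\<Sum>mu\<in>insert 0 (Poly_Mapping.keys h). pconst (Poly_Mapping.lookup h mu) * Tvar n mu)"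
    by (subst sum.insert_remove) auto
  also have "\<dots> = lin_ext (Tvar n) h"
    by (rule lin_ext_superset[symmetric]) auto
  finally show ?thesis .
qed

lemma Tlin_add: "Tlin n (f + g) = Tlin n f + Tlin n g"
  by (simp add: Tlin_eq lin_ext_add)

lemma Tlin_pconst_mult: "Tlin n (pconst c * f) = pconst c * Tlin n f"
  by (simp add: Tlin_eq lin_ext_pconst_mult)

lemma Tlin_pmon: "Tlin n (pmon mu) = Tvar n mu"
  by (simp add: Tlin_eq pmon_def)

lemma Tlin_1: "Tlin n 1 = of_nat n"
  using Tlin_pmon[of n 0] by (simp add: Tvar_def)

lemma TPoly_0 [simp]: "0 \<in> TPoly"
  by (simp add: TPoly_def)

lemma TPoly_pconst [simp]: "pconst c \<in> TPoly"
  by (cases "c = 0") (auto simp: TPoly_def pconst_def)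

lemma TPoly_1 [simp]: "1 \<in> TPoly"
  using TPoly_pconst[of 1] by simp

lemma TPoly_add: "p \<in> TPoly \<Longrightarrow> q \<in> TPoly \<Longrightarrow> p + q \<in> TPoly"
  using Poly_Mapping.keys_add[of p q] unfolding TPoly_def by blast

lemma TPoly_mult:
  fixes p q :: "('w \<Rightarrow>\<^sub>0 nat, 'k::comm_ring_1) mpoly"
  assumes "p \<in> TPoly" "q \<in> TPoly"
  shows "p * q \<in> TPoly"
  unfolding TPoly_def
proof (intro CollectI ballI)
  fix m mu assume "m \<in> Poly_Mapping.keys (p * q)" and mu: "mu \<in> Poly_Mapping.keys m"
  then obtain a b where ab: "m = a + b" "a \<in> Poly_Mapping.keys p" "b \<in> Poly_Mapping.keys q"
    using keys_mult[of p q] by blast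
  then have "mu \<in> Poly_Mapping.keys a \<union> Poly_Mapping.keys b"
    using mu Poly_Mapping.keys_add[of a b] by blast
  then show "mu \<noteq> 0" using assms ab unfolding TPoly_def by blast
qed

lemma TPoly_uminus: "p \<in> TPoly \<Longrightarrow> - p \<in> TPoly"
  unfolding TPoly_def by (simp add: keys_def)

lemma TPoly_diff: "p \<in> TPoly \<Longrightarrow> q \<in> TPoly \<Longrightarrow> p - q \<in> TPoly"
  using TPoly_add[of p "- q"] TPoly_uminus[of q] by simp

lemma TPoly_sum: "(\<And>x. x \<in> S \<Longrightarrow> f x \<in> TPoly) \<Longrightarrow> sum f S \<in> TPoly"
  by (induction S rule: infinite_finite_induct) (auto intro: TPoly_add)

lemma TPoly_Tvar: "Tvar n mu \<in> TPoly"
proof (cases "mu = 0")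
  case True
  have "(of_nat n :: ('a \<Rightarrow>\<^sub>0 nat, 'b) mpoly) = pconst (of_nat n)" by (simp add: pconst_of_nat)
  then show ?thesis using True by (simp add: Tvar_def)
next
  case False
  then show ?thesis by (auto simp: Tvar_def TPoly_def pvar_def)
qed

lemma TPoly_lin_ext: "(\<And>m. v m \<in> TPoly) \<Longrightarrow> lin_ext v p \<in> TPoly"
  unfolding lin_ext_def by (intro TPoly_sum TPoly_mult) auto

lemma TPoly_Tlin: "Tlin n h \<in> TPoly"
  unfolding Tlin_eq by (intro TPoly_lin_ext TPoly_Tvar)

lemma TPoly_cyc_sum: "cyc_sum (Tlin n) k h \<in> TPoly"
  by (induction k arbitrary: h) (auto simp: cyc_sum_0 cyc_sum_Suc intro!: TPoly_diff TPoly_mult TPoly_Tlin TPoly_sum)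

lemma TPoly_poly_eval_Tvar: "poly_eval (Tvar n) Phi \<in> TPoly"
  by (induction Phi rule: mpoly_induct)
    (auto simp: ring_map_add[OF ring_map_poly_eval] ring_map_mult[OF ring_map_poly_eval]
      intro: TPoly_Tvar TPoly_add TPoly_mult)

text \<open>Substituting \<open>Tvar n\<close> is the retraction onto \<open>TPoly\<close> that sets
  the variable of the constant monomial to n. Inductions over all polynomials produce this
  substitution; here it disappears again.\<close>

lemma poly_eval_Tvar_id:
  fixes Phi :: "('w \<Rightarrow>\<^sub>0 nat, 'k::comm_ring_1) mpoly"
  assumes "Phi \<in> TPoly" shows "poly_eval (Tvar n) Phi = Phi"
proof -
  have "poly_eval (Tvar n) Phi
      = (\<Sum>m\<in>Poly_Mapping.keys Phi. pconst (Poly_Mapping.lookup Phi m) * mon_eval (Tvar n) m)"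
    by (simp add: poly_eval_eq hom_eval_def)
  also have "\<dots> = (\<Sum>m\<in>Poly_Mapping.keys Phi. Poly_Mapping.single m (Poly_Mapping.lookup Phi m))"
  proof (rule sum.cong[OF refl])
    fix m assume "m \<in> Poly_Mapping.keys Phi"
    then have "mon_eval (Tvar n) m = (mon_eval pvar m :: ('w \<Rightarrow>\<^sub>0 nat, 'k) mpoly)"
      using assms unfolding mon_eval_def TPoly_def by (intro prod.cong) (auto simp: Tvar_def)
    then show "pconst (Poly_Mapping.lookup Phi m) * mon_eval (Tvar n) m
        = Poly_Mapping.single m (Poly_Mapping.lookup Phi m)"
      by (simp add: single_eq_pconst pmon_eq_mon_eval)
  qed
  also have "\<dots> = Phi" by (rule additive_eq_sum[symmetric]) simp
  finally show ?thesis .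
qed

lemma trace_relations_0: "0 \<in> trace_relations n I"
  unfolding trace_relations_def by (rule ideal_span_0)

lemma trace_relations_add:
  "x \<in> trace_relations n I \<Longrightarrow> y \<in> trace_relations n I \<Longrightarrow> x + y \<in> trace_relations n I"
  unfolding trace_relations_def by (rule ideal_span_add)

lemma trace_relations_mult:
  "r \<in> TPoly \<Longrightarrow> x \<in> trace_relations n I \<Longrightarrow> r * x \<in> trace_relations n I"
  unfolding trace_relations_def by (rule ideal_span_mult[OF TPoly_mult])

lemma trace_relations_uminus: "x \<in> trace_relations n I \<Longrightarrow> - x \<in> trace_relations n I"
  using trace_relations_mult[of "- 1" x n I] by (simp add: TPoly_uminus)

lemma trace_relations_diff:
  "x \<in> trace_relations n I \<Longrightarrow> y \<in> trace_relations n I \<Longrightarrow> x - y \<in> trace_relations n I"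
  using trace_relations_add[of x n I "- y"] trace_relations_uminus[of y n I] by simp

lemma trace_relations_sum:
  "(\<And>x. x \<in> S \<Longrightarrow> f x \<in> trace_relations n I) \<Longrightarrow> sum f S \<in> trace_relations n I"
  by (induction S rule: infinite_finite_induct) (auto intro: trace_relations_0 trace_relations_add)

lemma Tlin_in_trace_relations: "f \<in> I \<Longrightarrow> Tlin n f \<in> trace_relations n I"
  unfolding trace_relations_def by (rule ideal_span_base) auto

lemma cyc_sum_in_trace_relations: "cyc_sum (Tlin n) (Suc n) h \<in> trace_relations n I"
  unfolding trace_relations_def Psi_eq_cyc_sum[symmetric] by (rule ideal_span_base) auto

text \<open>In every summand the cycle through i has its product in I and so contributes a relation
  of type (b). In the recursion the element of I is split off as the last argument, or it is merged
  into, or stays in, an earlier slot.\<close>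

lemma cyc_sum_ideal_in_trace_relations:
  assumes I: "is_ideal I"
  shows "i < k \<Longrightarrow> h i \<in> I \<Longrightarrow> cyc_sum (Tlin n) k h \<in> trace_relations n I"
proof (induction k arbitrary: h i)
  case (Suc k)
  have "Tlin n (h k) * cyc_sum (Tlin n) k h \<in> trace_relations n I"
  proof (cases "i = k")
    case True
    then have "cyc_sum (Tlin n) k h * Tlin n (h k) \<in> trace_relations n I"
      using Suc.prems by (intro trace_relations_mult TPoly_cyc_sum Tlin_in_trace_relations) auto
    then show ?thesis by (simp add: mult.commute)
  next
    case False
    then show ?thesis using Suc by (intro trace_relations_mult TPoly_Tlin Suc.IH[of i]) auto
  qed
  moreover have "cyc_sum (Tlin n) k (h(b := h b * h k)) \<in> trace_relations n I" if b: "b < k" for b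
  proof (cases "i = k")
    case True
    show ?thesis by (rule Suc.IH[OF b]) (use Suc.prems True in \<open>simp add: is_ideal_mult[OF I]\<close>)
  next
    case False
    show ?thesis
      by (rule Suc.IH[of i]) (use Suc.prems False in \<open>auto simp: is_ideal_mult_right[OF I]\<close>)
  qed
  ultimately show ?case unfolding cyc_sum_Suc
    by (intro trace_relations_diff trace_relations_sum) auto
qed simp

section \<open>Multisymmetric functions\<close>

text \<open>A monomial in the variables x_(w,k) is a pure tensor of monomials in the x_w; this is
  its factor at place k.\<close>

definition mon_part :: "'n \<Rightarrow> (('w \<times> 'n) \<Rightarrow>\<^sub>0 nat) \<Rightarrow> ('w \<Rightarrow>\<^sub>0 nat)" where
  "mon_part k m = Poly_Mapping.map_key (\<lambda>w. (w, k)) m"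

lemma lookup_mon_part [simp]: "Poly_Mapping.lookup (mon_part k m) w = Poly_Mapping.lookup m (w, k)"
  unfolding mon_part_def by (subst map_key.rep_eq) (auto intro: injI)

lemma mon_part_add: "mon_part k (m + m') = mon_part k m + mon_part k m'"
  by (rule poly_mapping_eqI) (simp add: lookup_add)

lemma mon_part_0 [simp]: "mon_part k 0 = 0"
  by (rule poly_mapping_eqI) simp

definition mon_embed :: "'n \<Rightarrow> ('w \<Rightarrow>\<^sub>0 nat) \<Rightarrow> (('w \<times> 'n) \<Rightarrow>\<^sub>0 nat)" where
  "mon_embed k m = (\<Sum>w\<in>Poly_Mapping.keys m. Poly_Mapping.single (w, k) (Poly_Mapping.lookup m w))"

lemma lookup_mon_embed:
  "Poly_Mapping.lookup (mon_embed k m) (w, k') = (if k' = k then Poly_Mapping.lookup m w else 0)"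
proof -
  have "Poly_Mapping.lookup (mon_embed k m) (w, k')
     = (\<Sum>v\<in>Poly_Mapping.keys m. if v = w then (if k' = k then Poly_Mapping.lookup m w else 0) else 0)"
    unfolding mon_embed_def lookup_sum by (intro sum.cong) (auto simp: lookup_single when_def)
  then show ?thesis by (simp add: in_keys_iff)
qed

lemma mon_part_mon_embed: "mon_part k' (mon_embed k m) = (if k' = k then m else 0)"
  by (rule poly_mapping_eqI) (simp add: lookup_mon_embed)

lemma pmon_mon_embed: "mon_eval (copy_var k) m = (pmon (mon_embed k m) :: ('w \<times> 'n,'k::comm_ring_1) mpoly)"
proof -
  have "(pmon (mon_embed k m) :: ('w \<times> 'n,'k) mpoly) = (\<Prod>w\<in>Poly_Mapping.keys m. pmon (Poly_Mapping.single (w, k) (Poly_Mapping.lookup m w)))"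
    unfolding mon_embed_def
    by (induction rule: infinite_finite_induct) (auto simp: pmon_add)
  moreover have "(pmon (Poly_Mapping.single (w, k) i) :: ('w \<times> 'n,'k) mpoly) = copy_var k w ^ i" for w i
    by (simp add: pmon_eq_mon_eval copy_var_def)
  ultimately show ?thesis by (simp add: mon_eval_def)
qed

lemma mon_eval_prod_parts:
  fixes m :: "('w \<times> 'n::finite) \<Rightarrow>\<^sub>0 nat"
  shows "mon_eval t m = (\<Prod>k\<in>UNIV. mon_eval (\<lambda>w. t (w, k)) (mon_part k m))"
proof -
  let ?W = "fst ` Poly_Mapping.keys m"
  have "Poly_Mapping.keys m \<subseteq> ?W \<times> UNIV" by force
  then have "mon_eval t m = (\<Prod>(w,k)\<in>?W \<times> UNIV. t (w,k) ^ Poly_Mapping.lookup m (w,k))"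
    by (subst mon_eval_superset[of "?W \<times> UNIV"]) auto
  also have "\<dots> = (\<Prod>k\<in>UNIV. \<Prod>w\<in>?W. t (w,k) ^ Poly_Mapping.lookup m (w,k))"
    by (subst prod.cartesian_product[symmetric], rule prod.swap)
  also have "\<dots> = (\<Prod>k\<in>UNIV. mon_eval (\<lambda>w. t (w, k)) (mon_part k m))"
  proof (rule prod.cong[OF refl])
    fix k
    have "Poly_Mapping.keys (mon_part k m) \<subseteq> ?W"
      by (force simp: in_keys_iff image_iff)
    then show "(\<Prod>w\<in>?W. t (w,k) ^ Poly_Mapping.lookup m (w,k)) = mon_eval (\<lambda>w. t (w, k)) (mon_part k m)"
      by (subst mon_eval_superset[of ?W]) auto
  qed
  finally show ?thesis .
qed

lemma e1_mon_eq: "e1_mon mu = (\<Sum>k\<in>UNIV. mon_eval (copy_var k) mu)"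
  by (simp add: e1_mon_def)

lemma poly_eval_e1_Tlin:
  fixes h :: "('w,'k::comm_ring_1) mpoly"
  shows "poly_eval e1_mon (Tlin CARD('n) h)
     = (\<Sum>k\<in>(UNIV::'n::finite set). poly_eval (copy_var k) h :: ('w \<times> 'n,'k) mpoly)"
proof (induction h rule: mpoly_monomial_induct)
  case (single m c)
  have "poly_eval e1_mon (Tvar CARD('n) m) = (\<Sum>k\<in>UNIV. mon_eval (copy_var k) m :: ('w \<times> 'n,'k) mpoly)"
    by (cases "m = 0") (auto simp: Tvar_def e1_mon_eq pconst_of_nat[symmetric])
  then show ?case
    by (simp add: single_eq_pconst Tlin_pconst_mult Tlin_pmon ring_map_mult[OF ring_map_poly_eval]
       sum_distrib_left)
qed (simp add: Tlin_add ring_map_add[OF ring_map_poly_eval] sum.distrib)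

text \<open>A left inverse, up to the factor \<open>n!\<close> and modulo the trace relations, of
  \<open>T\<^sub>\<mu> \<mapsto> e\<^sub>1(\<mu>)\<close>: it sends \<open>\<mu>\<^sub>1 \<otimes> \<dots> \<otimes> \<mu>\<^sub>n\<close> to \<open>\<Psi>\<^sub>n(\<mu>\<^sub>1, \<dots>, \<mu>\<^sub>n)\<close>, where \<open>e\<close> numbers the tensor factors.\<close>
definition Theta :: "(nat \<Rightarrow> 'n::finite) \<Rightarrow> ('w \<times> 'n,'k::comm_ring_1) mpoly \<Rightarrow> ('w \<Rightarrow>\<^sub>0 nat, 'k) mpoly" where
  "Theta e = lin_ext (\<lambda>m. cyc_sum (Tlin CARD('n)) CARD('n) (\<lambda>j. pmon (mon_part (e j) m)))"

lemma Theta_add: "Theta e (p + q) = Theta e p + Theta e q"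
  by (simp add: Theta_def lin_ext_add)

lemma Theta_pconst_mult: "Theta e (pconst c * p) = pconst c * Theta e p"
  by (simp add: Theta_def lin_ext_pconst_mult)

lemma Theta_sum: "Theta e (sum f S) = (\<Sum>x\<in>S. Theta e (f x))"
  by (simp add: Theta_def lin_ext_sum)

lemma TPoly_Theta: "Theta e p \<in> TPoly"
  unfolding Theta_def by (intro TPoly_lin_ext TPoly_cyc_sum)

lemma Theta_pmon: "Theta (e :: nat \<Rightarrow> 'n::finite) (pmon m)
    = cyc_sum (Tlin CARD('n)) CARD('n) (\<lambda>j. pmon (mon_part (e j) m))"
  by (simp add: Theta_def pmon_def)

lemma Theta_1: "Theta (e :: nat \<Rightarrow> 'n::finite) (1 :: ('b \<times> 'n,'c::comm_ring_1) mpoly) = of_nat (fact CARD('n))"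
proof -
  have "Theta e 1 = cyc_sum (Tlin CARD('n)) CARD('n) (\<lambda>_. 1 :: ('b,'c) mpoly)"
    using Theta_pmon[of e 0] by simp
  then show ?thesis by (simp add: cyc_sum_one[of "Tlin CARD('n)" "CARD('n)", OF Tlin_1] fact_prod)
qed

context
  fixes e :: "nat \<Rightarrow> 'n::finite"
  assumes e: "bij_betw e {..<CARD('n)} UNIV"
begin

text \<open>A monomial at place \<open>e b\<close> changes only slot b of the cycle sum.
  Multilinearity extends this to arbitrary f, as is required for elements of I, which need not be
  monomials.\<close>

lemma Theta_pmon_mult_copy:
  fixes f :: "('w,'k::comm_ring_1) mpoly"
  assumes b: "b < CARD('n)"
  shows "Theta e (pmon m * poly_eval (copy_var (e b)) f)
    = cyc_sum (Tlin CARD('n)) CARD('n)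
        ((\<lambda>j. pmon (mon_part (e j) m))(b := pmon (mon_part (e b) m) * f))"
proof (induction f rule: mpoly_monomial_induct)
  case (single mu c)
  have "e j = e b \<longleftrightarrow> j = b" if "j < CARD('n)" for j
    using e that b unfolding bij_betw_def by (auto dest: inj_onD)
  then have "cyc_sum (Tlin CARD('n)) CARD('n) (\<lambda>j. pmon (mon_part (e j) (m + mon_embed (e b) mu)))
     = cyc_sum (Tlin CARD('n)) CARD('n)
        ((\<lambda>j. pmon (mon_part (e j) m))(b := pmon (mon_part (e b) m) * (pmon mu :: ('w,'k) mpoly)))"
    by (intro cyc_sum_cong) (auto simp: mon_part_add mon_part_mon_embed pmon_add)
  then have "Theta e (pmon m * poly_eval (copy_var (e b)) (pmon mu))
     = cyc_sum (Tlin CARD('n)) CARD('n)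
        ((\<lambda>j. pmon (mon_part (e j) m))(b := pmon (mon_part (e b) m) * (pmon mu :: ('w,'k) mpoly)))"
    by (simp add: pmon_mon_embed pmon_add[symmetric] Theta_pmon)
  then show ?case
    using cyc_sum_slot_scale[of "Tlin CARD('n)" "pconst c :: ('w,'k) mpoly" "pconst c", OF Tlin_pconst_mult b]
    by (simp only: single_eq_pconst ring_map_mult[OF ring_map_poly_eval] poly_eval_pconst
       mult.left_commute[of _ "pconst c"] Theta_pconst_mult)
next
  case (add p q)
  then show ?case
    using cyc_sum_slot_add[of "Tlin CARD('n) :: ('w,'k) mpoly \<Rightarrow> _", OF Tlin_add b]
    by (simp only: ring_map_add[OF ring_map_poly_eval] distrib_left Theta_add)
qed

text \<open>Multiplication by e_1(mu) multiplies one tensor factor at a time by mu, so Theta turns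
  it into the sum that is subtracted in the recursion for Psi_(n+1). What is left over is a relation
  of type (a).\<close>

lemma Theta_e1_mon:
  fixes q :: "('w \<times> 'n,'k::comm_ring_1) mpoly"
  shows "Theta e (e1_mon mu * q) - Tvar CARD('n) mu * Theta e q \<in> trace_relations CARD('n) I"
proof (induction q rule: mpoly_monomial_induct)
  case (single m c)
  let ?n = "CARD('n)"
  let ?m = "pmon m :: ('w \<times> 'n,'k) mpoly"
  let ?h = "\<lambda>j. pmon (mon_part (e j) m)"
  have "Theta e (e1_mon mu * ?m) = (\<Sum>k\<in>UNIV. Theta e (?m * poly_eval (copy_var k) (pmon mu)))"
    by (simp add: e1_mon_eq sum_distrib_left Theta_sum mult.commute)
  also have "\<dots> = (\<Sum>b<?n. Theta e (?m * poly_eval (copy_var (e b)) (pmon mu)))"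
    by (rule sum.reindex_bij_betw[OF e, symmetric])
  also have "\<dots> = (\<Sum>b<?n. cyc_sum (Tlin ?n) ?n (?h(b := ?h b * pmon mu)))"
    by (intro sum.cong refl Theta_pmon_mult_copy) auto
  also have "\<dots> = Tvar ?n mu * Theta e (?m) - cyc_sum (Tlin ?n) (Suc ?n) (?h(?n := pmon mu))"
    unfolding cyc_sum_Suc_upd by (simp add: Tlin_pmon Theta_pmon)
  finally have "Theta e (e1_mon mu * ?m) - Tvar ?n mu * Theta e (?m) \<in> trace_relations ?n I"
    by (simp add: cyc_sum_in_trace_relations trace_relations_uminus)
  then have "pconst c * (Theta e (e1_mon mu * ?m) - Tvar ?n mu * Theta e (?m)) \<in> trace_relations ?n I"
    by (intro trace_relations_mult) auto
  then show ?case
    by (simp only: single_eq_pconst Theta_pconst_mult mult.left_commute[of _ "pconst c"] right_diff_distrib)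
next
  case (add p q)
  from trace_relations_add[OF this] show ?case
    by (simp add: distrib_left Theta_add algebra_simps)
qed

text \<open>The factor \<open>q\<close> is arbitrary because a product p r is handled by moving the
  image of r into \<open>q\<close>.\<close>

lemma Theta_poly_eval_e1:
  "Theta e (poly_eval e1_mon Phi * q) - poly_eval (Tvar CARD('n)) Phi * Theta e q
     \<in> trace_relations CARD('n) I"
proof (induction Phi arbitrary: q rule: mpoly_induct)
  case (const c)
  show ?case by (simp add: Theta_pconst_mult trace_relations_0)
next
  case (var v)
  show ?case by (simp add: Theta_e1_mon)
next
  case (add p r)
  from trace_relations_add[OF add[of q]] show ?case
    by (simp add: ring_map_add[OF ring_map_poly_eval] Theta_add algebra_simps)
next
  case (mult p r)
  let ?T = "poly_eval (Tvar CARD('n))"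
  have "?T p * (Theta e (poly_eval e1_mon r * q) - ?T r * Theta e q) \<in> trace_relations CARD('n) I"
    by (intro trace_relations_mult TPoly_poly_eval_Tvar mult)
  from trace_relations_add[OF mult(1)[of "poly_eval e1_mon r * q"] this] show ?case
    by (simp add: ring_map_mult[OF ring_map_poly_eval] algebra_simps)
qed

lemma Theta_tens_ideal:
  assumes I: "is_ideal I" and p: "p \<in> tens_ideal I"
  shows "Theta e p \<in> trace_relations CARD('n) I"
  using p unfolding tens_ideal_def
proof (induction rule: ideal_span_induct)
  case zero
  show ?case by (simp add: Theta_def trace_relations_0)
next
  case (add r s x)
  then obtain f k where f: "f \<in> I" "s = poly_eval (copy_var k) f" by blast
  obtain b where b: "b < CARD('n)" "e b = k"
    using e unfolding bij_betw_def by (metis UNIV_I image_iff lessThan_iff)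
  have "Theta e (r * poly_eval (copy_var k) f) \<in> trace_relations CARD('n) I"
  proof (induction r rule: mpoly_monomial_induct)
    case (single m c)
    have "Theta e (pmon m * poly_eval (copy_var k) f) \<in> trace_relations CARD('n) I"
      unfolding b(2)[symmetric] Theta_pmon_mult_copy[OF b(1)]
      by (rule cyc_sum_ideal_in_trace_relations[OF I b(1)]) (simp add: is_ideal_mult[OF I f(1)])
    then have "pconst c * Theta e (pmon m * poly_eval (copy_var k) f) \<in> trace_relations CARD('n) I"
      by (rule trace_relations_mult[OF TPoly_pconst])
    then show ?case by (simp add: single_eq_pconst mult.assoc Theta_pconst_mult)
  qed (simp add: distrib_right Theta_add trace_relations_add)
  then show ?case using add f by (simp add: Theta_add trace_relations_add)
qed

text \<open>The image of T(h) is the sum of the n embeddings of h, so \<open>cyc_sum_inj\<close>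
  applies. With n arguments and n places the injective functions are the permutations s, each moving
  the factor at place k to place s k.\<close>

lemma poly_eval_e1_Theta:
  fixes p :: "('w \<times> 'n,'k::comm_ring_1) mpoly"
  shows "poly_eval e1_mon (Theta e p) = (\<Sum>s\<in>{s. s permutes UNIV}. sym_act s p)"
proof (induction p rule: mpoly_monomial_induct)
  case (single m c)
  let ?n = "CARD('n)"
  let ?h = "\<lambda>j. pmon (mon_part (e j) m)"
  let ?G = "\<lambda>f. \<Prod>j<?n. (poly_eval (copy_var (f j)) (?h j) :: ('w \<times> 'n,'k) mpoly)"
  have einv: "e (inv_into {..<?n} e k) = k" "inv_into {..<?n} e k < ?n" for k
    using e bij_betw_inv_into_right[OF e, of k] inv_into_into[of k e "{..<?n}"]
    by (auto simp: bij_betw_def)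
  have inve: "inv_into {..<?n} e (e j) = j" if "j < ?n" for j
    using that bij_betw_inv_into_left[OF e, of j] by simp
  have "poly_eval e1_mon (Theta e (pmon m)) = (\<Sum>f\<in>{..<?n} \<rightarrow>\<^sub>E UNIV. of_bool (inj_on f {..<?n}) * ?G f)"
    unfolding Theta_pmon ring_map_cyc_sum[OF ring_map_poly_eval] poly_eval_e1_Tlin
    by (rule cyc_sum_inj) (rule ring_map_mult[OF ring_map_poly_eval])
  also have "\<dots> = (\<Sum>f\<in>{f\<in>{..<?n} \<rightarrow>\<^sub>E UNIV. inj_on f {..<?n}}. ?G f)"
    by (intro sum.mono_neutral_cong_right) (auto intro: finite_PiE)
  \<comment> \<open>An injective f on the slots corresponds to the permutation f after the inverse
    of \<open>e\<close>; \<open>restrict\<close> supplies the fixed value outside the slots that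
    membership in the function set demands.\<close>
  also have "\<dots> = (\<Sum>s\<in>{s. s permutes UNIV}. ?G (\<lambda>j. s (e j)))"
  proof (rule sum.reindex_bij_witness[where
        i = "\<lambda>s. restrict (\<lambda>j. s (e j)) {..<?n}" and j = "\<lambda>f k. f (inv_into {..<?n} e k)"])
    fix f :: "nat \<Rightarrow> 'n" assume f: "f \<in> {f\<in>{..<?n} \<rightarrow>\<^sub>E UNIV. inj_on f {..<?n}}"
    show "restrict (\<lambda>j. f (inv_into {..<?n} e (e j))) {..<?n} = f"
      using f by (auto simp: inve PiE_def extensional_def fun_eq_iff restrict_def)
    have "inj (\<lambda>k. f (inv_into {..<?n} e k))"
      using f einv by (intro injI) (metis (mono_tags, lifting) inj_onD lessThan_iff mem_Collect_eq)
    then show "(\<lambda>k. f (inv_into {..<?n} e k)) \<in> {s. s permutes UNIV}"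
      by (auto intro!: bij_imp_permutes simp: bij_def finite_UNIV_inj_surj)
    show "?G (\<lambda>j. f (inv_into {..<?n} e (e j))) = ?G f"
      by (intro prod.cong) (auto simp: inve)
  next
    fix s :: "'n \<Rightarrow> 'n" assume s: "s \<in> {s. s permutes UNIV}"
    show "(\<lambda>k. restrict (\<lambda>j. s (e j)) {..<?n} (inv_into {..<?n} e k)) = s"
      using einv by (auto simp: fun_eq_iff)
    have "inj_on (\<lambda>j. s (e j)) {..<?n}"
      using s e by (auto simp: bij_betw_def inj_on_def dest: permutes_inj injD)
    then show "restrict (\<lambda>j. s (e j)) {..<?n} \<in> {f\<in>{..<?n} \<rightarrow>\<^sub>E UNIV. inj_on f {..<?n}}"
      by (auto simp: inj_on_def)
  qed
  also have "\<dots> = (\<Sum>s\<in>{s. s permutes UNIV}. sym_act s (pmon m))"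
  proof (rule sum.cong[OF refl])
    fix s :: "'n \<Rightarrow> 'n"
    have "sym_act s (pmon m) = (\<Prod>k\<in>UNIV. mon_eval (copy_var (s k)) (mon_part k m) :: ('w \<times> 'n,'k) mpoly)"
      by (simp add: sym_act_def mon_eval_prod_parts copy_var_def[abs_def])
    also have "\<dots> = ?G (\<lambda>j. s (e j))"
      by (subst prod.reindex_bij_betw[OF e, symmetric]) simp
    finally show "?G (\<lambda>j. s (e j)) = sym_act s (pmon m)" by simp
  qed
  finally show ?case
    by (simp add: single_eq_pconst Theta_pconst_mult ring_map_mult[OF ring_map_poly_eval] sym_act_def sum_distrib_left)
qed (simp add: Theta_add ring_map_add[OF ring_map_poly_eval] sym_act_def sum.distrib)

end

section \<open>Generation and kernel for the symmetric tensors\<close>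

lemma is_ideal_tens_ideal: "is_ideal (tens_ideal I)"
  unfolding tens_ideal_def by (rule is_ideal_ideal_span)

lemma enumeration_exists: "\<exists>e. bij_betw e {..<CARD('n::finite)} (UNIV :: 'n set)"
  using ex_bij_betw_nat_finite[of "UNIV :: 'n set"] by (simp add: atLeast0LessThan)

lemma sym_act_e1_mon:
  assumes "s permutes UNIV" shows "sym_act s (e1_mon mu) = e1_mon mu"
proof -
  have "sym_act s (e1_mon mu) = (\<Sum>k\<in>UNIV. mon_eval (copy_var (s k)) mu)"
    by (simp add: sym_act_def e1_mon_eq ring_map_sum[OF ring_map_poly_eval]
        mon_eval_ring_map[OF ring_map_poly_eval] copy_var_def[abs_def])
  also have "\<dots> = e1_mon mu"
    unfolding e1_mon_eq using assms by (rule sum.permute[symmetric, unfolded comp_def])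
  finally show ?thesis .
qed

lemma tens_invariant_e1_mon: "tens_invariant I (e1_mon mu)"
  by (simp add: tens_invariant_def sym_act_e1_mon is_ideal_0[OF is_ideal_tens_ideal])

lemma of_nat_mult_cancel_mpoly:
  fixes p :: "('v,'k::field_char_0) mpoly"
  assumes "n > 0" shows "pconst (inverse (of_nat n)) * (of_nat n * p) = p"
  using assms pconst_cancel[of "of_nat n :: 'k" p] by (simp add: pconst_of_nat)

text \<open>All translates of p under S_n agree with p modulo the ideal, so the symmetrization of p,
  which is the image of \<open>Theta e p\<close>, is congruent to n! p.\<close>

lemma tens_invariant_generated:
  fixes p :: "('w \<times> 'n::finite,'k::field_char_0) mpoly"
  assumes "tens_invariant I p"
  shows "\<exists>Phi\<in>TPoly. p - poly_eval e1_mon Phi \<in> tens_ideal I"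
proof -
  obtain e where e: "bij_betw e {..<CARD('n)} (UNIV :: 'n set)" using enumeration_exists by blast
  let ?c = "inverse (of_nat (fact CARD('n))) :: 'k"
  let ?Phi = "pconst ?c * Theta e p"
  have "(\<Sum>s\<in>{s. s permutes (UNIV :: 'n set)}. sym_act s p - p) \<in> tens_ideal I"
    using assms unfolding tens_invariant_def by (intro is_ideal_sum[OF is_ideal_tens_ideal]) auto
  also have "(\<Sum>s\<in>{s. s permutes (UNIV :: 'n set)}. sym_act s p - p)
      = poly_eval e1_mon (Theta e p) - of_nat (fact CARD('n)) * p"
    by (simp add: sum_subtractf poly_eval_e1_Theta[OF e] card_permutations)
  finally have "pconst ?c * (poly_eval e1_mon (Theta e p) - of_nat (fact CARD('n)) * p) \<in> tens_ideal I"
    by (rule is_ideal_mult[OF is_ideal_tens_ideal])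
  then have "poly_eval e1_mon ?Phi - p \<in> tens_ideal I"
    unfolding right_diff_distrib of_nat_mult_cancel_mpoly[OF fact_gt_zero]
    by (simp add: ring_map_mult[OF ring_map_poly_eval])
  then have "p - poly_eval e1_mon ?Phi \<in> tens_ideal I"
    using is_ideal_uminus[OF is_ideal_tens_ideal] by fastforce
  then show ?thesis using TPoly_mult[OF TPoly_pconst TPoly_Theta] by blast
qed

text \<open>Theta maps the image of Phi, as an element of the ideal, to a relation; by linearity
  over F[T] it also maps it to n! Phi modulo relations.\<close>

lemma tens_kernel:
  assumes I: "is_ideal (I :: ('w,'k::field_char_0) mpoly set)" and Phi: "Phi \<in> TPoly"
    and mem: "(poly_eval e1_mon Phi :: ('w \<times> 'n::finite,'k) mpoly) \<in> tens_ideal I"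
  shows "Phi \<in> trace_relations CARD('n) I"
proof -
  obtain e where e: "bij_betw e {..<CARD('n)} (UNIV :: 'n set)" using enumeration_exists by blast
  let ?c = "inverse (of_nat (fact CARD('n))) :: 'k"
  have "Theta e (poly_eval e1_mon Phi * 1) \<in> trace_relations CARD('n) I"
    using Theta_tens_ideal[OF e I mem] by simp
  from trace_relations_diff[OF this Theta_poly_eval_e1[OF e, of Phi 1]]
  have "of_nat (fact CARD('n)) * Phi \<in> trace_relations CARD('n) I"
    by (simp add: Theta_1 poly_eval_Tvar_id[OF Phi] mult.commute)
  from trace_relations_mult[OF TPoly_pconst this, of ?c] show ?thesis
    by (simp only: of_nat_mult_cancel_mpoly[OF fact_gt_zero])
qed

section \<open>Matrices modulo an ideal\<close>

definition mat_cong :: "'a::comm_ring_1 set \<Rightarrow> 'a^'n^'m \<Rightarrow> 'a^'n^'m \<Rightarrow> bool" where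
  "mat_cong J A B \<longleftrightarrow> (\<forall>i j. cong_ideal J (A $ i $ j) (B $ i $ j))"

lemma mat_cong_refl [simp]: "is_ideal J \<Longrightarrow> mat_cong J A A"
  by (simp add: mat_cong_def)

lemma mat_cong_trans: "is_ideal J \<Longrightarrow> mat_cong J A B \<Longrightarrow> mat_cong J B C \<Longrightarrow> mat_cong J A C"
  unfolding mat_cong_def by (blast intro: cong_ideal_trans)

lemma mat_cong_add:
  "is_ideal J \<Longrightarrow> mat_cong J A B \<Longrightarrow> mat_cong J A' B' \<Longrightarrow> mat_cong J (A + A') (B + B')"
  by (simp add: mat_cong_def cong_ideal_add)

lemma mat_cong_mult:
  "is_ideal J \<Longrightarrow> mat_cong J A B \<Longrightarrow> mat_cong J A' B' \<Longrightarrow> mat_cong J (A ** A') (B ** B')"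
  by (auto simp: mat_cong_def matrix_matrix_mult_def intro!: cong_ideal_sum cong_ideal_mult)

lemma mat_cong_scal: "is_ideal J \<Longrightarrow> mat_cong J A B \<Longrightarrow> mat_cong J (mat_scal c A) (mat_scal c B)"
  by (auto simp: mat_cong_def mat_scal_def intro!: cong_ideal_mult)

lemma mat_cong_trace: "is_ideal J \<Longrightarrow> mat_cong J A B \<Longrightarrow> cong_ideal J (trace A) (trace B)"
  by (auto simp: mat_cong_def trace_def intro!: cong_ideal_sum)

definition map_mat :: "('a \<Rightarrow> 'b) \<Rightarrow> 'a^'n^'m \<Rightarrow> 'b^'n^'m" where
  "map_mat f A = (\<chi> i j. f (A $ i $ j))"

lemma map_mat_nth [simp]: "map_mat f A $ i $ j = f (A $ i $ j)"
  by (simp add: map_mat_def)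

lemma map_mat_mult: "ring_map f \<Longrightarrow> map_mat f (A ** B) = map_mat f A ** map_mat f B"
  by (simp add: vec_eq_iff matrix_matrix_mult_def ring_map_sum ring_map_mult)

lemma map_mat_add: "ring_map f \<Longrightarrow> map_mat f (A + B) = map_mat f A + map_mat f B"
  by (simp add: vec_eq_iff ring_map_add)

lemma map_mat_one: "ring_map f \<Longrightarrow> map_mat f (mat 1) = mat 1"
  by (simp add: vec_eq_iff mat_def ring_map_0 ring_map_1)

lemma map_mat_scal: "ring_map f \<Longrightarrow> map_mat f (mat_scal c A) = mat_scal (f c) (map_mat f A)"
  by (simp add: vec_eq_iff mat_scal_def ring_map_mult)

lemma trace_map_mat: "ring_map f \<Longrightarrow> trace (map_mat f A) = f (trace A)"
  by (simp add: trace_def ring_map_sum)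

lemma mat_mult_add_left: "((B :: 'a::comm_ring_1^'n^'m) + C) ** A = B ** A + C ** A"
  by (simp add: vec_eq_iff matrix_matrix_mult_def distrib_right sum.distrib)

lemma mat_scal_mult_left: "mat_scal (c::'a::comm_ring_1) A ** B = mat_scal c (A ** B)"
  by (simp add: vec_eq_iff mat_scal_def matrix_matrix_mult_def sum_distrib_left mult.assoc)

lemma mat_scal_mult_right: "A ** mat_scal (c::'a::comm_ring_1) B = mat_scal c (A ** B)"
  by (simp add: vec_eq_iff mat_scal_def matrix_matrix_mult_def sum_distrib_left mult.left_commute)

lemma mat_scal_mat_scal: "mat_scal (c::'a::comm_ring_1) (mat_scal d A) = mat_scal (c * d) A"
  by (simp add: vec_eq_iff mat_scal_def mult.assoc)

lemma mat_scal_0 [simp]: "mat_scal (0::'a::comm_ring_1) A = 0"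
  by (simp add: vec_eq_iff mat_scal_def)

lemma mat_scal_add_left: "mat_scal (c + d) A = mat_scal (c::'a::comm_ring_1) A + mat_scal d A"
  by (simp add: vec_eq_iff mat_scal_def distrib_right)

lemma trace_mat_scal: "trace (mat_scal (c::'a::comm_ring_1) A) = c * trace A"
  by (simp add: trace_def mat_scal_def sum_distrib_left)

text \<open>Generic matrices commute only modulo the ideal. Exact matrix identities are therefore
  stated for words, and monomials enter once letters may be reordered.\<close>

definition word :: "('w \<Rightarrow> 'a::semiring_1^'n^'n) \<Rightarrow> 'w list \<Rightarrow> 'a^'n^'n" where
  "word X ws = foldr (\<lambda>w M. X w ** M) ws (mat 1)"

lemma word_Nil [simp]: "word X [] = mat 1"
  and word_Cons [simp]: "word X (w # ws) = X w ** word X ws"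
  by (simp_all add: word_def)

lemma word_append: "word X (ws @ vs) = word X ws ** word X vs"
  by (induction ws) (auto simp: matrix_mul_assoc)

lemma eval_mon_eq_word: "eval_mon X m = word X (mono_list m)"
  by (simp add: eval_mon_def word_def)

lemma map_mat_word: "ring_map f \<Longrightarrow> map_mat f (word X ws) = word (\<lambda>w. map_mat f (X w)) ws"
  by (induction ws) (auto simp: map_mat_one map_mat_mult)

lemma count_list_mono_list: "count_list (mono_list m) w = Poly_Mapping.lookup m w"
proof -
  have "\<exists>xs. \<forall>w. count_list xs w = Poly_Mapping.lookup m w"
  proof (induction m rule: Poly_Mapping.update_induct)
    case const
    show ?case by (rule exI[of _ "[]"]) simp
  next
    case (update f a b)
    then obtain xs where xs: "\<forall>w. count_list xs w = Poly_Mapping.lookup f w" by blast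
    have "count_list (replicate b a) w = (if w = a then b else 0)" for w
      by (induction b) auto
    then show ?case using xs update(1)
      by (intro exI[of _ "replicate b a @ xs"]) (auto simp: lookup_update in_keys_iff)
  qed
  then show ?thesis unfolding mono_list_def by (rule someI2_ex) blast
qed

lemma mset_eq_iff_count_list: "mset xs = mset ys \<longleftrightarrow> (\<forall>w. count_list xs w = count_list ys w)"
  by (simp add: multiset_eq_iff count_mset count_list_eq_length_filter)

lemma prod_list_mono_list:
  fixes s :: "'w \<Rightarrow> 'b::comm_ring_1"
  shows "prod_list (map s (mono_list m)) = mon_eval s m"
proof -
  have "prod_list (map s xs) = mon_eval s m" if "\<And>w. count_list xs w = Poly_Mapping.lookup m w" for xs
    using that
  proof (induction xs arbitrary: m)
    case Nil
    then have "m = 0" by (intro poly_mapping_eqI) simp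
    then show ?case by simp
  next
    case (Cons x xs)
    let ?m = "m - Poly_Mapping.single x 1"
    have pos: "Poly_Mapping.lookup m x > 0" using Cons.prems[of x] by simp
    have l: "count_list xs w = Poly_Mapping.lookup ?m w" for w
      using Cons.prems[of w] by (auto simp: lookup_minus lookup_single when_def split: if_splits)
    have "m = Poly_Mapping.single x 1 + ?m"
      using pos by (intro poly_mapping_eqI) (auto simp: lookup_add lookup_minus lookup_single when_def)
    then have "mon_eval s m = s x * mon_eval s ?m"
      by (metis mon_eval_add mon_eval_single power_one_right)
    then show ?case using Cons.IH[OF l] by simp
  qed
  then show ?thesis using count_list_mono_list by metis
qed

text \<open>The first letter is carried to its position in \<open>vs\<close> by adjacent exchanges;
  each is a congruence because congruences survive multiplication on both sides.\<close>

lemma word_cong_mset: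
  fixes X :: "'w \<Rightarrow> 'a::comm_ring_1^'n^'n"
  assumes J: "is_ideal J" and X: "\<And>w w'. mat_cong J (X w ** X w') (X w' ** X w)"
    and "mset ws = mset vs"
  shows "mat_cong J (word X ws) (word X vs)"
  using assms(3)
proof (induction ws arbitrary: vs)
  case Nil
  then show ?case by (simp add: J)
next
  case (Cons w ws)
  have move: "mat_cong J (X w ** word X (us @ us')) (word X (us @ w # us'))" for us us'
  proof (induction us)
    case Nil
    show ?case by (simp add: J)
  next
    case (Cons u us)
    have "mat_cong J ((X w ** X u) ** word X (us @ us')) ((X u ** X w) ** word X (us @ us'))"
      by (intro mat_cong_mult J X) (simp add: J)
    moreover have "mat_cong J (X u ** (X w ** word X (us @ us'))) (X u ** word X (us @ w # us'))"
      by (intro mat_cong_mult J Cons) (simp add: J)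
    ultimately show ?case by (auto simp: matrix_mul_assoc intro: mat_cong_trans[OF J])
  qed
  have "w \<in> set vs" using Cons.prems by (metis list.set_intros(1) set_mset_mset)
  then obtain us us' where vs: "vs = us @ w # us'" by (meson split_list)
  then have "mset ws = mset (us @ us')" using Cons.prems by simp
  from Cons.IH[OF this] have "mat_cong J (X w ** word X ws) (X w ** word X (us @ us'))"
    by (intro mat_cong_mult J) (simp add: J)
  then show ?case unfolding vs using move[of us us'] by (auto intro: mat_cong_trans[OF J])
qed

lemma eval_mat_superset:
  assumes "finite S" "Poly_Mapping.keys p \<subseteq> S"
  shows "eval_mat X p = (\<Sum>m\<in>S. mat_scal (pconst (Poly_Mapping.lookup p m)) (eval_mon X m))"
  unfolding eval_mat_def using assms
  by (intro sum.mono_neutral_left) (auto simp: in_keys_iff)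

lemma eval_mat_add: "eval_mat X (p + q) = eval_mat X p + eval_mat X q"
proof -
  let ?S = "Poly_Mapping.keys p \<union> Poly_Mapping.keys q"
  have "Poly_Mapping.keys (p + q) \<subseteq> ?S" by (rule Poly_Mapping.keys_add)
  then show ?thesis
    by (subst (1 2 3) eval_mat_superset[where S = ?S])
      (auto simp: lookup_add pconst_add mat_scal_add_left sum.distrib)
qed

lemma eval_mat_single: "eval_mat X (Poly_Mapping.single m c) = mat_scal (pconst c) (eval_mon X m)"
  by (cases "c = 0") (auto simp: eval_mat_def)

text \<open>\<open>mono_list (m + m')\<close> is a chosen ordering unrelated to those of m and m',
  so evaluation becomes multiplicative only when letters commute modulo J.\<close>

lemma eval_mat_mult_cong:
  fixes X :: "'w \<Rightarrow> ('u,'k::comm_ring_1) mpoly^'n^'n"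
  assumes J: "is_ideal J" and X: "\<And>w w'. mat_cong J (X w ** X w') (X w' ** X w)"
  shows "mat_cong J (eval_mat X (p * q)) (eval_mat X p ** eval_mat X q)"
proof (induction p rule: mpoly_monomial_induct)
  case (single m a)
  show ?case
  proof (induction q rule: mpoly_monomial_induct)
    case (single m' b)
    have "mset (mono_list (m + m')) = mset (mono_list m @ mono_list m')"
      unfolding mset_eq_iff_count_list by (simp add: count_list_mono_list lookup_add)
    from word_cong_mset[OF J X this]
    have "mat_cong J (eval_mon X (m + m')) (eval_mon X m ** eval_mon X m')"
      by (simp add: eval_mon_eq_word word_append)
    from mat_cong_scal[OF J this, of "pconst (a * b)"] show ?case
      by (simp add: mult_single eval_mat_single mat_scal_mult_left mat_scal_mult_right
          mat_scal_mat_scal pconst_mult mult.commute[of "pconst b"])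
  next
    case (add p q)
    then show ?case by (simp add: distrib_left eval_mat_add matrix_add_ldistrib mat_cong_add J)
  qed
next
  case (add p q)
  then show ?case by (simp add: distrib_right eval_mat_add mat_mult_add_left mat_cong_add J)
qed

section \<open>The fundamental trace identity\<close>

text \<open>The trace of \<open>M\<^sub>1 \<otimes> \<dots> \<otimes> M\<^sub>k\<close> times the antisymmetrizer, in coordinates.\<close>
definition alt_trace :: "nat \<Rightarrow> (nat \<Rightarrow> 'a::comm_ring_1^'n::finite^'n) \<Rightarrow> 'a" where
  "alt_trace k M = (\<Sum>i\<in>{..<k} \<rightarrow>\<^sub>E UNIV. \<Sum>\<sigma>\<in>{\<sigma>. \<sigma> permutes {..<k}}.
      of_int (sign \<sigma>) * (\<Prod>j<k. M (\<sigma> j) $ i j $ i (\<sigma> j)))"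

text \<open>The index y of the last tensor factor is summed first. If sigma fixes k this gives the
  trace of \<open>M k\<close>. Otherwise k lies between some j0 and b in its cycle, and y joins the
  column of \<open>M k\<close> to the row of \<open>M b\<close>, hence the product in this
  order.\<close>

lemma alt_trace_Suc:
  fixes M :: "nat \<Rightarrow> 'a::comm_ring_1^'n::finite^'n"
  shows "alt_trace (Suc k) M
     = trace (M k) * alt_trace k M - (\<Sum>b<k. alt_trace k (M(b := M k ** M b)))"
proof -
  let ?S = "{..<k}"
  let ?s = "\<lambda>q b. Transposition.transpose k b \<circ> q"
  define P where "P M S \<sigma> i = (\<Prod>j\<in>S. M (\<sigma> j) $ i j $ i (\<sigma> j))"
    for M :: "nat \<Rightarrow> 'a^'n^'n" and S and \<sigma> :: "nat \<Rightarrow> nat" and i :: "nat \<Rightarrow> 'n"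
  have P_upd: "P M ?S q (g(k := y)) = P M ?S q g" if "q permutes ?S" for M q g y
    unfolding P_def using that by (intro prod.cong) (auto dest: permutes_in_image)
  have fix_k: "(\<Sum>y\<in>UNIV. P M (insert k ?S) q (g(k := y))) = trace (M k) * P M ?S q g"
    if q: "q permutes ?S" for q g
  proof -
    have "q k = k" using q by (simp add: permutes_not_in)
    then have "P M (insert k ?S) q (g(k := y)) = M k $ y $ y * P M ?S q g" for y
      using P_upd[OF q, of M g y] by (simp add: P_def)
    then show ?thesis by (simp add: trace_def sum_distrib_right)
  qed
  have move: "(\<Sum>y\<in>UNIV. P M (insert k ?S) (?s q b) (g(k := y))) = P (M(b := M k ** M b)) ?S q g"
    if q: "q permutes ?S" and b: "b < k" for q b g
  proof -
    have qk: "q k = k" using q by (simp add: permutes_not_in)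
    obtain j0 where j0: "q j0 = b" using permutes_surj[OF q] by (metis surjD)
    then have j0k: "j0 < k" using b q by (metis lessThan_iff permutes_in_image)
    have inj: "q j = b \<longleftrightarrow> j = j0" for j using permutes_inj[OF q] j0 by (auto dest: injD)
    have lt: "q j < k" if "j < k" for j using that q by (metis lessThan_iff permutes_in_image)
    let ?R = "\<Prod>j\<in>?S - {j0}. M (q j) $ g j $ g (q j)"
    have "P M (insert k ?S) (?s q b) (g(k := y)) = M b $ y $ g b * (M k $ g j0 $ y * ?R)" for y
    proof -
      have "P M (insert k ?S) (?s q b) (g(k := y)) = M b $ y $ g b * P M ?S (?s q b) (g(k := y))"
        using b by (simp add: P_def qk)
      also have "P M ?S (?s q b) (g(k := y)) = M k $ g j0 $ y * (\<Prod>j\<in>?S - {j0}. M (?s q b j) $ (g(k := y)) j $ (g(k := y)) (?s q b j))"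
        unfolding P_def using j0k j0 by (subst prod.remove[of _ j0]) auto
      also have "(\<Prod>j\<in>?S - {j0}. M (?s q b j) $ (g(k := y)) j $ (g(k := y)) (?s q b j)) = ?R"
      proof (rule prod.cong[OF refl])
        fix j assume j: "j \<in> ?S - {j0}"
        then have "?s q b j = q j" "q j \<noteq> k" using inj lt[of j] by (auto simp: Transposition.transpose_def)
        then show "M (?s q b j) $ (g(k := y)) j $ (g(k := y)) (?s q b j) = M (q j) $ g j $ g (q j)"
          using j by simp
      qed
      finally show ?thesis .
    qed
    then have "(\<Sum>y\<in>UNIV. P M (insert k ?S) (?s q b) (g(k := y))) = (M k ** M b) $ g j0 $ g b * ?R"
      by (simp add: matrix_matrix_mult_def sum_distrib_right ac_simps)
    also have "\<dots> = P (M(b := M k ** M b)) ?S q g"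
    proof -
      have "?R = (\<Prod>j\<in>?S - {j0}. (M(b := M k ** M b)) (q j) $ g j $ g (q j))"
        by (intro prod.cong) (auto simp: inj)
      then show ?thesis unfolding P_def using j0k j0 by (subst (2) prod.remove[of _ j0]) auto
    qed
    finally show ?thesis .
  qed
  have sign: "sign (?s q b) = - sign q" if "q permutes ?S" "b < k" for q b
  proof -
    have "permutation q" using that by (auto simp: permutation_permutes)
    then show ?thesis using that by (subst sign_compose) (auto simp: permutation_swap_id sign_swap_id)
  qed
  have inner: "(\<Sum>y\<in>UNIV. \<Sum>\<sigma>\<in>{\<sigma>. \<sigma> permutes insert k ?S}. of_int (sign \<sigma>) * P M (insert k ?S) \<sigma> (g(k := y)))
    = (\<Sum>q\<in>{q. q permutes ?S}. trace (M k) * (of_int (sign q) * P M ?S q g))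
      - (\<Sum>b<k. \<Sum>q\<in>{q. q permutes ?S}. of_int (sign q) * P (M(b := M k ** M b)) ?S q g)" for g
  proof -
    have "(\<Sum>y\<in>UNIV. \<Sum>\<sigma>\<in>{\<sigma>. \<sigma> permutes insert k ?S}. of_int (sign \<sigma>) * P M (insert k ?S) \<sigma> (g(k := y)))
      = (\<Sum>\<sigma>\<in>{\<sigma>. \<sigma> permutes insert k ?S}. of_int (sign \<sigma>) * (\<Sum>y\<in>UNIV. P M (insert k ?S) \<sigma> (g(k := y))))"
      by (subst sum.swap) (simp add: sum_distrib_left)
    also have "\<dots> = (\<Sum>b\<in>insert k ?S. \<Sum>q\<in>{q. q permutes ?S}.
        of_int (sign (?s q b)) * (\<Sum>y\<in>UNIV. P M (insert k ?S) (?s q b) (g(k := y))))"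
      by (rule sum_over_permutations_insert) auto
    also have "\<dots> = (\<Sum>q\<in>{q. q permutes ?S}. of_int (sign q) * (\<Sum>y\<in>UNIV. P M (insert k ?S) q (g(k := y))))
      + (\<Sum>b<k. \<Sum>q\<in>{q. q permutes ?S}.
        of_int (sign (?s q b)) * (\<Sum>y\<in>UNIV. P M (insert k ?S) (?s q b) (g(k := y))))"
      by (subst sum.insert) auto
    also have "(\<Sum>b<k. \<Sum>q\<in>{q. q permutes ?S}.
        of_int (sign (?s q b)) * (\<Sum>y\<in>UNIV. P M (insert k ?S) (?s q b) (g(k := y))))
      = (\<Sum>b<k. \<Sum>q\<in>{q. q permutes ?S}. - (of_int (sign q) * P (M(b := M k ** M b)) ?S q g))"
    proof (intro sum.cong refl)
      fix b q assume "b \<in> ?S" "q \<in> {q. q permutes ?S}"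
      then have bq: "b < k" "q permutes ?S" by auto
      show "of_int (sign (?s q b)) * (\<Sum>y\<in>UNIV. P M (insert k ?S) (?s q b) (g(k := y)))
          = - (of_int (sign q) * P (M(b := M k ** M b)) ?S q g)"
        unfolding sign[OF bq(2,1)] move[OF bq(2,1)] by simp
    qed
    also have "(\<Sum>q\<in>{q. q permutes ?S}. of_int (sign q) * (\<Sum>y\<in>UNIV. P M (insert k ?S) q (g(k := y))))
      = (\<Sum>q\<in>{q. q permutes ?S}. trace (M k) * (of_int (sign q) * P M ?S q g))"
      by (intro sum.cong refl) (auto simp only: fix_k mem_Collect_eq mult.left_commute)
    finally show ?thesis by (simp only: sum_negf add_uminus_conv_diff)
  qed
  have "alt_trace (Suc k) M = (\<Sum>g\<in>?S \<rightarrow>\<^sub>E UNIV. \<Sum>y\<in>UNIV.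
     \<Sum>\<sigma>\<in>{\<sigma>. \<sigma> permutes insert k ?S}. of_int (sign \<sigma>) * P M (insert k ?S) \<sigma> (g(k := y)))"
    by (simp only: alt_trace_def sum_PiE_Suc) (simp only: P_def lessThan_Suc)
  also have "\<dots> = trace (M k) * alt_trace k M
      - (\<Sum>g\<in>?S \<rightarrow>\<^sub>E UNIV. \<Sum>b<k. \<Sum>q\<in>{q. q permutes ?S}. of_int (sign q) * P (M(b := M k ** M b)) ?S q g)"
    unfolding inner alt_trace_def P_def[symmetric] by (simp add: sum_subtractf sum_distrib_left)
  also have "(\<Sum>g\<in>?S \<rightarrow>\<^sub>E UNIV. \<Sum>b<k. \<Sum>q\<in>{q. q permutes ?S}. of_int (sign q) * P (M(b := M k ** M b)) ?S q g)
      = (\<Sum>b<k. alt_trace k (M(b := M k ** M b)))"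
    unfolding alt_trace_def P_def[symmetric] by (rule sum.swap)
  finally show ?thesis .
qed

lemma alt_trace_0: "alt_trace 0 M = 1"
  by (simp add: alt_trace_def)

text \<open>Among more than n indices from n values two agree. Exchanging their positions changes
  the sign of sigma but not the product, so the sum over sigma is its own negative: exterior powers
  vanish beyond degree n.\<close>

lemma alt_trace_eq_0:
  fixes M :: "nat \<Rightarrow> 'a::comm_ring_1^'n::finite^'n"
  assumes k: "k > CARD('n)" and two: "\<And>x::'a. x + x = 0 \<Longrightarrow> x = 0"
  shows "alt_trace k M = 0"
  unfolding alt_trace_def
proof (rule sum.neutral, intro ballI)
  fix i :: "nat \<Rightarrow> 'n" assume "i \<in> {..<k} \<rightarrow>\<^sub>E UNIV"
  have "\<not> inj_on i {..<k}"
  proof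
    assume "inj_on i {..<k}"
    from card_inj_on_le[OF this, of UNIV] k show False by simp
  qed
  then obtain s t where st: "s < k" "t < k" "i s = i t" "s \<noteq> t" unfolding inj_on_def by auto
  let ?\<tau> = "Transposition.transpose s t"
  let ?F = "\<lambda>\<sigma>. \<Prod>j<k. M (\<sigma> j) $ i j $ i (\<sigma> j)"
  let ?X = "\<Sum>\<sigma>\<in>{\<sigma>. \<sigma> permutes {..<k}}. of_int (sign \<sigma>) * ?F \<sigma>"
  have \<tau>: "?\<tau> permutes {..<k}" using st by (intro permutes_swap_id) auto
  have i\<tau>: "i (?\<tau> j) = i j" for j using st by (auto simp: Transposition.transpose_def)
  have "?X = (\<Sum>\<sigma>\<in>{\<sigma>. \<sigma> permutes {..<k}}. of_int (sign (\<sigma> \<circ> ?\<tau>)) * ?F (\<sigma> \<circ> ?\<tau>))"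
    by (rule sum_permutations_compose_right[OF \<tau>])
  also have "\<dots> = (\<Sum>\<sigma>\<in>{\<sigma>. \<sigma> permutes {..<k}}. - (of_int (sign \<sigma>) * ?F \<sigma>))"
  proof (rule sum.cong[OF refl])
    fix \<sigma> assume "\<sigma> \<in> {\<sigma>. \<sigma> permutes {..<k}}"
    then have "permutation \<sigma>" by (auto simp: permutation_permutes)
    then have sg: "sign (\<sigma> \<circ> ?\<tau>) = - sign \<sigma>"
      using st by (subst sign_compose) (auto simp: permutation_swap_id sign_swap_id)
    have "?F \<sigma> = (\<Prod>j<k. M (\<sigma> (?\<tau> j)) $ i (?\<tau> j) $ i (\<sigma> (?\<tau> j)))"
      by (rule prod.permute[OF \<tau>, unfolded comp_def])
    then have "?F (\<sigma> \<circ> ?\<tau>) = ?F \<sigma>" by (simp add: i\<tau>)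
    then show "of_int (sign (\<sigma> \<circ> ?\<tau>)) * ?F (\<sigma> \<circ> ?\<tau>) = - (of_int (sign \<sigma>) * ?F \<sigma>)"
      by (simp add: sg)
  qed
  finally have "?X = - ?X" by (simp add: sum_negf)
  then have "?X + ?X = 0" by (simp only: eq_neg_iff_add_eq_0)
  then show "?X = 0" by (rule two)
qed

lemma alt_trace_cong:
  assumes J: "is_ideal J" and "\<And>j. mat_cong J (M j) (M' j)"
  shows "cong_ideal J (alt_trace k M) (alt_trace k M')"
  unfolding alt_trace_def using assms(2)
  by (intro cong_ideal_sum J cong_ideal_mult cong_ideal_prod) (auto simp: mat_cong_def J)

text \<open>Both sides obey the same recursion, with \<open>M k ** M b\<close> in the place of
  \<open>h b * h k\<close>; commutation modulo J reconciles the two.\<close>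

lemma cyc_sum_trace_cong:
  fixes X :: "'w \<Rightarrow> ('u,'k::comm_ring_1) mpoly^'n::finite^'n"
  assumes J: "is_ideal J" and X: "\<And>w w'. mat_cong J (X w ** X w') (X w' ** X w)"
  shows "cong_ideal J (cyc_sum (\<lambda>h. trace (eval_mat X h)) k h) (alt_trace k (\<lambda>j. eval_mat X (h j)))"
proof (induction k arbitrary: h)
  case 0
  show ?case by (simp add: cyc_sum_0 alt_trace_0 J)
next
  case (Suc k)
  have "cong_ideal J (cyc_sum (\<lambda>h. trace (eval_mat X h)) k (h(b := h b * h k)))
     (alt_trace k ((\<lambda>j. eval_mat X (h j))(b := eval_mat X (h k) ** eval_mat X (h b))))" for b
  proof (rule cong_ideal_trans[OF J Suc.IH], rule alt_trace_cong[OF J])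
    fix j
    show "mat_cong J (eval_mat X ((h(b := h b * h k)) j))
        (((\<lambda>j. eval_mat X (h j))(b := eval_mat X (h k) ** eval_mat X (h b))) j)"
      using eval_mat_mult_cong[OF J X, where p = "h k" and q = "h b"] by (simp add: J mult.commute)
  qed
  then show ?case unfolding cyc_sum_Suc alt_trace_Suc
    by (intro cong_ideal_diff J cong_ideal_mult cong_ideal_sum Suc.IH) (simp_all add: J)
qed

section \<open>The representation ideal\<close>

lemma is_ideal_rep_ideal: "is_ideal (rep_ideal I)"
  unfolding rep_ideal_def by (rule is_ideal_ideal_span)

lemma generic_commutator_in_rep_ideal:
  "(generic w ** generic w' - generic w' ** generic w) $ i $ j \<in> rep_ideal I"
  unfolding rep_ideal_def by (rule ideal_span_base) auto

lemma generic_commute: "mat_cong (rep_ideal I) (generic w ** generic w') (generic w' ** generic w)"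
  unfolding mat_cong_def cong_ideal_def
  by (metis generic_commutator_in_rep_ideal vector_minus_component)

lemma eval_mat_in_rep_ideal: "f \<in> I \<Longrightarrow> eval_mat generic f $ i $ j \<in> rep_ideal I"
  unfolding rep_ideal_def by (rule ideal_span_base, simp, blast)

lemma tr_mon_eq_word: "tr_mon m = trace (word generic (mono_list m))"
  by (simp add: tr_mon_def eval_mon_eq_word)

lemma mono_list_0: "mono_list 0 = []"
proof -
  have "count_list (mono_list 0) w = 0" for w :: 'a by (simp add: count_list_mono_list)
  then show ?thesis by (metis count_list_0_iff list.set_intros(1) neq_Nil_conv)
qed

lemma poly_eval_tr_Tvar:
  "poly_eval tr_mon (Tvar CARD('n) m) = (tr_mon m :: ('w \<times> 'n::finite \<times> 'n,'k::comm_ring_1) mpoly)"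
  by (cases "m = 0") (auto simp: Tvar_def pconst_of_nat[symmetric] tr_mon_eq_word trace_I mono_list_0)

lemma poly_eval_tr_Tlin:
  fixes h :: "('w,'k::comm_ring_1) mpoly"
  shows "poly_eval tr_mon (Tlin CARD('n) h)
     = (trace (eval_mat generic h) :: ('w \<times> 'n::finite \<times> 'n,'k) mpoly)"
proof (induction h rule: mpoly_monomial_induct)
  case (single m c)
  show ?case
    by (simp add: single_eq_pconst Tlin_pconst_mult Tlin_pmon ring_map_mult[OF ring_map_poly_eval] poly_eval_tr_Tvar)
      (simp add: single_eq_pconst[symmetric] eval_mat_single trace_mat_scal tr_mon_def)
qed (simp add: Tlin_add ring_map_add[OF ring_map_poly_eval] eval_mat_add trace_add)

text \<open>A relation of type (a) becomes the trace of the antisymmetrizer on n + 1 factors applied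
  to the matrices h_j(xi), which is zero; T(f) becomes the sum of the diagonal entries of
  f(xi).\<close>

lemma trace_relations_tr:
  fixes Phi :: "('w \<Rightarrow>\<^sub>0 nat, 'k::field_char_0) mpoly"
  assumes "Phi \<in> trace_relations CARD('n) I"
  shows "(poly_eval tr_mon Phi :: ('w \<times> 'n::finite \<times> 'n,'k) mpoly) \<in> rep_ideal I"
  using assms unfolding trace_relations_def
proof (induction rule: ideal_span_induct)
  case zero
  show ?case by (simp add: ring_map_0[OF ring_map_poly_eval] is_ideal_0[OF is_ideal_rep_ideal])
next
  case (add r s x)
  have two: "x = 0" if "x + x = 0" for x :: "('w \<times> 'n \<times> 'n,'k) mpoly"
    using of_nat_mult_cancel_mpoly[of 2 x] that by (simp add: mult_2)
  have "(poly_eval tr_mon s :: ('w \<times> 'n \<times> 'n,'k) mpoly) \<in> rep_ideal I"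
    using add(2)
  proof
    assume "s \<in> {Psi CARD('n) h |h. True}"
    then obtain h where s: "s = Psi CARD('n) h" by blast
    have "cong_ideal (rep_ideal I) (poly_eval tr_mon s :: ('w \<times> 'n \<times> 'n,'k) mpoly)
        (alt_trace (Suc CARD('n)) (\<lambda>j. eval_mat generic (h j)))"
      unfolding s Psi_eq_cyc_sum ring_map_cyc_sum[OF ring_map_poly_eval] poly_eval_tr_Tlin
      by (rule cyc_sum_trace_cong[OF is_ideal_rep_ideal generic_commute])
    then show ?thesis
      by (subst (asm) alt_trace_eq_0) (use two in \<open>auto simp: cong_ideal_def\<close>)
  next
    assume "s \<in> {Tlin CARD('n) f |f. f \<in> I}"
    then obtain f where f: "f \<in> I" "s = Tlin CARD('n) f" by blast
    show ?thesis unfolding f(2) poly_eval_tr_Tlin trace_def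
      by (intro is_ideal_sum[OF is_ideal_rep_ideal] eval_mat_in_rep_ideal f(1))
  qed
  then show ?case using add(3)
    by (simp add: ring_map_add[OF ring_map_poly_eval] ring_map_mult[OF ring_map_poly_eval]
        is_ideal_add[OF is_ideal_rep_ideal] is_ideal_mult[OF is_ideal_rep_ideal])
qed

subsection \<open>Restriction to diagonal matrices\<close>

definition diag_mat :: "('n \<Rightarrow> 'a::comm_ring_1) \<Rightarrow> 'a^'n^'n" where
  "diag_mat d = (\<chi> i j. if i = j then d i else 0)"

lemma diag_mat_mult: "diag_mat a ** diag_mat b = diag_mat (\<lambda>i::'n::finite. a i * b i)"
proof -
  have "(\<Sum>k\<in>UNIV. (if i = k then a i else 0) * (if k = j then b k else 0)) = (if i = j then a i * b i else 0)" for i j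
    by (subst sum.remove[of _ i]) (auto intro!: sum.neutral)
  then show ?thesis by (simp add: vec_eq_iff matrix_matrix_mult_def diag_mat_def)
qed

lemma diag_mat_scal: "mat_scal c (diag_mat a) = diag_mat (\<lambda>i. c * a i)"
  by (simp add: vec_eq_iff mat_scal_def diag_mat_def)

lemma word_diag_mat:
  "word (\<lambda>w. diag_mat (\<lambda>i::'n::finite. d i w)) ws = diag_mat (\<lambda>i. prod_list (map (d i) ws))"
proof (induction ws)
  case Nil
  show ?case by (simp add: vec_eq_iff mat_def diag_mat_def)
qed (simp add: diag_mat_mult)

text \<open>On representatives, the homomorphism from V_n(A) to the n-fold tensor power of A that
  classifies the diagonal representation, whose i-th entry is the i-th embedding of A.\<close>

definition diag_restrict :: "('w \<times> 'n \<times> 'n,'k::comm_ring_1) mpoly \<Rightarrow> ('w \<times> 'n,'k) mpoly" where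
  "diag_restrict = poly_eval (\<lambda>(w, i, j). if i = j then copy_var i w else 0)"

lemma ring_map_diag_restrict: "ring_map diag_restrict"
  unfolding diag_restrict_def by (rule ring_map_poly_eval)

lemma diag_restrict_pconst [simp]: "diag_restrict (pconst c) = pconst c"
  by (simp add: diag_restrict_def)

lemma diag_restrict_generic: "map_mat diag_restrict (generic w) = diag_mat (\<lambda>i. copy_var i w)"
  by (simp add: vec_eq_iff generic_def diag_restrict_def diag_mat_def)

lemma diag_restrict_eval_mon:
  "map_mat diag_restrict (eval_mon generic m) = diag_mat (\<lambda>i::'n::finite. mon_eval (copy_var i) m)"
  unfolding eval_mon_eq_word map_mat_word[OF ring_map_diag_restrict] diag_restrict_generic
    word_diag_mat prod_list_mono_list ..

lemma diag_restrict_eval_mat: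
  "map_mat diag_restrict (eval_mat generic f) = diag_mat (\<lambda>i::'n::finite. poly_eval (copy_var i) f)"
proof (induction f rule: mpoly_monomial_induct)
  case (single m c)
  show ?case
    by (simp add: eval_mat_single map_mat_scal[OF ring_map_diag_restrict] diag_restrict_eval_mon diag_mat_scal)
      (simp add: single_eq_pconst ring_map_mult[OF ring_map_poly_eval])
next
  case (add p q)
  then show ?case
    by (simp add: eval_mat_add map_mat_add[OF ring_map_diag_restrict] ring_map_add[OF ring_map_poly_eval])
      (simp add: vec_eq_iff diag_mat_def)
qed

lemma diag_restrict_tr_mon: "diag_restrict (tr_mon m) = e1_mon m"
  unfolding tr_mon_def trace_map_mat[OF ring_map_diag_restrict, symmetric] diag_restrict_eval_mon e1_mon_eq
  by (simp add: trace_def diag_mat_def)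

lemma diag_restrict_poly_eval_tr: "diag_restrict (poly_eval tr_mon Phi) = poly_eval e1_mon Phi"
  by (rule ring_map_eqI[of "\<lambda>Phi. diag_restrict (poly_eval tr_mon Phi)"])
    (simp_all add: ring_map_comp ring_map_diag_restrict ring_map_poly_eval diag_restrict_tr_mon)

text \<open>Diagonal matrices commute, so the commutators vanish; f of the diagonal generic matrices
  is diagonal, and its i-th entry is f at place i, a generator of the other ideal.\<close>

lemma diag_restrict_rep_ideal:
  fixes p :: "('w \<times> 'n::finite \<times> 'n,'k::comm_ring_1) mpoly"
  assumes "p \<in> rep_ideal I" shows "diag_restrict p \<in> tens_ideal I"
proof -
  have "p \<in> diag_restrict -` tens_ideal I"
    using assms unfolding rep_ideal_def
  proof (rule ideal_span_UNIV_minimal)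
    show "is_ideal (diag_restrict -` tens_ideal I)"
      by (rule is_ideal_vimage[OF ring_map_diag_restrict is_ideal_tens_ideal])
    have "diag_restrict ((generic w ** generic w' - generic w' ** generic w) $ i $ j) = (0 :: ('w \<times> 'n,'k) mpoly)"
      for w w' :: 'w and i j :: 'n
    proof -
      have "map_mat diag_restrict (generic w ** generic w' :: ('w \<times> 'n \<times> 'n,'k) mpoly^'n^'n) = map_mat diag_restrict (generic w' ** generic w)"
        by (simp add: map_mat_mult[OF ring_map_diag_restrict] diag_restrict_generic diag_mat_mult mult.commute)
      then have "diag_restrict ((generic w ** generic w' :: ('w \<times> 'n \<times> 'n,'k) mpoly^'n^'n) $ i $ j) = diag_restrict ((generic w' ** generic w) $ i $ j)"
        by (metis map_mat_nth)
      then show ?thesis by (simp add: ring_map_diff[OF ring_map_diag_restrict])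
    qed
    moreover have "diag_restrict (eval_mat generic f $ i $ j) \<in> tens_ideal I" if "f \<in> I" for f :: "('w,'k) mpoly" and i j :: 'n
    proof -
      have "diag_restrict (eval_mat generic f $ i $ j) = diag_mat (\<lambda>i. poly_eval (copy_var i) f) $ i $ j"
        using diag_restrict_eval_mat[of f] by (metis map_mat_nth)
      also have "\<dots> \<in> tens_ideal I"
      proof (cases "i = j")
        case True
        have "poly_eval (copy_var i) f \<in> tens_ideal I"
          unfolding tens_ideal_def by (rule ideal_span_base) (use that in auto)
        then show ?thesis using True by (simp add: diag_mat_def)
      qed (simp add: diag_mat_def is_ideal_0[OF is_ideal_tens_ideal])
      finally show ?thesis .
    qed
    ultimately show "{(generic w ** generic w' - generic w' ** generic w) $ i $ j |w w' i j. True}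
        \<union> {eval_mat generic f $ i $ j |f i j. f \<in> I}
       \<subseteq> (diag_restrict -` tens_ideal I :: ('w \<times> 'n \<times> 'n,'k) mpoly set)"
      by (auto simp: is_ideal_0[OF is_ideal_tens_ideal])
  qed
  then show ?thesis by simp
qed

subsection \<open>Conjugation\<close>

lemma ring_map_gl_act: "ring_map (gl_act g)"
  unfolding gl_act_def[abs_def] by (rule ring_map_poly_eval)

lemma gl_act_pconst [simp]: "gl_act g (pconst c) = pconst c"
  by (simp add: gl_act_def)

lemma gl_act_generic:
  "map_mat (gl_act g) (generic w) = const_mat g ** generic w ** const_mat (matrix_inv g)"
  by (simp add: vec_eq_iff generic_def gl_act_def)

lemma const_mat_mult: "const_mat (A ** B) = const_mat A ** const_mat B"
  by (simp add: vec_eq_iff const_mat_def matrix_matrix_mult_def pconst_sum pconst_mult)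

lemma const_mat_one: "const_mat (mat 1) = mat 1"
  by (simp add: vec_eq_iff const_mat_def mat_def)

lemma gl_act_tr_mon:
  assumes g: "invertible (g :: 'k::field^'n::finite^'n)"
  shows "gl_act g (tr_mon mu) = (tr_mon mu :: ('w \<times> 'n \<times> 'n,'k) mpoly)"
proof -
  let ?G = "const_mat g :: ('w \<times> 'n \<times> 'n,'k) mpoly^'n^'n"
  let ?H = "const_mat (matrix_inv g) :: ('w \<times> 'n \<times> 'n,'k) mpoly^'n^'n"
  have "g ** matrix_inv g = mat 1 \<and> matrix_inv g ** g = mat 1"
    using g unfolding invertible_def matrix_inv_def by (rule someI_ex)
  then have inv: "g ** matrix_inv g = mat 1" "matrix_inv g ** g = mat 1" by auto
  have GH: "?G ** ?H = mat 1" "?H ** ?G = mat 1"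
    unfolding const_mat_mult[symmetric] inv by (rule const_mat_one)+
  have "word (\<lambda>w. ?G ** generic w ** ?H) ws = ?G ** word generic ws ** ?H" for ws :: "'w list"
  proof (induction ws)
    case (Cons w ws)
    have "?G ** generic w ** ?H ** (?G ** word generic ws ** ?H)
        = ?G ** generic w ** (?H ** ?G) ** word generic ws ** ?H"
      by (simp only: matrix_mul_assoc)
    then show ?case using Cons by (simp add: GH matrix_mul_assoc)
  qed (simp add: GH)
  then have "gl_act g (tr_mon mu) = trace (?G ** (word generic (mono_list mu) ** ?H))"
    by (simp add: tr_mon_eq_word trace_map_mat[OF ring_map_gl_act, symmetric] map_mat_word[OF ring_map_gl_act]
       gl_act_generic matrix_mul_assoc)
  also have "\<dots> = trace (word generic (mono_list mu) ** (?H ** ?G))"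
    by (subst trace_mul_sym) (simp add: matrix_mul_assoc)
  finally show ?thesis by (simp add: GH tr_mon_eq_word)
qed

lemma rep_invariant_tr_mon: "rep_invariant I (tr_mon mu)"
  by (simp add: rep_invariant_def gl_act_tr_mon is_ideal_0[OF is_ideal_rep_ideal])

section \<open>Infinitesimal conjugation\<close>

definition derivation :: "(('u,'k::comm_ring_1) mpoly \<Rightarrow> ('u,'k) mpoly) \<Rightarrow> bool" where
  "derivation d \<longleftrightarrow> (\<forall>p q. d (p + q) = d p + d q) \<and> (\<forall>p q. d (p * q) = d p * q + p * d q)
     \<and> (\<forall>c. d (pconst c) = 0)"

lemma derivation_add: "derivation d \<Longrightarrow> d (p + q) = d p + d q"
  and derivation_mult: "derivation d \<Longrightarrow> d (p * q) = d p * q + p * d q"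
  and derivation_pconst: "derivation d \<Longrightarrow> d (pconst c) = 0"
  by (auto simp: derivation_def)

lemma derivation_0: "derivation d \<Longrightarrow> d 0 = 0"
  using derivation_pconst[of d 0] by simp

lemma derivation_1: "derivation d \<Longrightarrow> d 1 = 0"
  using derivation_pconst[of d 1] by simp

lemma derivation_pconst_mult: "derivation d \<Longrightarrow> d (pconst c * p) = pconst c * d p"
  by (simp add: derivation_mult derivation_pconst)

lemma derivation_uminus: assumes "derivation d" shows "d (- p) = - d p"
proof -
  have "d (- p) + d p = 0"
    unfolding derivation_add[OF assms, symmetric] by (simp add: derivation_0[OF assms])
  then show ?thesis by (simp add: eq_neg_iff_add_eq_0)
qed

lemma derivation_diff: "derivation d \<Longrightarrow> d (p - q) = d p - d q"
  using derivation_add[of d p "- q"] derivation_uminus[of d q] by simp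

lemma derivation_sum: "derivation d \<Longrightarrow> d (sum f S) = (\<Sum>x\<in>S. d (f x))"
  by (induction S rule: infinite_finite_induct) (auto simp: derivation_0 derivation_add)

lemma derivation_prod:
  assumes "derivation d" "finite S"
  shows "d (prod f S) = (\<Sum>s\<in>S. d (f s) * prod f (S - {s}))"
  using assms(2)
proof (induction S rule: finite_induct)
  case (insert x S)
  have "(\<Sum>s\<in>S. d (f s) * prod f (insert x S - {s})) = f x * (\<Sum>s\<in>S. d (f s) * prod f (S - {s}))"
    unfolding sum_distrib_left
  proof (rule sum.cong[OF refl])
    fix s assume "s \<in> S"
    then have "insert x S - {s} = insert x (S - {s})" using insert by auto
    then show "d (f s) * prod f (insert x S - {s}) = f x * (d (f s) * prod f (S - {s}))"
      using insert by simp
  qed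
  then show ?case using insert by (simp add: derivation_mult[OF assms(1)])
qed (simp add: derivation_1[OF assms(1)])

lemma derivation_eqI:
  assumes "derivation d" "derivation d'" "\<And>v. d (pvar v) = d' (pvar v)"
  shows "d p = d' p"
  by (induction p rule: mpoly_induct)
    (simp_all add: assms derivation_add derivation_mult derivation_pconst)

lemma derivation_sumI: "(\<And>x. x \<in> S \<Longrightarrow> derivation (d x)) \<Longrightarrow> derivation (\<lambda>p. \<Sum>x\<in>S. d x p)"
  by (induction S rule: infinite_finite_induct) (auto simp: derivation_def algebra_simps)

lemma derivation_scale: "derivation d \<Longrightarrow> derivation (\<lambda>p. c * d p)"
  by (auto simp: derivation_def algebra_simps)

text \<open>Homomorphisms into \<open>R[t]\<close> that reduce to the identity at \<open>t = 0\<close>; the coefficient of \<open>t\<close>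
  is a derivation.\<close>
definition t_hom :: "('u \<Rightarrow> ('u,'k::comm_ring_1) mpoly poly) \<Rightarrow> ('u,'k) mpoly \<Rightarrow> ('u,'k) mpoly poly" where
  "t_hom = hom_eval (\<lambda>c. [:pconst c:])"

lemma ring_map_const_poly: "ring_map (\<lambda>c. [:pconst c:])"
  by (simp add: ring_map_def pconst_add pconst_mult)

lemma ring_map_t_hom: "ring_map (t_hom s)"
  unfolding t_hom_def by (rule ring_map_hom_eval[OF ring_map_const_poly])

lemma t_hom_pconst [simp]: "t_hom s (pconst c) = [:pconst c:]"
  by (simp add: t_hom_def hom_eval_pconst[OF ring_map_const_poly])

lemma t_hom_pvar [simp]: "t_hom s (pvar v) = s v"
  by (simp add: t_hom_def hom_eval_pvar[OF ring_map_const_poly])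

lemma coeff_0_t_hom:
  assumes "\<And>v. coeff (s v) 0 = pvar v" shows "coeff (t_hom s p) 0 = p"
proof (rule ring_map_eqI[of "\<lambda>p. coeff (t_hom s p) 0" "\<lambda>p. p"])
  show "ring_map (\<lambda>p. coeff (t_hom s p) 0)"
    by (rule ring_mapI)
      (simp_all add: ring_map_1[OF ring_map_t_hom] ring_map_add[OF ring_map_t_hom]
        ring_map_mult[OF ring_map_t_hom] coeff_mult_0)
qed (simp_all add: assms ring_map_def)

lemma derivation_t_hom:
  assumes "\<And>v. coeff (s v) 0 = pvar v"
  shows "derivation (\<lambda>p. coeff (t_hom s p) 1)"
  unfolding derivation_def
  by (auto simp: ring_map_add[OF ring_map_t_hom] ring_map_mult[OF ring_map_t_hom] coeff_mult
      coeff_0_t_hom[OF assms] add.commute)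

text \<open>The derivation sending each generic matrix xi to the commutator E_ij xi - xi E_ij. Its
  form as a coefficient of t makes the Leibniz rule an instance of
  \<open>derivation_t_hom\<close>.\<close>

definition inf_act :: "'n::finite \<Rightarrow> 'n \<Rightarrow> ('w \<times> 'n \<times> 'n,'k::comm_ring_1) mpoly \<Rightarrow> ('w \<times> 'n \<times> 'n,'k) mpoly" where
  "inf_act i j p = coeff (t_hom (\<lambda>(w, a, b). [:pvar (w, a, b),
      (if a = i then pvar (w, j, b) else 0) - (if b = j then pvar (w, a, i) else 0):]) p) 1"

lemma derivation_inf_act: "derivation (inf_act i j)"
  unfolding inf_act_def[abs_def] by (rule derivation_t_hom) auto

lemma inf_act_pvar:
  "inf_act i j (pvar (w, a, b)) = (if a = i then pvar (w, j, b) else 0) - (if b = j then pvar (w, a, i) else 0)"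
  by (simp add: inf_act_def)

text \<open>The matrix transforms like a generic one: \<open>inf_act i j\<close> on all entries
  gives E_ij M - M E_ij. Closure under products brings in all words in the generic matrices.\<close>

definition equivariant :: "('w \<times> 'n::finite \<times> 'n,'k::comm_ring_1) mpoly^'n^'n \<Rightarrow> bool" where
  "equivariant M \<longleftrightarrow> (\<forall>i j a b. inf_act i j (M $ a $ b)
      = (if a = i then M $ j $ b else 0) - (if b = j then M $ a $ i else 0))"

lemma equivariantD:
  "equivariant M \<Longrightarrow> inf_act i j (M $ a $ b) = (if a = i then M $ j $ b else 0) - (if b = j then M $ a $ i else 0)"
  by (simp add: equivariant_def)

lemma equivariant_generic: "equivariant (generic w)"
  by (simp add: equivariant_def generic_def inf_act_pvar)

lemma equivariant_one: "equivariant (mat 1)"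
  by (auto simp: equivariant_def mat_def derivation_0[OF derivation_inf_act] derivation_1[OF derivation_inf_act])

lemma equivariant_mult:
  assumes "equivariant M" "equivariant N" shows "equivariant (M ** N)"
  unfolding equivariant_def
proof (intro allI)
  fix i j a b
  have "inf_act i j ((M ** N) $ a $ b)
     = (\<Sum>c\<in>UNIV. ((if a = i then M $ j $ c else 0) - (if c = j then M $ a $ i else 0)) * N $ c $ b
         + M $ a $ c * ((if c = i then N $ j $ b else 0) - (if b = j then N $ c $ i else 0)))"
    using assms by (simp add: matrix_matrix_mult_def derivation_sum[OF derivation_inf_act]
        derivation_mult[OF derivation_inf_act] equivariant_def)
  also have "\<dots> = (\<Sum>c\<in>UNIV. (if a = i then M $ j $ c * N $ c $ b else 0))
       - (\<Sum>c\<in>UNIV. (if c = j then M $ a $ i * N $ c $ b else 0))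
       + ((\<Sum>c\<in>UNIV. (if c = i then M $ a $ c * N $ j $ b else 0))
       - (\<Sum>c\<in>UNIV. (if b = j then M $ a $ c * N $ c $ i else 0)))"
    unfolding sum.distrib[symmetric] sum_subtractf[symmetric]
    by (intro sum.cong refl) (simp add: algebra_simps)
  also have "\<dots> = (if a = i then (M ** N) $ j $ b else 0) - (if b = j then (M ** N) $ a $ i else 0)"
    by (simp add: matrix_matrix_mult_def)
  finally show "inf_act i j ((M ** N) $ a $ b)
     = (if a = i then (M ** N) $ j $ b else 0) - (if b = j then (M ** N) $ a $ i else 0)" .
qed

lemma equivariant_add: "equivariant M \<Longrightarrow> equivariant N \<Longrightarrow> equivariant (M + N)"
  by (simp add: equivariant_def derivation_add[OF derivation_inf_act])

lemma equivariant_diff: "equivariant M \<Longrightarrow> equivariant N \<Longrightarrow> equivariant (M - N)"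
  by (simp add: equivariant_def derivation_diff[OF derivation_inf_act])

lemma equivariant_scal: "equivariant M \<Longrightarrow> equivariant (mat_scal (pconst c) M)"
  by (simp add: equivariant_def mat_scal_def derivation_pconst_mult[OF derivation_inf_act]
      right_diff_distrib)

lemma equivariant_word: "equivariant (word generic ws)"
  by (induction ws) (simp_all add: equivariant_one equivariant_mult equivariant_generic)

lemma equivariant_eval_mat: "equivariant (eval_mat generic f)"
proof (induction f rule: mpoly_monomial_induct)
  case (single m c)
  show ?case unfolding eval_mat_single eval_mon_eq_word by (intro equivariant_scal equivariant_word)
qed (simp add: eval_mat_add equivariant_add)

lemma inf_act_trace: "equivariant M \<Longrightarrow> inf_act i j (trace M) = 0"
  by (simp add: trace_def derivation_sum[OF derivation_inf_act] equivariant_def sum_subtractf)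

lemma inf_act_poly_eval_tr: "inf_act i j (poly_eval tr_mon Phi) = 0"
proof (induction Phi rule: mpoly_induct)
  case (var v)
  show ?case by (simp add: tr_mon_eq_word inf_act_trace equivariant_word)
qed (simp_all add: ring_map_add[OF ring_map_poly_eval] ring_map_mult[OF ring_map_poly_eval]
      derivation_add[OF derivation_inf_act] derivation_mult[OF derivation_inf_act]
      derivation_pconst[OF derivation_inf_act])

text \<open>The generators are entries of equivariant matrices with all their entries in the ideal,
  and \<open>inf_act\<close> of an entry is a combination of entries of the same matrix. Hence the
  Lie algebra acts on the quotient.\<close>

lemma inf_act_rep_ideal:
  assumes "p \<in> rep_ideal I" shows "inf_act i j p \<in> rep_ideal I"
proof -
  note J = is_ideal_rep_ideal
  have ent: "inf_act i j (M $ a $ b) \<in> rep_ideal I"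
    if "equivariant M" "\<And>a b. M $ a $ b \<in> rep_ideal I" for M a b
    using that by (auto simp: equivariant_def intro!: is_ideal_diff[OF J] is_ideal_uminus[OF J] is_ideal_0[OF J])
  show ?thesis using assms unfolding rep_ideal_def
  proof (induction rule: ideal_span_induct)
    case zero
    show ?case by (simp add: derivation_0[OF derivation_inf_act] ideal_span_0)
  next
    case (add r s x)
    have "s \<in> rep_ideal I \<and> inf_act i j s \<in> rep_ideal I"
      using add(2)
    proof
      assume "s \<in> {(generic w ** generic w' - generic w' ** generic w) $ i $ j |w w' i j. True}"
      then obtain w w' a b where s: "s = (generic w ** generic w' - generic w' ** generic w) $ a $ b" by blast
      show ?thesis unfolding s
        by (intro conjI ent equivariant_diff equivariant_mult equivariant_generic generic_commutator_in_rep_ideal)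
    next
      assume "s \<in> {eval_mat generic f $ i $ j |f i j. f \<in> I}"
      then obtain f a b where "f \<in> I" "s = eval_mat generic f $ a $ b" by blast
      then show ?thesis using eval_mat_in_rep_ideal[of f I]
        by (auto intro!: ent equivariant_eval_mat)
    qed
    then show ?case using add(3)
      unfolding rep_ideal_def[symmetric]
      by (auto simp: derivation_add[OF derivation_inf_act] derivation_mult[OF derivation_inf_act]
         intro!: is_ideal_add[OF J] is_ideal_mult[OF J])
  qed
qed

subsection \<open>From the group to its Lie algebra\<close>

text \<open>This is the vanishing of a polynomial with infinitely many roots, read modulo J. The
  quotient by J may have zero divisors, so roots are removed by synthetic division, and only
  differences of distinct scalars, which are units, are cancelled.\<close>

lemma poly_values_in_ideal:
  fixes Q :: "('u,'k::field_char_0) mpoly poly"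
  assumes J: "is_ideal J"
  shows "degree Q \<le> d \<Longrightarrow> infinite S \<Longrightarrow> (\<And>t. t \<in> S \<Longrightarrow> poly Q (pconst t) \<in> J) \<Longrightarrow> coeff Q k \<in> J"
proof (induction d arbitrary: Q S k)
  case 0
  then obtain a where Q: "Q = [:a:]" by (metis degree_eq_zeroE le_zero_eq)
  obtain t where "t \<in> S" using 0(2) by (metis ex_in_conv finite.emptyI)
  then show ?case using 0(3)[of t] Q by (auto simp: coeff_pCons is_ideal_0[OF J] split: nat.split)
next
  case (Suc d)
  obtain t where t: "t \<in> S" using Suc.prems(2) by (metis ex_in_conv finite.emptyI)
  define Q1 where "Q1 = synthetic_div Q (pconst t)"
  have Q: "Q = [:- pconst t, 1:] * Q1 + [:poly Q (pconst t):]"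
    unfolding Q1_def by (rule synthetic_div_correct'[symmetric])
  have Q1: "coeff Q1 k \<in> J" for k
  proof (rule Suc.IH)
    show "degree Q1 \<le> d" using Suc.prems(1) by (simp add: Q1_def degree_synthetic_div)
    show "infinite (S - {t})" using Suc.prems(2) by simp
    fix t' assume t': "t' \<in> S - {t}"
    have "poly Q (pconst t') - poly Q (pconst t) = pconst (t' - t) * poly Q1 (pconst t')"
      by (subst Q) (simp add: pconst_diff algebra_simps)
    then have "pconst (t' - t) * poly Q1 (pconst t') \<in> J"
      using Suc.prems(3) t t' is_ideal_diff[OF J] by (metis Diff_iff)
    from is_ideal_mult[OF J this, of "pconst (inverse (t' - t))"]
    show "poly Q1 (pconst t') \<in> J" using t' by (simp add: pconst_cancel)
  qed
  have "coeff Q k = - pconst t * coeff Q1 k + coeff (pCons 0 Q1) k + coeff [:poly Q (pconst t):] k"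
    by (subst Q) simp
  also have "\<dots> \<in> J"
    using Q1 Suc.prems(3)[OF t]
    by (auto simp: coeff_pCons is_ideal_0[OF J] split: nat.split
        intro!: is_ideal_diff[OF J] is_ideal_mult[OF J] is_ideal_uminus[OF J])
  finally show ?case .
qed

lemma matrix_inv_unique:
  fixes A B :: "'k::field^'n::finite^'n"
  assumes "A ** B = mat 1" "B ** A = mat 1"
  shows "matrix_inv A = B"
proof -
  have "invertible A" using assms unfolding invertible_def by blast
  then have "A ** matrix_inv A = mat 1 \<and> matrix_inv A ** A = mat 1"
    unfolding invertible_def matrix_inv_def by (rule someI_ex)
  then have "B ** (A ** matrix_inv A) = B" by simp
  then show ?thesis using assms by (simp add: matrix_mul_assoc)
qed

text \<open>\<open>N = (u\<^sub>i v\<^sub>j)\<close> squares to zero, so \<open>1 + t N\<close> has inverse \<open>1 - t N\<close> and acts polynomially in \<open>t\<close>.\<close>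
lemma rep_invariant_rank_one:
  fixes p :: "('w \<times> 'n::finite \<times> 'n,'k::field_char_0) mpoly" and u v :: "'n \<Rightarrow> 'k"
  assumes inv: "rep_invariant I p" and uv: "(\<Sum>i\<in>UNIV. v i * u i) = 0"
  shows "(\<Sum>i\<in>UNIV. \<Sum>j\<in>UNIV. pconst (u i * v j) * inf_act i j p) \<in> rep_ideal I"
proof -
  define N :: "'k^'n^'n" where "N = (\<chi> i j. u i * v j)"
  define g where "g t = mat 1 + mat_scal t N" for t
  have NN: "N ** N = 0"
  proof -
    have "(\<Sum>k\<in>UNIV. u i * v k * (u k * v j)) = u i * (\<Sum>k\<in>UNIV. v k * u k) * v j" for i j
      by (simp add: sum_distrib_left sum_distrib_right ac_simps)
    then show ?thesis by (simp add: N_def vec_eq_iff matrix_matrix_mult_def uv)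
  qed
  have gg: "g t ** g s = g (t + s)" for t s
    by (simp add: g_def mat_mult_add_left matrix_add_ldistrib mat_scal_mult_left mat_scal_mult_right NN
        mat_scal_add_left) (simp add: vec_eq_iff mat_scal_def)
  have g0: "g 0 = mat 1" by (simp add: g_def)
  have ginv: "g t ** g (- t) = mat 1" "g (- t) ** g t = mat 1" for t by (simp_all add: gg g0)
  let ?N = "const_mat N :: ('w \<times> 'n \<times> 'n,'k) mpoly^'n^'n"
  \<comment> \<open>The coefficients of (1 + t N) xi (1 - t N) in powers of t: xi, the commutator of
    N with xi, and - N xi N.\<close>
  define s :: "'w \<times> 'n \<times> 'n \<Rightarrow> ('w \<times> 'n \<times> 'n,'k) mpoly poly" where
    "s = (\<lambda>(w, a, b). [:pvar (w, a, b), (?N ** generic w - generic w ** ?N) $ a $ b,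
        - (?N ** generic w ** ?N) $ a $ b:])"
  have s0: "coeff (s x) 0 = pvar x" for x by (cases x) (simp add: s_def)
  have cg: "const_mat (g t) = mat 1 + mat_scal (pconst t) ?N" for t
    by (auto simp: g_def vec_eq_iff const_mat_def mat_scal_def mat_def pconst_add pconst_mult)
  have "poly (t_hom s p) (pconst t) = gl_act (g t) p" for t
  proof (rule ring_map_eqI[of "\<lambda>p. poly (t_hom s p) (pconst t)"])
    show "ring_map (\<lambda>p. poly (t_hom s p) (pconst t))"
      by (rule ring_mapI)
        (simp_all add: ring_map_1[OF ring_map_t_hom] ring_map_add[OF ring_map_t_hom]
          ring_map_mult[OF ring_map_t_hom])
    show "ring_map (gl_act (g t) :: ('w \<times> 'n \<times> 'n,'k) mpoly \<Rightarrow> _)" by (rule ring_map_gl_act)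
    show "poly (t_hom s (pconst c)) (pconst t) = gl_act (g t) (pconst c)" for c by simp
    fix x :: "'w \<times> 'n \<times> 'n"
    obtain w a b where x: "x = (w, a, b)" by (cases x)
    have "matrix_inv (g t) = g (- t)" by (rule matrix_inv_unique[OF ginv])
    then have "gl_act (g t) (pvar x) = (const_mat (g t) ** generic w ** const_mat (g (- t))) $ a $ b"
      by (simp add: gl_act_def x)
    also have "const_mat (g t) ** generic w ** const_mat (g (- t))
       = generic w + mat_scal (pconst t) (?N ** generic w) - mat_scal (pconst t) (generic w ** ?N)
         - mat_scal (pconst t * pconst t) (?N ** generic w ** ?N)"
      unfolding cg
      by (simp add: mat_mult_add_left matrix_add_ldistrib mat_scal_mult_left mat_scal_mult_right
          mat_scal_mat_scal pconst_uminus)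
        (simp add: vec_eq_iff mat_scal_def algebra_simps)
    finally show "poly (t_hom s (pvar x)) (pconst t) = gl_act (g t) (pvar x)"
      by (simp add: x s_def) (simp add: generic_def mat_scal_def algebra_simps)
  qed
  moreover have "invertible (g t)" for t unfolding invertible_def using ginv by blast
  ultimately have "poly (t_hom s p - [:p:]) (pconst t) \<in> rep_ideal I" for t
    using inv by (simp add: rep_invariant_def)
  \<comment> \<open>Membership for every scalar t passes to the coefficient of t. That coefficient
    and the combination of the \<open>inf_act i j\<close> are derivations in p, and on variables
    both are the commutator with N.\<close>
  then have "coeff (t_hom s p - [:p:]) 1 \<in> rep_ideal I"
    by (intro poly_values_in_ideal[OF is_ideal_rep_ideal order_refl, of UNIV]) (auto simp: infinite_UNIV_char_0)
  also have "coeff (t_hom s p - [:p:]) 1 = coeff (t_hom s p) 1" by simp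
  also have "\<dots> = (\<Sum>i\<in>UNIV. \<Sum>j\<in>UNIV. pconst (u i * v j) * inf_act i j p)"
  proof (rule derivation_eqI[of "\<lambda>p. coeff (t_hom s p) 1"])
    show "derivation (\<lambda>p. coeff (t_hom s p) 1)" by (rule derivation_t_hom[OF s0])
    show "derivation (\<lambda>p. \<Sum>i\<in>UNIV. \<Sum>j\<in>UNIV. pconst (u i * v j) * inf_act i j p)"
      by (intro derivation_sumI derivation_scale derivation_inf_act)
    fix x :: "'w \<times> 'n \<times> 'n"
    obtain w a b where x: "x = (w, a, b)" by (cases x)
    have "(\<Sum>i\<in>UNIV. \<Sum>j\<in>UNIV. pconst (u i * v j) * inf_act i j (pvar x))
      = (\<Sum>i\<in>UNIV. if i = a then (\<Sum>j\<in>UNIV. pconst (u i * v j) * pvar (w, j, b)) else 0)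
        - (\<Sum>i\<in>UNIV. \<Sum>j\<in>UNIV. if j = b then pconst (u i * v j) * pvar (w, a, i) else 0)"
      unfolding sum_subtractf[symmetric]
    proof (intro sum.cong refl)
      fix i
      have e: "(if i = a then (\<Sum>j\<in>UNIV. pconst (u i * v j) * pvar (w, j, b)) else 0)
          = (\<Sum>j\<in>UNIV. if i = a then pconst (u i * v j) * pvar (w, j, b) else 0)" by simp
      show "(\<Sum>j\<in>UNIV. pconst (u i * v j) * inf_act i j (pvar x))
          = (if i = a then (\<Sum>j\<in>UNIV. pconst (u i * v j) * pvar (w, j, b)) else 0)
           - (\<Sum>j\<in>UNIV. if j = b then pconst (u i * v j) * pvar (w, a, i) else 0)"
        unfolding x inf_act_pvar e sum_subtractf[symmetric] by (rule sum.cong) (auto simp: right_diff_distrib)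
    qed
    also have "\<dots> = (?N ** generic w - generic w ** ?N) $ a $ b"
      by (simp add: matrix_matrix_mult_def const_mat_def N_def generic_def mult.commute)
    finally show "coeff (t_hom s (pvar x)) 1 = (\<Sum>i\<in>UNIV. \<Sum>j\<in>UNIV. pconst (u i * v j) * inf_act i j (pvar x))"
      by (simp add: x s_def)
  qed
  finally show ?thesis .
qed

text \<open>Square-zero matrices of rank one span the trace-zero matrices, and the identity has zero
  commutators. In coordinates, E_ii is recovered from the differences E_ii - E_kk on division by
  n.\<close>

lemma rep_invariant_inf_act:
  fixes p :: "('w \<times> 'n::finite \<times> 'n,'k::field_char_0) mpoly"
  assumes inv: "rep_invariant I p"
  shows "inf_act i j p \<in> rep_ideal I"
proof -
  note J = is_ideal_rep_ideal
  have delta: "(\<Sum>l\<in>UNIV. pconst (of_bool (l = j)) * f l) = f j"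
    for f :: "'n \<Rightarrow> ('w \<times> 'n \<times> 'n,'k) mpoly" and j
  proof -
    have "(\<Sum>l\<in>UNIV. pconst (of_bool (l = j)) * f l) = (\<Sum>l\<in>UNIV. if l = j then f l else 0)"
      by (intro sum.cong) auto
    then show ?thesis by simp
  qed
  have off: "inf_act i j p \<in> rep_ideal I" if "i \<noteq> j" for i j
  proof -
    have "(\<Sum>k\<in>UNIV. of_bool (k = j) * of_bool (k = i) :: 'k) = 0"
      using that by (intro sum.neutral) auto
    from rep_invariant_rank_one[OF inv this]
    have "(\<Sum>k\<in>UNIV. \<Sum>l\<in>UNIV. pconst (of_bool (k = i) * of_bool (l = j)) * inf_act k l p) \<in> rep_ideal I" .
    also have "(\<Sum>k\<in>UNIV. \<Sum>l\<in>UNIV. pconst (of_bool (k = i) * of_bool (l = j)) * inf_act k l p)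
        = (\<Sum>k\<in>UNIV. pconst (of_bool (k = i)) * (\<Sum>l\<in>UNIV. pconst (of_bool (l = j)) * inf_act k l p))"
      by (simp add: pconst_mult sum_distrib_left mult.assoc)
    finally show ?thesis by (simp only: delta)
  qed
  have diag: "inf_act i i p - inf_act j j p \<in> rep_ideal I" for i j
  proof (cases "i = j")
    case False
    \<comment> \<open>For u = e_i + e_j and v = e_i - e_j the matrix (u_k v_l) is E_ii - E_jj - E_ij
      + E_ji, and its off-diagonal units are already settled.\<close>
    let ?u = "\<lambda>k. of_bool (k = i) + of_bool (k = j) :: 'k"
    let ?v = "\<lambda>k. of_bool (k = i) - of_bool (k = j) :: 'k"
    have "(\<Sum>k\<in>UNIV. ?v k * ?u k) = (\<Sum>k\<in>UNIV. (if k = i then 1 else 0) - (if k = j then 1 else 0))"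
      using False by (intro sum.cong) auto
    then have "(\<Sum>k\<in>UNIV. ?v k * ?u k) = 0" by (simp add: sum_subtractf)
    from rep_invariant_rank_one[OF inv this]
    have "(\<Sum>k\<in>UNIV. \<Sum>l\<in>UNIV. pconst (?u k * ?v l) * inf_act k l p) \<in> rep_ideal I" .
    also have "(\<Sum>k\<in>UNIV. \<Sum>l\<in>UNIV. pconst (?u k * ?v l) * inf_act k l p)
      = (\<Sum>k\<in>UNIV. (if k = i then inf_act k i p - inf_act k j p else 0)
           + (if k = j then inf_act k i p - inf_act k j p else 0))"
    proof (intro sum.cong refl)
      fix k
      have "(\<Sum>l\<in>UNIV. pconst (?u k * ?v l) * inf_act k l p)
          = (\<Sum>l\<in>UNIV. pconst (?u k) * ((if l = i then inf_act k l p else 0) - (if l = j then inf_act k l p else 0)))"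
        using False by (intro sum.cong refl) (auto simp: pconst_mult pconst_uminus)
      also have "\<dots> = pconst (?u k) * (inf_act k i p - inf_act k j p)"
        unfolding sum_distrib_left[symmetric] by (simp add: sum_subtractf)
      finally show "(\<Sum>l\<in>UNIV. pconst (?u k * ?v l) * inf_act k l p)
         = (if k = i then inf_act k i p - inf_act k j p else 0)
           + (if k = j then inf_act k i p - inf_act k j p else 0)"
        using False by auto
    qed
    also have "\<dots> = (inf_act i i p - inf_act j j p) - inf_act i j p + inf_act j i p"
      by (simp add: sum.distrib)
    finally have "(inf_act i i p - inf_act j j p) - inf_act i j p + inf_act j i p \<in> rep_ideal I" .
    from is_ideal_diff[OF J is_ideal_add[OF J this off[OF False]] off[OF False[symmetric]]]
    show ?thesis by simp
  qed (simp add: is_ideal_0[OF J])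
  have "(\<Sum>k\<in>UNIV. inf_act k k p) = 0"
  proof (rule derivation_eqI[of "\<lambda>p. \<Sum>k\<in>UNIV. inf_act k k p" "\<lambda>p. 0"])
    show "derivation (\<lambda>p. \<Sum>k\<in>UNIV. inf_act k k p)"
      by (intro derivation_sumI derivation_inf_act)
    show "derivation (\<lambda>p. 0)" by (simp add: derivation_def)
    fix x :: "'w \<times> 'n \<times> 'n"
    show "(\<Sum>k\<in>UNIV. inf_act k k (pvar x)) = 0"
      by (cases x) (simp add: inf_act_pvar sum_subtractf)
  qed
  then have "of_nat CARD('n) * inf_act i i p = (\<Sum>k\<in>UNIV. inf_act i i p - inf_act k k p)" for i
    by (simp add: sum_subtractf)
  then have "of_nat CARD('n) * inf_act i i p \<in> rep_ideal I" for i
    using diag by (simp add: is_ideal_sum[OF J])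
  from is_ideal_mult[OF J this, of "pconst (inverse (of_nat CARD('n)))"]
  have "inf_act i i p \<in> rep_ideal I" for i
    by (simp only: of_nat_mult_cancel_mpoly[OF zero_less_card_finite])
  then show ?thesis using off by (cases "i = j") auto
qed

section \<open>Polynomials in the Casimir operator\<close>

text \<open>The Casimir element of gl_n for the trace form, in which E_ij is dual to E_ji.\<close>

definition casimir :: "('w \<times> 'n::finite \<times> 'n,'k::comm_ring_1) mpoly \<Rightarrow> ('w \<times> 'n \<times> 'n,'k) mpoly" where
  "casimir p = (\<Sum>i\<in>UNIV. \<Sum>j\<in>UNIV. inf_act i j (inf_act j i p))"

lemma casimir_add: "casimir (p + q) = casimir p + casimir q"
  by (simp add: casimir_def derivation_add[OF derivation_inf_act] sum.distrib)

lemma casimir_pconst_mult: "casimir (pconst c * p) = pconst c * casimir p"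
  by (simp add: casimir_def derivation_pconst_mult[OF derivation_inf_act] sum_distrib_left)

lemma casimir_0 [simp]: "casimir 0 = 0"
  using casimir_pconst_mult[of 0 0] by simp

lemma casimir_sum: "casimir (sum f S) = (\<Sum>x\<in>S. casimir (f x))"
  by (induction S rule: infinite_finite_induct) (auto simp: casimir_add)

lemma casimir_tr_mult: "casimir (poly_eval tr_mon Phi * p) = poly_eval tr_mon Phi * casimir p"
  by (simp add: casimir_def derivation_mult[OF derivation_inf_act] inf_act_poly_eval_tr sum_distrib_left)

lemma casimir_rep_ideal: "p \<in> rep_ideal I \<Longrightarrow> casimir p \<in> rep_ideal I"
  unfolding casimir_def by (intro is_ideal_sum[OF is_ideal_rep_ideal] inf_act_rep_ideal)

definition casimir_poly ::
  "'k::comm_ring_1 poly \<Rightarrow> ('w \<times> 'n::finite \<times> 'n,'k) mpoly \<Rightarrow> ('w \<times> 'n \<times> 'n,'k) mpoly" where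
  "casimir_poly h p = (\<Sum>k\<le>degree h. pconst (coeff h k) * (casimir ^^ k) p)"

lemma casimir_poly_bound:
  "degree h \<le> n \<Longrightarrow> casimir_poly h p = (\<Sum>k\<le>n. pconst (coeff h k) * (casimir ^^ k) p)"
  unfolding casimir_poly_def by (intro sum.mono_neutral_left) (auto simp: coeff_eq_0)

lemma casimir_poly_0 [simp]: "casimir_poly 0 p = 0"
  by (simp add: casimir_poly_def)

lemma casimir_poly_pCons: "casimir_poly (pCons a h) p = pconst a * p + casimir (casimir_poly h p)"
proof -
  have "casimir_poly (pCons a h) p = (\<Sum>k\<le>Suc (degree h). pconst (coeff (pCons a h) k) * (casimir ^^ k) p)"
    by (rule casimir_poly_bound) (rule degree_pCons_le)
  also have "\<dots> = pconst a * p + (\<Sum>k\<le>degree h. pconst (coeff h k) * casimir ((casimir ^^ k) p))"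
    by (subst sum.atMost_Suc_shift) simp
  finally show ?thesis by (simp add: casimir_poly_def casimir_sum casimir_pconst_mult)
qed

lemma casimir_poly_add: "casimir_poly (g + h) p = casimir_poly g p + casimir_poly h p"
  using casimir_poly_bound[of g "max (degree g) (degree h)" p]
    casimir_poly_bound[of h "max (degree g) (degree h)" p]
    casimir_poly_bound[of "g + h" "max (degree g) (degree h)" p]
  by (simp add: degree_add_le pconst_add distrib_right sum.distrib)

lemma casimir_poly_sum: "casimir_poly (sum g S) p = (\<Sum>x\<in>S. casimir_poly (g x) p)"
  by (induction S rule: infinite_finite_induct) (auto simp: casimir_poly_add)

lemma casimir_poly_monom: "casimir_poly (monom a k) p = pconst a * (casimir ^^ k) p"
proof -
  have "casimir_poly (monom a k) p = (\<Sum>l\<le>k. pconst (coeff (monom a k) l) * (casimir ^^ l) p)"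
    by (rule casimir_poly_bound) (rule degree_monom_le)
  also have "\<dots> = (\<Sum>l\<in>{k}. pconst (coeff (monom a k) l) * (casimir ^^ l) p)"
    by (intro sum.mono_neutral_right) auto
  finally show ?thesis by simp
qed

lemma casimir_poly_smult: "casimir_poly (smult a h) p = pconst a * casimir_poly h p"
  using casimir_poly_bound[OF degree_smult_le, of a h p]
  by (simp add: casimir_poly_def pconst_mult sum_distrib_left mult.assoc)

lemma casimir_poly_mult: "casimir_poly (g * h) p = casimir_poly g (casimir_poly h p)"
  by (induction g) (simp_all add: casimir_poly_add casimir_poly_smult casimir_poly_pCons)

lemma casimir_poly_linear:
  "casimir_poly h (p + q) = casimir_poly h p + casimir_poly h q"
  "casimir_poly h (pconst c * p) = pconst c * casimir_poly h p"
  "casimir_poly h (casimir p) = casimir (casimir_poly h p)"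
  "casimir_poly h (poly_eval tr_mon Phi * p) = poly_eval tr_mon Phi * casimir_poly h p"
  by (induction h) (simp_all add: casimir_poly_pCons casimir_add casimir_pconst_mult casimir_tr_mult
      distrib_left mult.left_commute)

lemma casimir_poly_closed:
  assumes "\<And>x y. x \<in> A \<Longrightarrow> y \<in> A \<Longrightarrow> x + y \<in> A" "\<And>c x. x \<in> A \<Longrightarrow> pconst c * x \<in> A"
    "\<And>x. x \<in> A \<Longrightarrow> casimir x \<in> A" "p \<in> A"
  shows "casimir_poly h p \<in> A"
proof (induction h)
  case 0
  show ?case using assms(2)[OF assms(4), of 0] by simp
qed (auto simp: casimir_poly_pCons assms)

section \<open>Elements that Casimir polynomials send into the trace ring\<close>

definition tr_span :: "('w,'k::comm_ring_1) mpoly set \<Rightarrow> ('w \<times> 'n::finite \<times> 'n,'k) mpoly set" where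
  "tr_span I = {p. \<exists>Phi\<in>TPoly. p - poly_eval tr_mon Phi \<in> rep_ideal I}"

lemma tr_span_rep_ideal: "p \<in> rep_ideal I \<Longrightarrow> p \<in> tr_span I"
  unfolding tr_span_def
  by (auto intro!: bexI[of _ 0] simp: ring_map_0[OF ring_map_poly_eval])

lemma tr_span_add:
  assumes "p \<in> tr_span I" "q \<in> tr_span I" shows "p + q \<in> tr_span I"
proof -
  obtain P Q where PQ: "P \<in> TPoly" "p - poly_eval tr_mon P \<in> rep_ideal I"
     "Q \<in> TPoly" "q - poly_eval tr_mon Q \<in> rep_ideal I"
    using assms unfolding tr_span_def by blast
  have "p + q - poly_eval tr_mon (P + Q) = (p - poly_eval tr_mon P) + (q - poly_eval tr_mon Q)"
    by (simp add: ring_map_add[OF ring_map_poly_eval])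
  also have "\<dots> \<in> rep_ideal I" by (rule is_ideal_add[OF is_ideal_rep_ideal PQ(2,4)])
  finally show ?thesis using TPoly_add[OF PQ(1,3)] unfolding tr_span_def by blast
qed

lemma tr_span_tr_mult:
  assumes "Q \<in> TPoly" "p \<in> tr_span I" shows "poly_eval tr_mon Q * p \<in> tr_span I"
proof -
  obtain P where P: "P \<in> TPoly" "p - poly_eval tr_mon P \<in> rep_ideal I"
    using assms unfolding tr_span_def by blast
  have "poly_eval tr_mon Q * p - poly_eval tr_mon (Q * P) = poly_eval tr_mon Q * (p - poly_eval tr_mon P)"
    by (simp add: ring_map_mult[OF ring_map_poly_eval] right_diff_distrib)
  also have "\<dots> \<in> rep_ideal I" by (rule is_ideal_mult[OF is_ideal_rep_ideal P(2)])
  finally show ?thesis using TPoly_mult[OF assms(1) P(1)] unfolding tr_span_def by blast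
qed

lemma tr_span_pconst_mult: "p \<in> tr_span I \<Longrightarrow> pconst c * p \<in> tr_span I"
  using tr_span_tr_mult[OF TPoly_pconst] by fastforce

lemma tr_span_1: "1 \<in> tr_span I"
  unfolding tr_span_def
  by (auto intro!: bexI[of _ 1] simp: ring_map_1[OF ring_map_poly_eval] is_ideal_0[OF is_ideal_rep_ideal])

lemma tr_span_casimir: "p \<in> tr_span I \<Longrightarrow> casimir p \<in> tr_span I"
proof -
  assume "p \<in> tr_span I"
  then obtain P where P: "p - poly_eval tr_mon P \<in> rep_ideal I" unfolding tr_span_def by blast
  have "casimir (poly_eval tr_mon P :: ('a \<times> 'b \<times> 'b,'c) mpoly) = 0"
    by (simp add: casimir_def inf_act_poly_eval_tr derivation_0[OF derivation_inf_act])
  then have "casimir p = casimir (p - poly_eval tr_mon P)"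
    using casimir_add[of "p - poly_eval tr_mon P" "poly_eval tr_mon P"] by simp
  also have "\<dots> \<in> tr_span I" by (intro tr_span_rep_ideal casimir_rep_ideal P)
  finally show ?thesis .
qed

lemma trace_word_tr_span:
  "\<exists>Phi\<in>TPoly. cong_ideal (rep_ideal I) (trace (word generic ws)) (poly_eval tr_mon Phi
      :: ('w \<times> 'n::finite \<times> 'n,'k::comm_ring_1) mpoly)"
proof -
  have "\<exists>m. \<forall>w. Poly_Mapping.lookup m w = count_list ws w"
  proof (induction ws)
    case Nil
    show ?case by (rule exI[of _ 0]) simp
  next
    case (Cons v ws)
    then obtain m where "\<forall>w. Poly_Mapping.lookup m w = count_list ws w" by blast
    then show ?case
      by (intro exI[of _ "m + Poly_Mapping.single v 1"]) (auto simp: lookup_add lookup_single when_def)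
  qed
  then obtain m where m: "\<forall>w. Poly_Mapping.lookup m w = count_list ws w" by blast
  have "mset ws = mset (mono_list m)"
    unfolding mset_eq_iff_count_list by (simp add: count_list_mono_list m)
  from mat_cong_trace[OF is_ideal_rep_ideal word_cong_mset[OF is_ideal_rep_ideal generic_commute this]]
  have "cong_ideal (rep_ideal I) (trace (word generic ws)) (tr_mon m :: ('w \<times> 'n \<times> 'n,'k) mpoly)"
    by (simp add: tr_mon_eq_word)
  then show ?thesis using poly_eval_tr_Tvar TPoly_Tvar by metis
qed

text \<open>Constant term 1 is stable under multiplication of polynomials, so a sum of good elements
  admits a common polynomial; and on an element killed by the Casimir operator such a polynomial
  acts as the identity.\<close>

definition casimir_good :: "('w,'k::comm_ring_1) mpoly set \<Rightarrow> ('w \<times> 'n::finite \<times> 'n,'k) mpoly set" where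
  "casimir_good I = {p. \<exists>h. coeff h 0 = 1 \<and> casimir_poly h p \<in> tr_span I}"

lemma casimir_poly_tr_span: "p \<in> tr_span I \<Longrightarrow> casimir_poly h p \<in> tr_span I"
  by (rule casimir_poly_closed) (auto intro: tr_span_add tr_span_pconst_mult tr_span_casimir)

lemma casimir_good_add:
  assumes "p \<in> casimir_good I" "q \<in> casimir_good I" shows "p + q \<in> casimir_good I"
proof -
  obtain g h where gh: "coeff g 0 = 1" "casimir_poly g p \<in> tr_span I"
    "coeff h 0 = 1" "casimir_poly h q \<in> tr_span I"
    using assms unfolding casimir_good_def by blast
  have "casimir_poly (h * g) (p + q) = casimir_poly h (casimir_poly g p) + casimir_poly g (casimir_poly h q)"
    by (metis casimir_poly_linear(1) casimir_poly_mult mult.commute)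
  also have "\<dots> \<in> tr_span I" by (intro tr_span_add casimir_poly_tr_span gh)
  finally show ?thesis using gh unfolding casimir_good_def by (auto intro!: exI[of _ "h * g"] simp: coeff_mult_0)
qed

lemma casimir_good_tr_mult:
  assumes "Q \<in> TPoly" "p \<in> casimir_good I" shows "poly_eval tr_mon Q * p \<in> casimir_good I"
  using assms tr_span_tr_mult unfolding casimir_good_def
  by (fastforce simp: casimir_poly_linear)

lemma casimir_good_pconst_mult: "p \<in> casimir_good I \<Longrightarrow> pconst c * p \<in> casimir_good I"
  using casimir_good_tr_mult[OF TPoly_pconst] by fastforce

lemma casimir_good_casimir: "p \<in> casimir_good I \<Longrightarrow> casimir p \<in> casimir_good I"
  using tr_span_casimir unfolding casimir_good_def by (fastforce simp: casimir_poly_linear)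

lemma tr_span_casimir_good: "p \<in> tr_span I \<Longrightarrow> p \<in> casimir_good I"
  unfolding casimir_good_def by (auto intro!: exI[of _ "[:1:]"] simp: casimir_poly_pCons)

lemma casimir_good_0: "0 \<in> casimir_good I"
  by (intro tr_span_casimir_good tr_span_rep_ideal is_ideal_0[OF is_ideal_rep_ideal])

lemma casimir_good_uminus: "p \<in> casimir_good I \<Longrightarrow> - p \<in> casimir_good I"
  using casimir_good_pconst_mult[of p I "- 1"] by (simp add: pconst_uminus)

lemma casimir_good_sum: "(\<And>x. x \<in> S \<Longrightarrow> f x \<in> casimir_good I) \<Longrightarrow> sum f S \<in> casimir_good I"
  by (induction S rule: infinite_finite_induct) (auto intro: casimir_good_0 casimir_good_add)

lemma casimir_good_rep_ideal: "p \<in> rep_ideal I \<Longrightarrow> p \<in> casimir_good I"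
  by (intro tr_span_casimir_good tr_span_rep_ideal)

lemma casimir_good_trace_word:
  fixes p :: "('w \<times> 'n::finite \<times> 'n,'k::comm_ring_1) mpoly"
  assumes "p \<in> casimir_good I" shows "trace (word generic ws) * p \<in> casimir_good I"
proof -
  obtain Q where Q: "Q \<in> TPoly"
    "cong_ideal (rep_ideal I) (trace (word generic ws)) (poly_eval tr_mon Q :: ('w \<times> 'n \<times> 'n,'k) mpoly)"
    using trace_word_tr_span by blast
  have "(trace (word generic ws) - poly_eval tr_mon Q) * p \<in> rep_ideal I"
    using Q(2) unfolding cong_ideal_def by (rule is_ideal_mult_right[OF is_ideal_rep_ideal])
  then have "(trace (word generic ws) - poly_eval tr_mon Q) * p + poly_eval tr_mon Q * p \<in> casimir_good I"
    by (intro casimir_good_add casimir_good_tr_mult casimir_good_rep_ideal Q(1) assms)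
  then show ?thesis by (simp add: algebra_simps)
qed

lemma casimir_good_trans:
  assumes "casimir_poly h p \<in> casimir_good I" "coeff h 0 = 1" shows "p \<in> casimir_good I"
proof -
  obtain g where "coeff g 0 = 1" "casimir_poly (g * h) p \<in> tr_span I"
    using assms(1) unfolding casimir_good_def by (auto simp: casimir_poly_mult)
  then show ?thesis
    using assms(2) unfolding casimir_good_def by (auto simp: coeff_mult_0 intro!: exI[of _ "g * h"])
qed

section \<open>Minimal polynomials of injective operators\<close>

text \<open>Elimination of one coordinate at a time: two relations for X with disjoint supports
  combine to one that also holds at x. The lower bound \<open>m\<close> allows the second relation
  to be asked for beyond the support of the first.\<close>

lemma linear_relation_exists:
  fixes v :: "nat \<Rightarrow> 'c \<Rightarrow> 'q::field"
  assumes "finite X"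
  shows "\<exists>K r. finite K \<and> K \<subseteq> {m..} \<and> (\<forall>k. k \<notin> K \<longrightarrow> r k = 0) \<and> (\<exists>k. r k \<noteq> 0)
     \<and> (\<forall>c\<in>X. (\<Sum>k\<in>K. r k * v k c) = 0)"
  using assms
proof (induction X arbitrary: m rule: finite_induct)
  case empty
  show ?case by (rule exI[of _ "{m}"], rule exI[of _ "\<lambda>k. if k = m then 1 else 0"]) auto
next
  case (insert x X)
  obtain K r where K: "finite K" "K \<subseteq> {m..}" "\<And>k. k \<notin> K \<Longrightarrow> r k = 0" "\<exists>k. r k \<noteq> 0"
    "\<And>c. c \<in> X \<Longrightarrow> (\<Sum>k\<in>K. r k * v k c) = 0" using insert.IH[of m] by blast
  obtain L s where L: "finite L" "L \<subseteq> {max m (Suc (Max K))..}" "\<And>k. k \<notin> L \<Longrightarrow> s k = 0" "\<exists>k. s k \<noteq> 0"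
    "\<And>c. c \<in> X \<Longrightarrow> (\<Sum>k\<in>L. s k * v k c) = 0" using insert.IH[of "max m (Suc (Max K))"] by blast
  define \<alpha> where "\<alpha> = (\<Sum>k\<in>K. r k * v k x)"
  define \<beta> where "\<beta> = (\<Sum>k\<in>L. s k * v k x)"
  show ?case
  proof (cases "\<alpha> = 0")
    case True
    then show ?thesis using K by (intro exI[of _ K] exI[of _ r]) (auto simp: \<alpha>_def)
  next
    case False
    let ?t = "\<lambda>k. \<beta> * r k - \<alpha> * s k"
    have sum_eq: "(\<Sum>k\<in>K \<union> L. ?t k * v k c) = \<beta> * (\<Sum>k\<in>K. r k * v k c) - \<alpha> * (\<Sum>k\<in>L. s k * v k c)" for c
    proof -
      have "(\<Sum>k\<in>K. r k * v k c) = (\<Sum>k\<in>K \<union> L. r k * v k c)"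
        using K L by (intro sum.mono_neutral_left) auto
      moreover have "(\<Sum>k\<in>L. s k * v k c) = (\<Sum>k\<in>K \<union> L. s k * v k c)"
        using K L by (intro sum.mono_neutral_left) auto
      ultimately show ?thesis
        by (simp add: sum_distrib_left sum_subtractf[symmetric] left_diff_distrib mult.assoc)
    qed
    obtain l where l: "s l \<noteq> 0" using L(4) by blast
    then have "l \<in> L" using L(3) by blast
    then have "l \<notin> K" using L(2) Max_ge[OF K(1), of l] by auto
    then have "?t l \<noteq> 0" using l False K(3) by simp
    then show ?thesis
      using K L by (intro exI[of _ "K \<union> L"] exI[of _ ?t])
        (auto simp: sum_eq, auto simp: \<alpha>_def[symmetric] \<beta>_def[symmetric])
  qed
qed

text \<open>The iterates of T on e satisfy a linear relation on X. If its lowest exponent is k0, the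
  relation is T^k0 applied to some w, and injectivity cancels T^k0; division by the lowest
  coefficient makes the constant term 1.\<close>

lemma injective_operator_relation:
  fixes T :: "('c \<Rightarrow> 'q::field) \<Rightarrow> 'c \<Rightarrow> 'q"
  assumes X: "finite X"
    and lin: "\<And>K r v. finite (K :: nat set) \<Longrightarrow> T (\<lambda>c. \<Sum>k\<in>K. r k * v k c) = (\<lambda>c. \<Sum>k\<in>K. r k * T (v k) c)"
    and inj: "\<And>v. (\<And>c. c \<in> X \<Longrightarrow> T v c = 0) \<Longrightarrow> (\<And>c. c \<in> X \<Longrightarrow> v c = 0)"
  shows "\<exists>N r. r 0 = 1 \<and> (\<forall>c\<in>X. (\<Sum>k\<le>N. r k * (T ^^ k) e c) = 0)"
proof -
  obtain K r where K: "finite K" "\<And>k. k \<notin> K \<Longrightarrow> r k = 0" "\<exists>k. r k \<noteq> 0"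
    "\<And>c. c \<in> X \<Longrightarrow> (\<Sum>k\<in>K. r k * (T ^^ k) e c) = 0"
    using linear_relation_exists[OF X, of 0 "\<lambda>k. (T ^^ k) e"] by blast
  define k0 where "k0 = (LEAST k. r k \<noteq> 0)"
  have k0: "r k0 \<noteq> 0" unfolding k0_def using K(3) by (rule LeastI_ex)
  have low: "r k = 0" if "k < k0" for k using not_less_Least[of k "\<lambda>k. r k \<noteq> 0"] that unfolding k0_def by blast
  define N where "N = Max K"
  \<comment> \<open>The relation with all exponents lowered by \<open>k0\<close>; the bound
    \<open>N\<close> is generous, since r vanishes beyond \<open>Max K\<close>.\<close>
  define w where "w = (\<lambda>c. \<Sum>k\<le>N. r (k + k0) * (T ^^ k) e c)"
  have Tw: "(T ^^ l) w = (\<lambda>c. \<Sum>k\<le>N. r (k + k0) * (T ^^ (k + l)) e c)" for l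
  proof (induction l)
    case 0
    show ?case by (simp add: w_def)
  next
    case (Suc l)
    show ?case using lin[of "{..N}" "\<lambda>k. r (k + k0)" "\<lambda>k. (T ^^ (k + l)) e"] by (simp add: Suc)
  qed
  have "(T ^^ k0) w c = 0" if "c \<in> X" for c
  proof -
    have "(T ^^ k0) w c = (\<Sum>k\<in>{k0..N + k0}. r k * (T ^^ k) e c)"
      unfolding Tw by (rule sum.reindex_bij_witness[of _ "\<lambda>k. k - k0" "\<lambda>k. k + k0"]) auto
    also have "\<dots> = (\<Sum>k\<in>K. r k * (T ^^ k) e c)"
    proof (rule sum.mono_neutral_cong)
      fix k assume "k \<in> K - {k0..N + k0}"
      then have "k < k0" using Max_ge[OF K(1), of k] unfolding N_def by auto
      then show "r k * (T ^^ k) e c = 0" by (simp add: low)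
    qed (use K in auto)
    finally show ?thesis using K(4)[OF that] by simp
  qed
  moreover have "(\<forall>c\<in>X. (T ^^ l) w c = 0) \<Longrightarrow> \<forall>c\<in>X. w c = 0" for l
    by (induction l) (auto intro: inj)
  ultimately have "\<forall>c\<in>X. w c = 0" by blast
  then have "(\<Sum>k\<le>N. (r (k + k0) / r k0) * (T ^^ k) e c) = 0" if "c \<in> X" for c
    using that by (simp add: w_def sum_divide_distrib[symmetric])
  then show ?thesis using k0 by (intro exI[of _ N] exI[of _ "\<lambda>k. r (k + k0) / r k0"]) auto
qed

section \<open>The Casimir operator on products of matrix entries\<close>

text \<open>The entry \<open>M\<^sub>s(c(s, True), c(s, False))\<close> of the matrix in slot \<open>s\<close> has two index slots.
  \<open>slot_act P i j\<close> is the action of the matrix unit \<open>E\<^sub>i\<^sub>j\<close> on the index slots in \<open>P\<close>.\<close>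
definition slot_act :: "'s set \<Rightarrow> 'n \<Rightarrow> 'n \<Rightarrow> (('s \<Rightarrow> 'n) \<Rightarrow> 'b::comm_ring_1) \<Rightarrow> ('s \<Rightarrow> 'n) \<Rightarrow> 'b" where
  "slot_act P i j U c = (\<Sum>s\<in>P. if c s = i then U (c(s := j)) else 0)"

text \<open>The order of the two actions makes this a sum of operators A^* A,
  \<open>slot_act P j i\<close> being the transpose of \<open>slot_act P i j\<close>. The operator D
  is its sum over the row slots and the column slots.\<close>

definition slot_casimir :: "'s set \<Rightarrow> (('s \<Rightarrow> 'n::finite) \<Rightarrow> 'b::comm_ring_1) \<Rightarrow> ('s \<Rightarrow> 'n) \<Rightarrow> 'b" where
  "slot_casimir P U c = (\<Sum>i\<in>UNIV. \<Sum>j\<in>UNIV. slot_act P j i (slot_act P i j U) c)"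

lemma slot_act_lin:
  "slot_act P i j (\<lambda>c. \<Sum>k\<in>K. r k * v k c) = (\<lambda>c. \<Sum>k\<in>K. r k * slot_act P i j (v k) c)"
proof
  fix c
  have "slot_act P i j (\<lambda>c. \<Sum>k\<in>K. r k * v k c) c
      = (\<Sum>s\<in>P. \<Sum>k\<in>K. r k * (if c s = i then v k (c(s := j)) else 0))"
    unfolding slot_act_def by (intro sum.cong) auto
  then show "slot_act P i j (\<lambda>c. \<Sum>k\<in>K. r k * v k c) c = (\<Sum>k\<in>K. r k * slot_act P i j (v k) c)"
    unfolding slot_act_def sum_distrib_left by (subst (asm) sum.swap)
qed

lemma slot_casimir_lin:
  "slot_casimir P (\<lambda>c. \<Sum>k\<in>K. r k * v k c) = (\<lambda>c. \<Sum>k\<in>K. r k * slot_casimir P (v k) c)"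
  unfolding slot_casimir_def slot_act_lin sum_distrib_left
  by (rule ext, subst (2) sum.swap, subst sum.swap) (rule refl)

lemma slot_act_ring_map:
  assumes "ring_map f" shows "f (slot_act P i j U c) = slot_act P i j (\<lambda>c. f (U c)) c"
  unfolding slot_act_def ring_map_sum[OF assms]
  by (intro sum.cong) (auto simp: ring_map_0[OF assms])

lemma slot_casimir_ring_map:
  assumes "ring_map f" shows "f (slot_casimir P U c) = slot_casimir P (\<lambda>c. f (U c)) c"
  unfolding slot_casimir_def ring_map_sum[OF assms] slot_act_ring_map[OF assms] ..

text \<open>For each slot s, rewriting its index exchanges the terms with c s = i and those with c s
  = j. \<open>Y\<close> is separate from \<open>P\<close> because row and column slots act on the
  same index functions.\<close>

lemma slot_act_adjoint:
  fixes u v :: "('s \<Rightarrow> 'n::finite) \<Rightarrow> 'b::comm_ring_1"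
  assumes "P \<subseteq> Y" "finite Y"
  shows "(\<Sum>c\<in>Y \<rightarrow>\<^sub>E UNIV. v c * slot_act P i j u c) = (\<Sum>c\<in>Y \<rightarrow>\<^sub>E UNIV. slot_act P j i v c * u c)"
proof -
  let ?X = "Y \<rightarrow>\<^sub>E (UNIV :: 'n set)"
  have fin: "finite ?X" using assms(2) by (auto intro: finite_PiE)
  have "(\<Sum>c\<in>?X. v c * (if c s = i then u (c(s := j)) else 0))
      = (\<Sum>c\<in>?X. (if c s = j then v (c(s := i)) else 0) * u c)" if "s \<in> P" for s
  proof -
    have upd: "c(s := k) \<in> ?X" if "c \<in> ?X" for c k
      using that \<open>s \<in> P\<close> assms(1) by (auto simp: PiE_def extensional_def)
    have "(\<Sum>c\<in>?X. v c * (if c s = i then u (c(s := j)) else 0)) = (\<Sum>c\<in>{c\<in>?X. c s = i}. v c * u (c(s := j)))"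
      using fin by (intro sum.mono_neutral_cong_right) auto
    also have "\<dots> = (\<Sum>c\<in>{c\<in>?X. c s = j}. v (c(s := i)) * u c)"
      by (rule sum.reindex_bij_witness[of _ "\<lambda>c. c(s := i)" "\<lambda>c. c(s := j)"])
        (auto simp: upd simp del: PiE_UNIV_domain)
    also have "\<dots> = (\<Sum>c\<in>?X. (if c s = j then v (c(s := i)) else 0) * u c)"
      using fin by (intro sum.mono_neutral_cong_left) auto
    finally show ?thesis .
  qed
  then show ?thesis
    unfolding slot_act_def sum_distrib_left sum_distrib_right
    by (subst (1 2) sum.swap) (rule sum.cong[OF refl])
qed

lemma slot_casimir_adjoint:
  fixes u v :: "('s \<Rightarrow> 'n::finite) \<Rightarrow> 'b::comm_ring_1"
  assumes "P \<subseteq> Y" "finite Y"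
  shows "(\<Sum>c\<in>Y \<rightarrow>\<^sub>E UNIV. v c * slot_casimir P u c) = (\<Sum>c\<in>Y \<rightarrow>\<^sub>E UNIV. slot_casimir P v c * u c)"
proof -
  let ?X = "Y \<rightarrow>\<^sub>E (UNIV :: 'n set)"
  have "(\<Sum>c\<in>?X. v c * slot_casimir P u c) = (\<Sum>i\<in>UNIV. \<Sum>j\<in>UNIV. \<Sum>c\<in>?X. v c * slot_act P j i (slot_act P i j u) c)"
    unfolding slot_casimir_def sum_distrib_left by (subst sum.swap, subst (2) sum.swap) (rule refl)
  also have "\<dots> = (\<Sum>i\<in>UNIV. \<Sum>j\<in>UNIV. \<Sum>c\<in>?X. slot_act P j i (slot_act P i j v) c * u c)"
    by (simp add: slot_act_adjoint[OF assms])
  also have "\<dots> = (\<Sum>c\<in>?X. slot_casimir P v c * u c)"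
    unfolding slot_casimir_def sum_distrib_right by (subst sum.swap, subst (2) sum.swap) (rule refl)
  finally show ?thesis .
qed

lemma slot_casimir_square:
  fixes v :: "('s \<Rightarrow> 'n::finite) \<Rightarrow> 'b::comm_ring_1"
  assumes "P \<subseteq> Y" "finite Y"
  shows "(\<Sum>c\<in>Y \<rightarrow>\<^sub>E UNIV. v c * slot_casimir P v c)
      = (\<Sum>i\<in>UNIV. \<Sum>j\<in>UNIV. \<Sum>c\<in>Y \<rightarrow>\<^sub>E UNIV. slot_act P i j v c * slot_act P i j v c)"
proof -
  let ?X = "Y \<rightarrow>\<^sub>E (UNIV :: 'n set)"
  have "(\<Sum>c\<in>?X. v c * slot_casimir P v c) = (\<Sum>i\<in>UNIV. \<Sum>j\<in>UNIV. \<Sum>c\<in>?X. v c * slot_act P j i (slot_act P i j v) c)"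
    unfolding slot_casimir_def sum_distrib_left by (subst sum.swap, subst (2) sum.swap) (rule refl)
  then show ?thesis by (simp add: slot_act_adjoint[OF assms])
qed

text \<open>Positivity: over an ordered field the Casimir operator is a sum of squares \<open>A\<^sup>* A\<close>, among
  them the operators that count the occurrences of an index.\<close>
lemma slot_casimir_injective:
  fixes v :: "('s \<Rightarrow> 'n::finite) \<Rightarrow> 'q::linordered_field"
  assumes "P \<subseteq> Y" "Q \<subseteq> Y" "finite Y" "P \<noteq> {}"
    and 0: "\<And>c. c \<in> Y \<rightarrow>\<^sub>E UNIV \<Longrightarrow> slot_casimir P v c + slot_casimir Q v c = 0"
    and c: "c \<in> Y \<rightarrow>\<^sub>E UNIV"
  shows "v c = 0"
proof -
  let ?X = "Y \<rightarrow>\<^sub>E (UNIV :: 'n set)"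
  let ?q = "\<lambda>P i j. \<Sum>c\<in>?X. slot_act P i j v c * slot_act P i j v c"
  have fin: "finite ?X" using assms(3) by (auto intro: finite_PiE)
  have pos: "?q P i j \<ge> 0" for P i j by (rule sum_nonneg) simp
  have "(\<Sum>c\<in>?X. v c * (slot_casimir P v c + slot_casimir Q v c)) = 0" using 0 by simp
  then have "(\<Sum>i\<in>UNIV. \<Sum>j\<in>UNIV. ?q P i j) + (\<Sum>i\<in>UNIV. \<Sum>j\<in>UNIV. ?q Q i j) = 0"
    unfolding distrib_left sum.distrib
    unfolding slot_casimir_square[OF assms(1,3)] slot_casimir_square[OF assms(2,3)] .
  then have "(\<Sum>i\<in>UNIV. \<Sum>j\<in>UNIV. ?q P i j) = 0"
    using pos by (metis (no_types, lifting) add_nonneg_eq_0_iff sum_nonneg)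
  then have q: "?q P i j = 0" for i j
    using pos by (simp add: sum_nonneg_eq_0_iff sum_nonneg)
  obtain s where s: "s \<in> P" using assms(4) by blast
  \<comment> \<open>With i = j = c s the action multiplies \<open>v c\<close> by the number of slots
    of P that carry the index c s, which is positive because s is one of them.\<close>
  have "slot_act P (c s) (c s) v c * slot_act P (c s) (c s) v c = 0"
    using q[of "c s" "c s"] fin c by (subst (asm) sum_nonneg_eq_0_iff) auto
  then have "slot_act P (c s) (c s) v c = 0" by simp
  moreover have "slot_act P (c s) (c s) v c = (\<Sum>t\<in>P. if c t = c s then v c else 0)"
    unfolding slot_act_def by (intro sum.cong) (auto simp: fun_upd_idem)
  moreover have "(\<Sum>t\<in>P. if c t = c s then v c else 0) = of_nat (card {t\<in>P. c t = c s}) * v c"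
    using finite_subset[OF assms(1,3)] by (simp add: sum.inter_filter[symmetric])
  moreover have "card {t\<in>P. c t = c s} \<noteq> 0"
    using s finite_subset[OF assms(1,3)] by auto
  ultimately show ?thesis by simp
qed

text \<open>Entries of words instead of variables, so that a contraction, which may multiply two
  matrices, stays in the same class with one factor fewer. \<open>S\<close> is a set of labels, so
  that removing a factor needs no renumbering. True marks the row index, False the column
  index.\<close>

definition entry_prod ::
  "nat set \<Rightarrow> (nat \<Rightarrow> 'w list) \<Rightarrow> (nat \<times> bool \<Rightarrow> 'n::finite) \<Rightarrow> ('w \<times> 'n \<times> 'n,'k::comm_ring_1) mpoly" where
  "entry_prod S W c = (\<Prod>s\<in>S. word generic (W s) $ c (s, True) $ c (s, False))"

lemma entry_prod_cong:
  assumes "\<And>x. x \<in> S \<times> UNIV \<Longrightarrow> c x = c' x"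
  shows "entry_prod S W c = entry_prod S W c'"
  unfolding entry_prod_def
proof (rule prod.cong[OF refl])
  fix s assume "s \<in> S"
  then have "c (s, b) = c' (s, b)" for b by (intro assms) simp
  then show "word generic (W s) $ c (s, True) $ c (s, False) = word generic (W s) $ c' (s, True) $ c' (s, False)"
    by simp
qed

lemma slot_act_times:
  "slot_act (S \<times> {x}) k l U c = (\<Sum>s\<in>S. if c (s, x) = k then U (c((s, x) := l)) else 0)"
proof -
  have "S \<times> {x} = (\<lambda>s. (s, x)) ` S" by auto
  moreover have "inj_on (\<lambda>s. (s, x)) S" by (rule inj_onI) simp
  ultimately show ?thesis unfolding slot_act_def by (simp only: sum.reindex comp_def)
qed

text \<open>Leibniz rule: row indices transform under E_ij, column indices contragrediently, with
  the transposed unit and a minus sign.\<close>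

lemma inf_act_entry_prod:
  fixes c :: "nat \<times> bool \<Rightarrow> 'n::finite"
  assumes "finite S"
  shows "inf_act i j (entry_prod S W c :: ('w \<times> 'n \<times> 'n,'k::comm_ring_1) mpoly)
    = slot_act (S \<times> {True}) i j (entry_prod S W) c - slot_act (S \<times> {False}) j i (entry_prod S W) c"
proof -
  define M where "M s = (word generic (W s) :: ('w \<times> 'n \<times> 'n,'k) mpoly^'n^'n)" for s
  define R where "R s = (\<Prod>t\<in>S - {s}. M t $ c (t, True) $ c (t, False))" for s
  have rest: "entry_prod S W d = M s $ d (s, True) $ d (s, False) * R s"
    if "s \<in> S" "\<And>t x. t \<noteq> s \<Longrightarrow> d (t, x) = c (t, x)" for s d
  proof -
    have "entry_prod S W d = M s $ d (s, True) $ d (s, False) * (\<Prod>t\<in>S - {s}. M t $ d (t, True) $ d (t, False))"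
      unfolding entry_prod_def M_def[symmetric] by (rule prod.remove[OF assms that(1)])
    also have "(\<Prod>t\<in>S - {s}. M t $ d (t, True) $ d (t, False)) = R s"
      unfolding R_def using that(2) by (intro prod.cong) auto
    finally show ?thesis .
  qed
  have T: "entry_prod S W (c((s, True) := k)) = M s $ k $ c (s, False) * R s" if "s \<in> S" for s k
    using rest[OF that, of "c((s, True) := k)"] by simp
  have F: "entry_prod S W (c((s, False) := k)) = M s $ c (s, True) $ k * R s" if "s \<in> S" for s k
    using rest[OF that, of "c((s, False) := k)"] by simp
  have "inf_act i j (entry_prod S W c) = (\<Sum>s\<in>S. inf_act i j (M s $ c (s, True) $ c (s, False)) * R s)"
    unfolding entry_prod_def R_def M_def by (rule derivation_prod[OF derivation_inf_act assms])
  also have "\<dots> = (\<Sum>s\<in>S. (if c (s, True) = i then entry_prod S W (c((s, True) := j)) else 0)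
      - (if c (s, False) = j then entry_prod S W (c((s, False) := i)) else 0))"
  proof (rule sum.cong[OF refl])
    fix s assume s: "s \<in> S"
    have e: "inf_act i j (M s $ c (s, True) $ c (s, False))
       = (if c (s, True) = i then M s $ j $ c (s, False) else 0) - (if c (s, False) = j then M s $ c (s, True) $ i else 0)"
      unfolding M_def by (rule equivariantD[OF equivariant_word])
    have if_mult: "((if P then x else 0) - (if Q then y else 0)) * z = (if P then x * z else 0) - (if Q then y * z else 0)"
      for P Q and x y z :: "('w \<times> 'n \<times> 'n,'k) mpoly"
      by (simp add: left_diff_distrib)
    show "inf_act i j (M s $ c (s, True) $ c (s, False)) * R s
      = (if c (s, True) = i then entry_prod S W (c((s, True) := j)) else 0)
      - (if c (s, False) = j then entry_prod S W (c((s, False) := i)) else 0)"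
      unfolding e T[OF s] F[OF s] by (rule if_mult)
  qed
  also have "\<dots> = slot_act (S \<times> {True}) i j (entry_prod S W) c - slot_act (S \<times> {False}) j i (entry_prod S W) c"
    unfolding slot_act_times by (rule sum_subtractf)
  finally show ?thesis .
qed

lemma inf_act_slot_act: "inf_act i j (slot_act P k l U c) = slot_act P k l (\<lambda>c. inf_act i j (U c)) c"
  unfolding slot_act_def derivation_sum[OF derivation_inf_act]
  by (intro sum.cong) (auto simp: derivation_0[OF derivation_inf_act])

lemma slot_act_diff: "slot_act P i j (\<lambda>c. U c - V c) c = slot_act P i j U c - slot_act P i j V c"
  unfolding slot_act_def sum_subtractf[symmetric] by (intro sum.cong) auto

text \<open>Each \<open>inf_act\<close> is a row action minus a column action, which gives two pure
  terms, forming D, and two mixed ones. Slot actions have constant coefficients, so the outer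
  \<open>inf_act\<close> passes inside them and the actions come out in reversed order.\<close>

lemma casimir_entry_prod:
  fixes c :: "nat \<times> bool \<Rightarrow> 'n::finite"
  assumes "finite S"
  shows "casimir (entry_prod S W c :: ('w \<times> 'n \<times> 'n,'k::comm_ring_1) mpoly)
    = slot_casimir (S \<times> {True}) (entry_prod S W) c + slot_casimir (S \<times> {False}) (entry_prod S W) c
      - (\<Sum>i\<in>UNIV. \<Sum>j\<in>UNIV. slot_act (S \<times> {True}) j i (slot_act (S \<times> {False}) j i (entry_prod S W)) c)
      - (\<Sum>i\<in>UNIV. \<Sum>j\<in>UNIV. slot_act (S \<times> {False}) j i (slot_act (S \<times> {True}) j i (entry_prod S W)) c)"
proof -
  let ?u = "entry_prod S W :: _ \<Rightarrow> ('w \<times> 'n \<times> 'n,'k) mpoly"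
  let ?L = "S \<times> {True}" and ?R = "S \<times> {False}"
  have "casimir (?u c) = (\<Sum>i\<in>UNIV. \<Sum>j\<in>UNIV. (slot_act ?L j i (slot_act ?L i j ?u) c
      - slot_act ?L j i (slot_act ?R j i ?u) c)
      - (slot_act ?R i j (slot_act ?L i j ?u) c - slot_act ?R i j (slot_act ?R j i ?u) c))"
    unfolding casimir_def inf_act_entry_prod[OF assms] derivation_diff[OF derivation_inf_act]
      inf_act_slot_act slot_act_diff ..
  also have "\<dots> = slot_casimir ?L ?u c - (\<Sum>i\<in>UNIV. \<Sum>j\<in>UNIV. slot_act ?L j i (slot_act ?R j i ?u) c)
      - ((\<Sum>i\<in>UNIV. \<Sum>j\<in>UNIV. slot_act ?R i j (slot_act ?L i j ?u) c)
        - (\<Sum>i\<in>UNIV. \<Sum>j\<in>UNIV. slot_act ?R i j (slot_act ?R j i ?u) c))"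
    by (simp add: slot_casimir_def sum_subtractf)
  also have "(\<Sum>i\<in>UNIV. \<Sum>j\<in>UNIV. slot_act ?R i j (slot_act ?L i j ?u) c)
     = (\<Sum>i\<in>UNIV. \<Sum>j\<in>UNIV. slot_act ?R j i (slot_act ?L j i ?u) c)"
    by (rule sum.swap)
  also have "(\<Sum>i\<in>UNIV. \<Sum>j\<in>UNIV. slot_act ?R i j (slot_act ?R j i ?u) c) = slot_casimir ?R ?u c"
    unfolding slot_casimir_def by (rule sum.swap)
  finally show ?thesis by simp
qed

text \<open>The mixed terms contract an upper with a lower index; this splits off a trace or
  multiplies two of the matrices.\<close>
lemma contraction_casimir_good:
  fixes c :: "nat \<times> bool \<Rightarrow> 'n::finite" and I :: "('w,'k::comm_ring_1) mpoly set"
  assumes fin: "finite S" and st: "s \<in> S" "t \<in> S"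
    and IH: "\<And>S' W' (c' :: nat \<times> bool \<Rightarrow> 'n). finite S' \<Longrightarrow> card S' < card S \<Longrightarrow> entry_prod S' W' c' \<in> casimir_good I"
  shows "(\<Sum>i\<in>UNIV. entry_prod S W (c((s, True) := i, (t, False) := i)) :: ('w \<times> 'n \<times> 'n,'k) mpoly) \<in> casimir_good I"
proof -
  let ?M = "\<lambda>s. word generic (W s) :: ('w \<times> 'n \<times> 'n,'k) mpoly^'n^'n"
  let ?d = "\<lambda>i. c((s, True) := i, (t, False) := i)"
  let ?e = "\<lambda>c r. ?M r $ c (r, True) $ c (r, False)"
  have card: "card (S - {s}) < card S" using fin st(1) by (rule card_Diff1_less)
  have 1: "entry_prod S W (?d i) = ?e (?d i) s * (\<Prod>r\<in>S - {s}. ?e (?d i) r)" for i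
    unfolding entry_prod_def by (rule prod.remove[OF fin st(1)])
  show ?thesis
  proof (cases "s = t")
    case True
    have "(\<Prod>r\<in>S - {s}. ?e (?d i) r) = entry_prod (S - {s}) W c" for i
      unfolding entry_prod_def using True by (intro prod.cong) auto
    then have "(\<Sum>i\<in>UNIV. entry_prod S W (?d i)) = trace (?M s) * entry_prod (S - {s}) W c"
      unfolding 1 using True by (simp add: trace_def sum_distrib_right)
    then show ?thesis using casimir_good_trace_word[OF IH[OF _ card]] fin by simp
  next
    case False
    \<comment> \<open>The column of factor t is contracted with the row of factor s: the words are
      joined in this order, and the new factor at t inherits the column index of s.\<close>
    let ?W = "W(t := W t @ W s)"
    let ?c = "c((t, False) := c (s, False))"
    let ?R = "\<Prod>r\<in>S - {s} - {t}. ?e c r"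
    have t: "t \<in> S - {s}" using False st by auto
    have "(\<Prod>r\<in>S - {s}. ?e (?d i) r) = ?M t $ c (t, True) $ i * ?R" for i
    proof -
      have "(\<Prod>r\<in>S - {s}. ?e (?d i) r) = ?e (?d i) t * (\<Prod>r\<in>S - {s} - {t}. ?e (?d i) r)"
        using fin t by (intro prod.remove) auto
      also have "(\<Prod>r\<in>S - {s} - {t}. ?e (?d i) r) = ?R" by (intro prod.cong) auto
      also have "?e (?d i) t = ?M t $ c (t, True) $ i" using False by simp
      finally show ?thesis .
    qed
    then have "entry_prod S W (?d i) = ?M t $ c (t, True) $ i * ?M s $ i $ c (s, False) * ?R" for i
      unfolding 1 using False by (simp add: ac_simps)
    then have "(\<Sum>i\<in>UNIV. entry_prod S W (?d i)) = (?M t ** ?M s) $ c (t, True) $ c (s, False) * ?R"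
      by (simp add: matrix_matrix_mult_def sum_distrib_right)
    also have "\<dots> = entry_prod (S - {s}) ?W ?c"
    proof -
      have "entry_prod (S - {s}) ?W ?c = word generic (?W t) $ ?c (t, True) $ ?c (t, False)
        * (\<Prod>r\<in>S - {s} - {t}. word generic (?W r) $ ?c (r, True) $ ?c (r, False))"
        unfolding entry_prod_def using fin t by (intro prod.remove) auto
      also have "(\<Prod>r\<in>S - {s} - {t}. word generic (?W r) $ ?c (r, True) $ ?c (r, False)) = ?R"
        by (intro prod.cong) auto
      also have "word generic (?W t) $ ?c (t, True) $ ?c (t, False) = (?M t ** ?M s) $ c (t, True) $ c (s, False)"
        by (simp add: word_append)
      finally show ?thesis by (rule sym)
    qed
    finally show ?thesis using IH[OF _ card] fin by simp
  qed
qed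

text \<open>Both selected indices must equal j, which fixes j as c (s, x); both are then replaced by
  i, and the sum over i is a contraction. Which of x and y marks the row decides the roles of s and
  t.\<close>

lemma cross_term_casimir_good:
  fixes c :: "nat \<times> bool \<Rightarrow> 'n::finite" and I :: "('w,'k::comm_ring_1) mpoly set"
  assumes fin: "finite S"
    and IH: "\<And>S' W' (c' :: nat \<times> bool \<Rightarrow> 'n). finite S' \<Longrightarrow> card S' < card S \<Longrightarrow> entry_prod S' W' c' \<in> casimir_good I"
    and x: "x \<noteq> y"
  shows "(\<Sum>i\<in>UNIV. \<Sum>j\<in>UNIV. slot_act (S \<times> {x}) j i (slot_act (S \<times> {y}) j i
      (entry_prod S W :: _ \<Rightarrow> ('w \<times> 'n \<times> 'n,'k) mpoly)) c) \<in> casimir_good I"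
proof -
  let ?u = "entry_prod S W :: _ \<Rightarrow> ('w \<times> 'n \<times> 'n,'k) mpoly"
  have "(\<Sum>i\<in>UNIV. \<Sum>j\<in>UNIV. slot_act (S \<times> {x}) j i (slot_act (S \<times> {y}) j i ?u) c)
     = (\<Sum>i\<in>UNIV. \<Sum>j\<in>UNIV. \<Sum>s\<in>S. \<Sum>t\<in>S. if j = c (s, x) then
         (if c (t, y) = c (s, x) then ?u (c((s, x) := i, (t, y) := i)) else 0) else 0)"
    unfolding slot_act_times using x by (intro sum.cong refl) (auto intro!: sum.cong)
  also have "\<dots> = (\<Sum>s\<in>S. \<Sum>t\<in>S. \<Sum>i\<in>UNIV. \<Sum>j\<in>UNIV. if j = c (s, x) then
         (if c (t, y) = c (s, x) then ?u (c((s, x) := i, (t, y) := i)) else 0) else 0)"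
    by (subst (2) sum.swap, subst sum.swap, rule sum.cong[OF refl],
        subst (2) sum.swap, subst sum.swap) (rule refl)
  also have "\<dots> = (\<Sum>s\<in>S. \<Sum>t\<in>S. if c (t, y) = c (s, x) then
         (\<Sum>i\<in>UNIV. ?u (c((s, x) := i, (t, y) := i))) else 0)"
    by (intro sum.cong refl) simp
  also have "\<dots> \<in> casimir_good I"
  proof (intro casimir_good_sum)
    fix s t assume st: "s \<in> S" "t \<in> S"
    have "(\<Sum>i\<in>UNIV. ?u (c((s, x) := i, (t, y) := i))) \<in> casimir_good I"
    proof (cases x)
      case True
      then show ?thesis using contraction_casimir_good[OF fin st IH, of W c] x by simp
    next
      case False
      then have "(c((s, x) := i, (t, y) := i)) = (c((t, True) := i, (s, False) := i))" for i
        using x by (auto simp: fun_eq_iff)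
      then show ?thesis using contraction_casimir_good[OF fin st(2,1) IH, of W c] by simp
    qed
    then show "(if c (t, y) = c (s, x) then (\<Sum>i\<in>UNIV. ?u (c((s, x) := i, (t, y) := i))) else 0) \<in> casimir_good I"
      by (simp add: casimir_good_0)
  qed
  finally show ?thesis .
qed

lemma ring_map_of_rat: "ring_map (\<lambda>q. pconst (of_rat q :: 'k::field_char_0) :: ('v,'k) mpoly)"
  by (simp add: ring_map_def of_rat_add of_rat_mult pconst_add pconst_mult)

text \<open>Modulo products of fewer factors, good by induction, the Casimir operator acts on
  combinations of products with fixed words through the operator D on coefficient vectors. A
  polynomial with constant term 1 that kills the coefficient vector of one product therefore sends
  that product to a good element.\<close>

lemma entry_prod_casimir_good:
  fixes c :: "nat \<times> bool \<Rightarrow> 'n::finite" and I :: "('w,'k::field_char_0) mpoly set"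
  assumes "finite S"
  shows "(entry_prod S W c :: ('w \<times> 'n \<times> 'n,'k) mpoly) \<in> casimir_good I"
  using assms
proof (induction "card S" arbitrary: S W c rule: less_induct)
  case less
  note fin = less.prems
  let ?u = "entry_prod S W :: _ \<Rightarrow> ('w \<times> 'n \<times> 'n,'k) mpoly"
  let ?L = "S \<times> {True}" and ?R = "S \<times> {False}" and ?Y = "S \<times> (UNIV :: bool set)"
  let ?X = "?Y \<rightarrow>\<^sub>E (UNIV :: 'n set)"
  show ?case
  proof (cases "S = {}")
    case True
    then show ?thesis by (simp add: entry_prod_def tr_span_casimir_good tr_span_1)
  next
    case False
    have finY: "finite ?Y" using fin by simp
    have finX: "finite ?X" using finY by (auto intro: finite_PiE)
    have sub: "?L \<subseteq> ?Y" "?R \<subseteq> ?Y" by auto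
    define c0 where "c0 = restrict c ?Y"
    have c0: "c0 \<in> ?X" by (auto simp: c0_def)
    have uc0: "?u c0 = ?u c" by (rule entry_prod_cong) (auto simp: c0_def)
    define \<iota> where "\<iota> q = (pconst (of_rat q) :: ('w \<times> 'n \<times> 'n,'k) mpoly)" for q
    have \<iota>: "ring_map \<iota>" unfolding \<iota>_def[abs_def] by (rule ring_map_of_rat)
    \<comment> \<open>D on rational coefficient vectors, where positivity is available;
      \<open>\<iota>\<close> carries the coefficients into the polynomial ring.\<close>
    define T where "T v c = slot_casimir ?L v c + slot_casimir ?R v c" for v :: "_ \<Rightarrow> rat" and c :: "nat \<times> bool \<Rightarrow> 'n"
    define e where "e d = (if d = c0 then 1 else 0 :: rat)" for d
    have "\<exists>N r. r 0 = 1 \<and> (\<forall>c\<in>?X. (\<Sum>k\<le>N. r k * (T ^^ k) e c) = 0)"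
    proof (rule injective_operator_relation[OF finX])
      show "T (\<lambda>c. \<Sum>k\<in>K. r k * v k c) = (\<lambda>c. \<Sum>k\<in>K. r k * T (v k) c)" for K :: "nat set" and r v
        unfolding T_def[abs_def] slot_casimir_lin by (simp add: distrib_left sum.distrib)
      show "v c = 0" if "\<And>c. c \<in> ?X \<Longrightarrow> T v c = 0" "c \<in> ?X" for v c
        using slot_casimir_injective[OF sub finY, of v c] that False unfolding T_def by blast
    qed
    then obtain N r where r: "r 0 = 1" "\<And>c. c \<in> ?X \<Longrightarrow> (\<Sum>k\<le>N. r k * (T ^^ k) e c) = 0" by blast
    define ev where "ev v = (\<Sum>d\<in>?X. \<iota> (v d) * ?u d)" for v
    have IH: "entry_prod S' W' c' \<in> casimir_good I"
      if "finite S'" "card S' < card S" for S' W' and c' :: "nat \<times> bool \<Rightarrow> 'n"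
      using less.hyps[OF that(2,1)] .
    \<comment> \<open>Self-adjointness moves D from the products to the coefficients; what remains
      of the Casimir operator are the mixed terms.\<close>
    have step: "casimir (ev v) - ev (T v) \<in> casimir_good I" for v
    proof -
      have "ev (T v) = (\<Sum>d\<in>?X. slot_casimir ?L (\<lambda>d. \<iota> (v d)) d * ?u d) + (\<Sum>d\<in>?X. slot_casimir ?R (\<lambda>d. \<iota> (v d)) d * ?u d)"
        by (simp add: ev_def T_def ring_map_add[OF \<iota>] slot_casimir_ring_map[OF \<iota>] distrib_right sum.distrib)
      also have "\<dots> = (\<Sum>d\<in>?X. \<iota> (v d) * (slot_casimir ?L ?u d + slot_casimir ?R ?u d))"
        unfolding slot_casimir_adjoint[OF sub(1) finY, symmetric] slot_casimir_adjoint[OF sub(2) finY, symmetric]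
        by (simp add: distrib_left sum.distrib)
      finally have evT: "ev (T v) = (\<Sum>d\<in>?X. \<iota> (v d) * (slot_casimir ?L ?u d + slot_casimir ?R ?u d))" .
      have "casimir (ev v) = (\<Sum>d\<in>?X. \<iota> (v d) * casimir (?u d))"
        by (simp add: ev_def casimir_sum \<iota>_def casimir_pconst_mult)
      then have "casimir (ev v) - ev (T v)
         = (\<Sum>d\<in>?X. \<iota> (v d) * (casimir (?u d) - (slot_casimir ?L ?u d + slot_casimir ?R ?u d)))"
        unfolding evT by (simp add: right_diff_distrib sum_subtractf)
      also have "\<dots> \<in> casimir_good I"
        unfolding \<iota>_def casimir_entry_prod[OF fin]
      proof (intro casimir_good_sum casimir_good_pconst_mult)
        fix d
        from casimir_good_add[OF cross_term_casimir_good[OF fin IH, of True False W d]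
            cross_term_casimir_good[OF fin IH, of False True W d]]
        have "- ((\<Sum>i\<in>UNIV. \<Sum>j\<in>UNIV. slot_act ?L j i (slot_act ?R j i ?u) d)
           + (\<Sum>i\<in>UNIV. \<Sum>j\<in>UNIV. slot_act ?R j i (slot_act ?L j i ?u) d)) \<in> casimir_good I"
          by (intro casimir_good_uminus) simp
        then show "slot_casimir ?L ?u d + slot_casimir ?R ?u d
          - (\<Sum>i\<in>UNIV. \<Sum>j\<in>UNIV. slot_act ?L j i (slot_act ?R j i ?u) d)
          - (\<Sum>i\<in>UNIV. \<Sum>j\<in>UNIV. slot_act ?R j i (slot_act ?L j i ?u) d)
          - (slot_casimir ?L ?u d + slot_casimir ?R ?u d) \<in> casimir_good I"
          by (simp add: algebra_simps)
      qed
      finally show ?thesis .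
    qed
    have ev_e: "ev e = ?u c0"
    proof -
      have "ev e = (\<Sum>d\<in>?X. if d = c0 then ?u d else 0)"
        unfolding ev_def e_def by (intro sum.cong) (auto simp: ring_map_0[OF \<iota>] ring_map_1[OF \<iota>])
      then show ?thesis using finX c0 by simp
    qed
    have powers: "(casimir ^^ k) (?u c0) - ev ((T ^^ k) e) \<in> casimir_good I" for k
    proof (induction k)
      case 0
      show ?case by (simp add: ev_e casimir_good_0)
    next
      case (Suc k)
      have "casimir ((casimir ^^ k) (?u c0) - ev ((T ^^ k) e)) + (casimir (ev ((T ^^ k) e)) - ev (T ((T ^^ k) e)))
         \<in> casimir_good I"
        by (intro casimir_good_add casimir_good_casimir Suc step)
      moreover have "casimir ((casimir ^^ k) (?u c0) - ev ((T ^^ k) e)) + casimir (ev ((T ^^ k) e)) = casimir ((casimir ^^ k) (?u c0))"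
        by (simp add: casimir_add[symmetric])
      ultimately show ?case by (simp add: add_diff_eq)
    qed
    \<comment> \<open>By the relation for the unit vector \<open>e\<close> this combination
      vanishes, so the polynomial in the Casimir operator yields a combination of the good
      differences in \<open>powers\<close>.\<close>
    have "(\<Sum>k\<le>N. \<iota> (r k) * ev ((T ^^ k) e)) = (\<Sum>d\<in>?X. \<iota> (\<Sum>k\<le>N. r k * (T ^^ k) e d) * ?u d)"
      unfolding ev_def ring_map_sum[OF \<iota>] ring_map_mult[OF \<iota>] sum_distrib_left sum_distrib_right
      by (subst sum.swap) (simp add: mult.assoc)
    also have "\<dots> = 0" using r(2) by (simp add: ring_map_0[OF \<iota>])
    finally have "(\<Sum>k\<le>N. \<iota> (r k) * (casimir ^^ k) (?u c0))
       = (\<Sum>k\<le>N. \<iota> (r k) * ((casimir ^^ k) (?u c0) - ev ((T ^^ k) e)))"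
      by (simp add: right_diff_distrib sum_subtractf)
    also have "\<dots> \<in> casimir_good I"
      unfolding \<iota>_def by (intro casimir_good_sum casimir_good_pconst_mult powers)
    finally have "casimir_poly (\<Sum>k\<le>N. monom (of_rat (r k)) k) (?u c0) \<in> casimir_good I"
      by (simp add: casimir_poly_sum casimir_poly_monom \<iota>_def)
    moreover have "coeff (\<Sum>k\<le>N. monom (of_rat (r k) :: 'k) k) 0 = 1"
      by (simp add: coeff_sum r(1))
    ultimately have "?u c0 \<in> casimir_good I" by (rule casimir_good_trans)
    then show ?thesis by (simp add: uc0)
  qed
qed

section \<open>Generation of the matrix invariants\<close>

lemma casimir_good_UNIV:
  fixes p :: "('w \<times> 'n::finite \<times> 'n,'k::field_char_0) mpoly"
  shows "p \<in> casimir_good I"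
proof (induction p rule: mpoly_monomial_induct)
  case (single m a)
  let ?xs = "mono_list m"
  \<comment> \<open>Each variable of the monomial is an entry of a one-letter word;
    \<open>?c\<close> reads off its row and column.\<close>
  let ?c = "\<lambda>(s, b). case ?xs ! s of (w, i, j) \<Rightarrow> if b then i else j"
  have "(pvar (?xs ! s) :: ('w \<times> 'n \<times> 'n,'k) mpoly) = word generic [fst (?xs ! s)] $ ?c (s, True) $ ?c (s, False)" for s
    by (cases "?xs ! s") (simp add: generic_def)
  then have "(entry_prod {..<length ?xs} (\<lambda>s. [fst (?xs ! s)]) ?c :: ('w \<times> 'n \<times> 'n,'k) mpoly)
     = (\<Prod>s<length ?xs. pvar (?xs ! s))"
    unfolding entry_prod_def by simp
  also have "\<dots> = prod_list (map pvar ?xs)"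
    by (simp add: prod.list_conv_set_nth atLeast0LessThan)
  also have "\<dots> = pmon m" by (simp add: prod_list_mono_list pmon_eq_mon_eval)
  finally have "(pmon m :: ('w \<times> 'n \<times> 'n,'k) mpoly) \<in> casimir_good I"
    using entry_prod_casimir_good[of "{..<length ?xs}"] by (metis finite_lessThan)
  then show ?case by (simp add: single_eq_pconst casimir_good_pconst_mult)
qed (rule casimir_good_add)

lemma rep_invariant_generated:
  fixes p :: "('w \<times> 'n::finite \<times> 'n,'k::field_char_0) mpoly"
  assumes "rep_invariant I p"
  shows "\<exists>Phi\<in>TPoly. p - poly_eval tr_mon Phi \<in> rep_ideal I"
proof -
  obtain h where h: "coeff h 0 = 1" "casimir_poly h p \<in> tr_span I"
    using casimir_good_UNIV[of p I] unfolding casimir_good_def by blast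
  have cas: "casimir p \<in> rep_ideal I"
    unfolding casimir_def
    by (intro is_ideal_sum[OF is_ideal_rep_ideal] inf_act_rep_ideal rep_invariant_inf_act assms)
  \<comment> \<open>Writing h = 1 + X g gives p = h(C) p - g(C) (C p), with the first term in the
    trace ring modulo the ideal and the second in the ideal.\<close>
  obtain g where g: "h = pCons 1 g" using h(1) by (cases h) auto
  have "casimir_poly g (casimir p) \<in> rep_ideal I"
    by (rule casimir_poly_closed)
      (auto intro: is_ideal_add[OF is_ideal_rep_ideal] is_ideal_mult[OF is_ideal_rep_ideal] casimir_rep_ideal cas)
  then have "- casimir_poly g (casimir p) \<in> rep_ideal I" by (rule is_ideal_uminus[OF is_ideal_rep_ideal])
  from tr_span_add[OF h(2) tr_span_rep_ideal[OF this]]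
  have "p \<in> tr_span I" by (simp add: g casimir_poly_pCons casimir_poly_linear)
  then show ?thesis unfolding tr_span_def by blast
qed

theorem mainTheorem10:
  fixes I :: "('w, 'k::field_char_0) mpoly set"
  assumes "is_ideal I"
  shows
   "(\<forall>mu. rep_invariant I (tr_mon mu :: (('w \<times> 'n::finite \<times> 'n),'k) mpoly))
    \<and> (\<forall>p :: (('w \<times> 'n \<times> 'n),'k) mpoly. rep_invariant I p \<longrightarrow>
         (\<exists>Phi\<in>TPoly. p - poly_eval tr_mon Phi \<in> rep_ideal I))
    \<and> (\<forall>Phi\<in>TPoly. (poly_eval tr_mon Phi :: (('w \<times> 'n \<times> 'n),'k) mpoly) \<in> rep_ideal I
         \<longleftrightarrow> Phi \<in> trace_relations CARD('n) I)
    \<and> (\<forall>mu. tens_invariant I (e1_mon mu :: (('w \<times> 'n),'k) mpoly))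
    \<and> (\<forall>p :: (('w \<times> 'n),'k) mpoly. tens_invariant I p \<longrightarrow>
         (\<exists>Phi\<in>TPoly. p - poly_eval e1_mon Phi \<in> tens_ideal I))
    \<and> (\<forall>Phi\<in>TPoly. (poly_eval e1_mon Phi :: (('w \<times> 'n),'k) mpoly) \<in> tens_ideal I
         \<longleftrightarrow> Phi \<in> trace_relations CARD('n) I)"
proof -
  \<comment> \<open>This closes the circle between the two kernels and the trace relations. Together
    with \<open>trace_relations_tr\<close> it also shows that the trace relations vanish on the
    symmetric tensors.\<close>
  have tr_e1: "(poly_eval e1_mon Phi :: (('w \<times> 'n),'k) mpoly) \<in> tens_ideal I"
    if "(poly_eval tr_mon Phi :: (('w \<times> 'n \<times> 'n),'k) mpoly) \<in> rep_ideal I" for Phi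
    using diag_restrict_rep_ideal[OF that] by (simp add: diag_restrict_poly_eval_tr)
  show ?thesis
    using rep_invariant_tr_mon rep_invariant_generated tens_invariant_e1_mon tens_invariant_generated
      trace_relations_tr tens_kernel[OF assms] tr_e1
    by (intro conjI allI ballI impI iffI) blast+
qed

end
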